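(* Let $\mathcal{H}$ be a separable normalized complete Nevanlinna--Pick space that satisfies the column-row property with constant $\kappa$. Then $\mathrm{Mult}(\mathcal{H}) = \mathrm{Mult}(\mathcal{H}\odot\mathcal{H})$ and $$\|\theta\|_{\mathrm{Mult}(\mathcal{H}\odot\mathcal{H})} \le \|\theta\|_{\mathrm{Mult}(\mathcal{H})} \le \kappa\,\|\theta\|_{\mathrm{Mult}(\mathcal{H}\odot\mathcal{H})}$$ for every $\theta\in\mathrm{Mult}(\mathcal{H})$.
   Context: A normalized complete Nevanlinna--Pick space on a set $X$ is a reproducing kernel Hilbert space $\mathcal{H}$ of complex-valued functions on $X$ whose reproducing kernel has the form $K(z,w) = \frac{1}{1-\langle b(z), b(w)\rangle}$, where $b$ maps $X$ into the open unit ball of an auxiliary Hilbert space and $b(z_0)=0$ for some $z_0 \in X$. Weak product: $\mathcal{H}\odot\mathcal{H} = \{ h = \sum_{i=1}^\infty f_i g_i : f_i,g_i\in\mathcal{H},\ \sum_{i=1}^\infty \|f_i\|\|g_i\| < \infty\}$, with norm $\|h\| = \inf\{\sum_i \|f_i\|\|g_i\| : h = \sum_i f_i g_i\}$. It is a Banach space of functions on $X$ with continuous point evaluations. For a Banach function space $\mathcal{B}$ on $X$ (in particular $\mathcal{B}=\mathcal{H}$ or $\mathcal{H}\odot\mathcal{H}$), $\mathrm{Mult}(\mathcal{B}) = \{\varphi: X\to\mathbb{C} : \varphi f\in\mathcal{B} \text{ for all } f\in\mathcal{B}\}$, and $\|\varphi\|_{\mathrm{Mult}(\mathcal{B})}$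 is the operator norm of $f\mapsto\varphi f$ on $\mathcal{B}$ (finite by the closed graph theorem). $\mathcal{H}$ satisfies the column-row property with constant $\kappa$ if, whenever $(\varphi_n)_{n\ge1}$ is a sequence in $\mathrm{Mult}(\mathcal{H})$ such that the column operator $\mathcal{H}\to\mathcal{H}\otimes\ell^2$, $f\mapsto(\varphi_n f)_n$, has norm at most $1$, the row operator $\mathcal{H}\otimes\ell^2\to\mathcal{H}$, $(f_n)_n\mapsto\sum_n\varphi_n f_n$, is bounded with norm at most $\kappa$. *)

theory Defs
  imports "HOL-Analysis.Analysis" "HOL-Library.Function_Algebras"
begin

text \<open>The set \<open>X\<close> is the type \<open>'x\<close>. Sums and products of functions on \<open>X\<close> are
  the pointwise ones of \<^theory>\<open>HOL-Library.Function_Algebras\<close>.\<close>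

definition ip_norm :: "('v \<Rightarrow> 'v \<Rightarrow> complex) \<Rightarrow> 'v \<Rightarrow> real" where
  "ip_norm ip v = sqrt (Re (ip v v))"

text \<open>The underlying set of the Hilbert space is a subspace \<open>V\<close> of the ambient complex vector
  space, and \<open>ip\<close> is unconstrained off \<open>V\<close>. Inner products are linear in the first argument.\<close>

locale complex_hilbert_space = vector_space scale
  for scale :: "complex \<Rightarrow> 'v::ab_group_add \<Rightarrow> 'v" +
  fixes V :: "'v set" and ip :: "'v \<Rightarrow> 'v \<Rightarrow> complex"
  assumes subspace_V: "subspace V"
    and ip_add_left: "\<lbrakk>u \<in> V; v \<in> V; w \<in> V\<rbrakk> \<Longrightarrow> ip (u + v) w = ip u w + ip v w"
    and ip_scale_left: "\<lbrakk>v \<in> V; w \<in> V\<rbrakk> \<Longrightarrow> ip (scale c v) w = c * ip v w"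
    and ip_commute: "\<lbrakk>v \<in> V; w \<in> V\<rbrakk> \<Longrightarrow> ip w v = cnj (ip v w)"
    and ip_ge_zero: "v \<in> V \<Longrightarrow> 0 \<le> Re (ip v v)"
    and ip_eq_zero: "\<lbrakk>v \<in> V; ip v v = 0\<rbrakk> \<Longrightarrow> v = 0"
    and complete: "\<lbrakk>\<And>n. s n \<in> V;
        \<forall>e>0. \<exists>N. \<forall>m\<ge>N. \<forall>n\<ge>N. ip_norm ip (s m - s n) < e\<rbrakk>
      \<Longrightarrow> \<exists>l\<in>V. (\<lambda>n. ip_norm ip (s n - l)) \<longlonglongrightarrow> 0"

locale rkhs = complex_hilbert_space "\<lambda>c f z. c * f z" H ip
  for H :: "('x \<Rightarrow> complex) set" and ip :: "('x \<Rightarrow> complex) \<Rightarrow> ('x \<Rightarrow> complex) \<Rightarrow> complex" +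
  assumes bounded_evaluation: "\<exists>C. \<forall>f\<in>H. cmod (f z) \<le> C * ip_norm ip f"

definition reproducing_kernel ::
  "('x \<Rightarrow> complex) set \<Rightarrow> (('x \<Rightarrow> complex) \<Rightarrow> ('x \<Rightarrow> complex) \<Rightarrow> complex)
    \<Rightarrow> ('x \<Rightarrow> 'x \<Rightarrow> complex) \<Rightarrow> bool" where
  "reproducing_kernel H ip K \<longleftrightarrow>
    (\<forall>w. (\<lambda>z. K z w) \<in> H \<and> (\<forall>f\<in>H. f w = ip f (\<lambda>z. K z w)))"

text \<open>The auxiliary Hilbert space \<open>E\<close> and the map \<open>b\<close> are parameters, because HOL cannot quantify
  existentially over the type in which \<open>E\<close> lives.\<close>

locale normalized_cnp_space =
  rkhs H ip + aux: complex_hilbert_space scaleE E ipE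
  for H :: "('x \<Rightarrow> complex) set" and ip
    and scaleE :: "complex \<Rightarrow> 'e::ab_group_add \<Rightarrow> 'e" and E ipE +
  fixes b :: "'x \<Rightarrow> 'e"
  assumes b_in: "b z \<in> E"
    and b_ball: "ip_norm ipE (b z) < 1"
    and b_zero: "\<exists>z0. b z0 = 0"
    and kernel: "reproducing_kernel H ip (\<lambda>z w. 1 / (1 - ipE (b z) (b w)))"

definition separable :: "('x \<Rightarrow> complex) set \<Rightarrow> (('x \<Rightarrow> complex) \<Rightarrow> ('x \<Rightarrow> complex) \<Rightarrow> complex) \<Rightarrow> bool"
  where
  "separable H ip \<longleftrightarrow>
    (\<exists>D\<subseteq>H. countable D \<and> (\<forall>f\<in>H. \<forall>e>0. \<exists>d\<in>D. ip_norm ip (f - d) < e))"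

definition product_representation ::
  "('x \<Rightarrow> complex) set \<Rightarrow> (('x \<Rightarrow> complex) \<Rightarrow> ('x \<Rightarrow> complex) \<Rightarrow> complex) \<Rightarrow> ('x \<Rightarrow> complex)
    \<Rightarrow> (nat \<Rightarrow> 'x \<Rightarrow> complex) \<Rightarrow> (nat \<Rightarrow> 'x \<Rightarrow> complex) \<Rightarrow> bool" where
  "product_representation H ip h f g \<longleftrightarrow>
    (\<forall>i. f i \<in> H \<and> g i \<in> H) \<and>
    summable (\<lambda>i. ip_norm ip (f i) * ip_norm ip (g i)) \<and>
    (\<forall>z. (\<lambda>i. f i z * g i z) sums h z)"

definition weak_product ::
  "('x \<Rightarrow> complex) set \<Rightarrow> (('x \<Rightarrow> complex) \<Rightarrow> ('x \<Rightarrow> complex) \<Rightarrow> complex) \<Rightarrow> ('x \<Rightarrow> complex) set"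
  where
  "weak_product H ip = {h. \<exists>f g. product_representation H ip h f g}"

definition weak_product_norm ::
  "('x \<Rightarrow> complex) set \<Rightarrow> (('x \<Rightarrow> complex) \<Rightarrow> ('x \<Rightarrow> complex) \<Rightarrow> complex) \<Rightarrow> ('x \<Rightarrow> complex) \<Rightarrow> real"
  where
  "weak_product_norm H ip h =
    Inf {(\<Sum>i. ip_norm ip (f i) * ip_norm ip (g i)) | f g. product_representation H ip h f g}"

definition Mult :: "('x \<Rightarrow> complex) set \<Rightarrow> ('x \<Rightarrow> complex) set" where
  "Mult B = {\<phi>. \<forall>f\<in>B. \<phi> * f \<in> B}"

text \<open>The real supremum is meaningful since multiplication operators on a Banach function space
  are bounded, by the closed graph theorem.\<close>

definition mult_norm :: "('x \<Rightarrow> complex) set \<Rightarrow> (('x \<Rightarrow> complex) \<Rightarrow> real) \<Rightarrow> ('x \<Rightarrow> complex) \<Rightarrow> real"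
  where
  "mult_norm B nrm \<phi> = (SUP f\<in>{f\<in>B. nrm f \<le> 1}. nrm (\<phi> * f))"

text \<open>The Hilbert space tensor product of \<open>H\<close> with \<open>\<ell>\<^sup>2\<close> is realised as the space of
  square-summable \<open>H\<close>-valued sequences.\<close>

definition tensor_l2 ::
  "('x \<Rightarrow> complex) set \<Rightarrow> (('x \<Rightarrow> complex) \<Rightarrow> ('x \<Rightarrow> complex) \<Rightarrow> complex)
    \<Rightarrow> (nat \<Rightarrow> 'x \<Rightarrow> complex) set" where
  "tensor_l2 H ip = {F. (\<forall>n. F n \<in> H) \<and> summable (\<lambda>n. (ip_norm ip (F n))\<^sup>2)}"

definition tensor_l2_norm ::
  "(('x \<Rightarrow> complex) \<Rightarrow> ('x \<Rightarrow> complex) \<Rightarrow> complex) \<Rightarrow> (nat \<Rightarrow> 'x \<Rightarrow> complex) \<Rightarrow> real" where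
  "tensor_l2_norm ip F = sqrt (\<Sum>n. (ip_norm ip (F n))\<^sup>2)"

definition column_norm_le ::
  "('x \<Rightarrow> complex) set \<Rightarrow> (('x \<Rightarrow> complex) \<Rightarrow> ('x \<Rightarrow> complex) \<Rightarrow> complex)
    \<Rightarrow> (nat \<Rightarrow> 'x \<Rightarrow> complex) \<Rightarrow> real \<Rightarrow> bool" where
  "column_norm_le H ip \<phi> C \<longleftrightarrow>
    (\<forall>f\<in>H. (\<lambda>n. \<phi> n * f) \<in> tensor_l2 H ip \<and>
      tensor_l2_norm ip (\<lambda>n. \<phi> n * f) \<le> C * ip_norm ip f)"

text \<open>The series defining the row operator is required to converge in the norm of \<open>H\<close>. This is
  automatic once the operator is bounded on finitely supported sequences.\<close>

definition row_norm_le ::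
  "('x \<Rightarrow> complex) set \<Rightarrow> (('x \<Rightarrow> complex) \<Rightarrow> ('x \<Rightarrow> complex) \<Rightarrow> complex)
    \<Rightarrow> (nat \<Rightarrow> 'x \<Rightarrow> complex) \<Rightarrow> real \<Rightarrow> bool" where
  "row_norm_le H ip \<phi> C \<longleftrightarrow>
    (\<forall>F\<in>tensor_l2 H ip. \<exists>h\<in>H.
      (\<lambda>N. ip_norm ip ((\<Sum>n<N. \<phi> n * F n) - h)) \<longlonglongrightarrow> 0 \<and>
      ip_norm ip h \<le> C * tensor_l2_norm ip F)"

definition column_row_property ::
  "('x \<Rightarrow> complex) set \<Rightarrow> (('x \<Rightarrow> complex) \<Rightarrow> ('x \<Rightarrow> complex) \<Rightarrow> complex) \<Rightarrow> real \<Rightarrow> bool" where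
  "column_row_property H ip \<kappa> \<longleftrightarrow>
    (\<forall>\<phi>. (\<forall>n. \<phi> n \<in> Mult H) \<and> column_norm_le H ip \<phi> 1 \<longrightarrow> row_norm_le H ip \<phi> \<kappa>)"

end

theory Submission
  imports Defs "HOL-Library.Sublist"
begin

text \<open>Only the bound \<open>\<parallel>\<theta>\<parallel>\<^bsub>Mult(H)\<^esub> \<le> \<kappa> \<parallel>\<theta>\<parallel>\<^bsub>Mult(H \<odot> H)\<^esub>\<close> is difficult. A function of norm \<open>\<le> 1\<close> in
  \<open>H \<otimes> \<ell>\<^sup>2\<close> is a contractive column multiplier applied to a function of norm \<open>\<le> 1\<close> in \<open>H\<close>: lift it
  to the full Fock space and use inner-outer (Beurling) factorization there. Let \<open>\<theta>\<close> have norm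
  \<open>< M\<close> on \<open>H \<odot> H\<close>. If \<open>f = (f\<^sub>j)\<close> is a finite family, write \<open>f\<^sub>j = \<alpha>\<^sub>j F\<close>; representing
  \<open>\<theta> F g = \<Sum> a\<^sub>i \<gamma>\<^sub>i\<close> and dividing by \<open>F\<close> gives \<open>\<theta> g = \<Sum> \<phi>\<^sub>i \<gamma>\<^sub>i\<close> with
  \<open>\<Sum> \<parallel>\<gamma>\<^sub>i\<parallel>\<^sup>2 \<le> \<parallel>g\<parallel>\<^sup>2\<close> and \<open>\<Sum>\<^sub>i\<^sub>j \<parallel>\<phi>\<^sub>i f\<^sub>j\<parallel>\<^sup>2 \<le> M\<^sup>2 \<Sum>\<^sub>j \<parallel>f\<^sub>j\<parallel>\<^sup>2\<close>. By minimax the latter can be achieved for each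
  \<open>f\<^sub>j\<close> separately. Factoring \<open>\<gamma>\<^sub>i = \<beta>\<^sub>i G\<close>, the column-row property bounds \<open>\<psi> = \<Sum> \<phi>\<^sub>i \<beta>\<^sub>i\<close> on every \<open>f\<^sub>j\<close> by
  \<open>\<kappa> M\<close>, and \<open>\<theta> g = \<psi> G\<close>. By Tychonoff's theorem \<open>\<psi>\<close> and \<open>G\<close> can be chosen such that \<open>\<psi>\<close> is bounded by
  \<open>\<kappa> M\<close> on all of \<open>H\<close>, so that \<open>\<parallel>\<theta> g\<parallel> = \<parallel>\<psi> G\<parallel> \<le> \<kappa> M \<parallel>g\<parallel>\<close>.\<close>



section \<open>Hilbert spaces\<close>

text \<open>The lift goes to the full Fock space because right multiplications by letters are there
  isometries with mutually orthogonal ranges, so the translates of one wandering vector are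
  orthonormal. The kernel \<open>1 / (1 - ipE (b z) (b w))\<close> is the Gram matrix of the
  noncommutative monomials evaluated at \<open>b z\<close>, and evaluation turns the noncommutative
  product into the pointwise one; so the factorization descends to \<open>H\<close>.

  The quotients \<open>\<phi>\<^sub>i = a\<^sub>i / F\<close> need not be multipliers: they are
  controlled only on the test family, which is made to contain \<open>1\<close> so that
  \<open>F\<close> has no zeros. A common factor \<open>F\<close> controls only a weighted total
  over the family, and minimax separates the members. The column-row property enters because the
  \<open>\<beta>\<^sub>i\<close> are controlled as a column, whereas
  \<open>\<Sum> \<beta>\<^sub>i (\<phi>\<^sub>i f)\<close> applies them as a row. The last estimate
  tests \<open>\<psi>\<close> on \<open>G\<close>, which arises together with \<open>\<psi>\<close>
  and cannot be put into a finite family beforehand; hence the bound on all of \<open>H\<close> and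
  the compactness argument.\<close>

context complex_hilbert_space
begin

abbreviation vnorm :: "'v \<Rightarrow> real" where "vnorm \<equiv> ip_norm ip"

lemma zero_in [simp, intro]: "0 \<in> V"
  and add_in [intro]: "\<lbrakk>u \<in> V; v \<in> V\<rbrakk> \<Longrightarrow> u + v \<in> V"
  and diff_in [intro]: "\<lbrakk>u \<in> V; v \<in> V\<rbrakk> \<Longrightarrow> u - v \<in> V"
  and scale_in [intro]: "v \<in> V \<Longrightarrow> scale c v \<in> V"
  and sum_in [intro]: "(\<And>i. i \<in> I \<Longrightarrow> f i \<in> V) \<Longrightarrow> sum f I \<in> V"
  using subspace_V by (simp_all add: subspace_0 subspace_add subspace_diff subspace_scale subspace_sum)

lemma Re_ip_commute: "\<lbrakk>u \<in> V; v \<in> V\<rbrakk> \<Longrightarrow> Re (ip u v) = Re (ip v u)"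
  by (metis ip_commute complex_cnj(1) complex.sel(1) cnj.sel(1))

lemma ip_add_right: "\<lbrakk>u \<in> V; v \<in> V; w \<in> V\<rbrakk> \<Longrightarrow> ip w (u + v) = ip w u + ip w v"
  by (metis add_in ip_add_left ip_commute complex_cnj_add)

lemma ip_scale_right: "\<lbrakk>v \<in> V; w \<in> V\<rbrakk> \<Longrightarrow> ip w (scale c v) = cnj c * ip w v"
  by (metis scale_in ip_scale_left ip_commute complex_cnj_mult)

lemma ip_zero_left [simp]: "w \<in> V \<Longrightarrow> ip 0 w = 0"
  using ip_scale_left[of 0 w 0] by simp

lemma ip_zero_right [simp]: "w \<in> V \<Longrightarrow> ip w 0 = 0"
  using ip_scale_right[of 0 w 0] by simp

lemma ip_diff_left: "\<lbrakk>u \<in> V; v \<in> V; w \<in> V\<rbrakk> \<Longrightarrow> ip (u - v) w = ip u w - ip v w"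
  using ip_add_left[of "u - v" v w] by (auto simp: diff_in)

lemma ip_diff_right: "\<lbrakk>u \<in> V; v \<in> V; w \<in> V\<rbrakk> \<Longrightarrow> ip w (u - v) = ip w u - ip w v"
  using ip_add_right[of "u - v" v w] by (auto simp: diff_in)

lemma ip_sum_left: "\<lbrakk>\<And>i. i \<in> I \<Longrightarrow> f i \<in> V; w \<in> V\<rbrakk> \<Longrightarrow> ip (sum f I) w = (\<Sum>i\<in>I. ip (f i) w)"
  by (induction I rule: infinite_finite_induct) (auto simp: ip_add_left sum_in)

lemma ip_sum_right: "\<lbrakk>\<And>i. i \<in> I \<Longrightarrow> f i \<in> V; w \<in> V\<rbrakk> \<Longrightarrow> ip w (sum f I) = (\<Sum>i\<in>I. ip w (f i))"
  by (induction I rule: infinite_finite_induct) (auto simp: ip_add_right sum_in)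

lemma ip_self: "v \<in> V \<Longrightarrow> ip v v = complex_of_real ((vnorm v)\<^sup>2)"
  using ip_ge_zero[of v] ip_commute[of v v]
  by (auto simp: ip_norm_def complex_eq_iff)

lemma vnorm_nonneg [simp]: "v \<in> V \<Longrightarrow> 0 \<le> vnorm v"
  by (simp add: ip_norm_def ip_ge_zero)

lemma vnorm_sq: "v \<in> V \<Longrightarrow> (vnorm v)\<^sup>2 = Re (ip v v)"
  by (simp add: ip_norm_def ip_ge_zero)

lemma vnorm_zero [simp]: "vnorm 0 = 0"
  by (simp add: ip_norm_def)

lemma vnorm_eq_0: "v \<in> V \<Longrightarrow> vnorm v = 0 \<longleftrightarrow> v = 0"
  using ip_self[of v] ip_eq_zero[of v] by auto

lemma vnorm_scale: "v \<in> V \<Longrightarrow> vnorm (scale c v) = cmod c * vnorm v"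
proof -
  assume v: "v \<in> V"
  have "ip (scale c v) (scale c v) = (c * cnj c) * ip v v"
    using v by (simp add: ip_scale_left ip_scale_right scale_in)
  also have "\<dots> = complex_of_real ((cmod c)\<^sup>2 * (vnorm v)\<^sup>2)"
    using v by (simp only: ip_self complex_norm_square[symmetric] of_real_mult)
  finally have "Re (ip (scale c v) (scale c v)) = (cmod c)\<^sup>2 * (vnorm v)\<^sup>2"
    by simp
  then have "(vnorm (scale c v))\<^sup>2 = (cmod c * vnorm v)\<^sup>2"
    using v by (simp add: vnorm_sq scale_in power_mult_distrib)
  then show ?thesis
    using v by (simp add: power2_eq_iff_nonneg scale_in)
qed

lemma vnorm_add_sq:
  assumes "u \<in> V" "v \<in> V"
  shows "(vnorm (u + v))\<^sup>2 = (vnorm u)\<^sup>2 + 2 * Re (ip u v) + (vnorm v)\<^sup>2"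
  using assms Re_ip_commute[of v u] by (simp add: vnorm_sq add_in ip_add_left ip_add_right)

lemma vnorm_diff_sq:
  assumes "u \<in> V" "v \<in> V"
  shows "(vnorm (u - v))\<^sup>2 = (vnorm u)\<^sup>2 - 2 * Re (ip u v) + (vnorm v)\<^sup>2"
  using assms Re_ip_commute[of v u] by (simp add: vnorm_sq diff_in ip_diff_left ip_diff_right)

lemma vnorm_minus: "u \<in> V \<Longrightarrow> v \<in> V \<Longrightarrow> vnorm (u - v) = vnorm (v - u)"
  by (rule power2_eq_imp_eq) (simp_all add: diff_in vnorm_diff_sq Re_ip_commute[of u v])

lemma Cauchy_Schwarz:
  assumes u: "u \<in> V" and v: "v \<in> V"
  shows "cmod (ip u v) \<le> vnorm u * vnorm v"
proof (cases "v = 0")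
  case False
  define c where "c = ip u v"
  define n where "n = (vnorm v)\<^sup>2"
  have n: "n > 0" using False v vnorm_eq_0[of v] by (simp add: n_def)
  \<comment> \<open>The vector \<open>n u - c v\<close> is \<open>n\<close> times the component of
    \<open>u\<close> orthogonal to \<open>v\<close>; clearing the denominator avoids a
    division.\<close>
  have "0 \<le> (vnorm (scale (of_real n) u - scale c v))\<^sup>2" by simp
  also have "\<dots> = n\<^sup>2 * (vnorm u)\<^sup>2 - 2 * (n * Re (cnj c * c)) + (cmod c)\<^sup>2 * n"
  proof -
    have "vnorm (scale (of_real n) u) = n * vnorm u" "vnorm (scale c v) = cmod c * vnorm v"
      using u v n by (simp_all add: vnorm_scale)
    moreover have "ip (scale (of_real n) u) (scale c v) = of_real n * (cnj c * c)"
      using u v by (simp add: ip_scale_left ip_scale_right scale_in c_def)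
    moreover have "Re (of_real n * (cnj c * c)) = n * Re (cnj c * c)"
      by (simp only: Re_complex_of_real times_complex.sel Im_complex_of_real mult_zero_left diff_zero)
    ultimately show ?thesis
      by (simp only: vnorm_diff_sq[OF scale_in[OF u] scale_in[OF v]] power_mult_distrib n_def[symmetric])
  qed
  also have "cnj c * c = of_real ((cmod c)\<^sup>2)"
    by (simp add: complex_norm_square mult.commute del: of_real_power)
  finally have "0 \<le> n\<^sup>2 * (vnorm u)\<^sup>2 - 2 * (n * (cmod c)\<^sup>2) + (cmod c)\<^sup>2 * n"
    by (simp only: Re_complex_of_real)
  then have "n * (cmod c)\<^sup>2 \<le> n * (n * (vnorm u)\<^sup>2)"
    by (simp add: power2_eq_square mult.assoc mult.commute[of "_ * cmod c" n])
  then have "(cmod c)\<^sup>2 \<le> n * (vnorm u)\<^sup>2"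
    using n by (rule mult_left_le_imp_le)
  then have "(cmod c)\<^sup>2 \<le> (vnorm u * vnorm v)\<^sup>2"
    by (simp only: n_def power_mult_distrib mult.commute)
  then show ?thesis
    unfolding c_def by (rule power2_le_imp_le) (use u v in simp)
qed (use u in simp)

lemma vnorm_triangle: 
  assumes u: "u \<in> V" and v: "v \<in> V"
  shows "vnorm (u + v) \<le> vnorm u + vnorm v"
proof (rule power2_le_imp_le)
  have "Re (ip u v) \<le> vnorm u * vnorm v"
    using Cauchy_Schwarz[OF u v] complex_Re_le_cmod order_trans by blast
  then show "(vnorm (u + v))\<^sup>2 \<le> (vnorm u + vnorm v)\<^sup>2"
    using u v by (simp add: vnorm_add_sq power2_sum)
qed (use u v in auto)

lemma vnorm_triangle_diff: 
  assumes u: "u \<in> V" and v: "v \<in> V"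
  shows "vnorm u \<le> vnorm v + vnorm (u - v)"
  using vnorm_triangle[of v "u - v"] assms by (simp add: diff_in)

lemma vnorm_triangle_diff_abs: 
  assumes u: "u \<in> V" and v: "v \<in> V"
  shows "\<bar>vnorm u - vnorm v\<bar> \<le> vnorm (u - v)"
  using vnorm_triangle_diff[of u v] vnorm_triangle_diff[of v u] vnorm_minus[of u v] assms by simp

lemma vnorm_sum_le:
  "(\<And>i. i \<in> I \<Longrightarrow> f i \<in> V) \<Longrightarrow> vnorm (sum f I) \<le> (\<Sum>i\<in>I. vnorm (f i))"
proof (induction I rule: infinite_finite_induct)
  case (insert i I)
  then show ?case using vnorm_triangle[of "f i" "sum f I"] by (force simp: sum_in)
qed auto

lemma tendsto_vnorm:
  assumes "\<And>n. s n \<in> V" "l \<in> V" "(\<lambda>n. vnorm (s n - l)) \<longlonglongrightarrow> 0"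
  shows "(\<lambda>n. vnorm (s n)) \<longlonglongrightarrow> vnorm l"
  by (rule Lim_transform[OF tendsto_const], rule Lim_null_comparison[OF _ assms(3)])
     (use assms vnorm_triangle_diff_abs in auto)

lemma tendsto_ip_left:
  assumes "\<And>n. s n \<in> V" "l \<in> V" "(\<lambda>n. vnorm (s n - l)) \<longlonglongrightarrow> 0" "v \<in> V"
  shows "(\<lambda>n. ip (s n) v) \<longlonglongrightarrow> ip l v"
proof -
  have "(\<lambda>n. vnorm (s n - l) * vnorm v) \<longlonglongrightarrow> 0"
    using tendsto_mult_left_zero[OF assms(3)] .
  moreover have "cmod (ip (s n) v - ip l v) \<le> vnorm (s n - l) * vnorm v" for n
    using Cauchy_Schwarz[of "s n - l" v] assms by (simp add: ip_diff_left diff_in)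
  ultimately have "(\<lambda>n. ip (s n) v - ip l v) \<longlonglongrightarrow> 0"
    by (rule Lim_null_comparison[OF always_eventually[OF allI], rotated])
  then show ?thesis by (simp add: LIM_zero_iff)
qed

lemma tendsto_ip_right:
  assumes "\<And>n. s n \<in> V" "l \<in> V" "(\<lambda>n. vnorm (s n - l)) \<longlonglongrightarrow> 0" "v \<in> V"
  shows "(\<lambda>n. ip v (s n)) \<longlonglongrightarrow> ip v l"
proof -
  have "cnj (ip (s n) v) = ip v (s n)" for n using ip_commute[of "s n" v] assms by simp
  moreover have "cnj (ip l v) = ip v l" using ip_commute[of l v] assms by simp
  ultimately show ?thesis using tendsto_cnj[OF tendsto_ip_left[OF assms]] by simp
qed

text \<open>Riesz representation of a functional that is given by its graph \<open>G\<close> over a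
  subspace: \<open>x\<close> minimises \<open>\<parallel>u\<parallel>\<^sup>2 - 2 Re a\<close> over \<open>(u, a) \<in> G\<close>.\<close>

lemma riesz_graph:
  assumes G_in: "\<And>u a. (u, a) \<in> G \<Longrightarrow> u \<in> V" and G_0: "(0, 0) \<in> G"
    and G_add: "\<And>u a v b. \<lbrakk>(u, a) \<in> G; (v, b) \<in> G\<rbrakk> \<Longrightarrow> (u + v, a + b) \<in> G"
    and G_scale: "\<And>u a c. (u, a) \<in> G \<Longrightarrow> (scale c u, c * a) \<in> G"
    and bound: "\<And>u a. (u, a) \<in> G \<Longrightarrow> cmod a \<le> M * vnorm u" and M: "M \<ge> 0"
  obtains x s where "x \<in> V" "vnorm x \<le> M" "\<And>u a. (u, a) \<in> G \<Longrightarrow> ip u x = a"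
    "\<And>n::nat. s n \<in> fst ` G" "(\<lambda>n. vnorm (s n - x)) \<longlonglongrightarrow> 0"
proof -
  define J where "J = (\<lambda>(u, a). (vnorm u)\<^sup>2 - 2 * Re a)"
  define m where "m = Inf (J ` G)"
  have lower: "J p \<ge> - M\<^sup>2" if "p \<in> G" for p
  proof -
    obtain u a where p: "p = (u, a)" by (cases p)
    have "Re a \<le> M * vnorm u" using bound that p complex_Re_le_cmod order_trans by blast
    moreover have "0 \<le> (vnorm u - M)\<^sup>2" by simp
    ultimately show ?thesis by (simp add: J_def p power2_eq_square algebra_simps)
  qed
  then have bdd: "bdd_below (J ` G)" by (intro bdd_belowI2) 
  have m: "m \<le> J p" if "p \<in> G" for p
    unfolding m_def using that bdd by (simp add: cINF_lower)
  have "\<exists>p\<in>G. J p < m + 1 / (real n + 1)" for n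
  proof -
    have "\<exists>y\<in>J ` G. y < m + 1 / (real n + 1)"
      unfolding m_def using G_0 by (intro cInf_lessD) (auto simp: add_pos_pos)
    then show ?thesis by blast
  qed
  then obtain p where p: "p n \<in> G" "J (p n) < m + 1 / (real n + 1)" for n by metis
  define s t where "s = (\<lambda>n. fst (p n))" and "t = (\<lambda>n. snd (p n))"
  have st: "(s n, t n) \<in> G" "(vnorm (s n))\<^sup>2 - 2 * Re (t n) < m + 1 / (real n + 1)" for n
    using p[of n] by (auto simp: s_def t_def J_def split: prod.splits)
  have sV: "s n \<in> V" for n using st G_in by blast
  \<comment> \<open>Parallelogram law: the midpoint of two near-minimisers still costs at least
    \<open>m\<close>, which leaves no room for them to be far apart.\<close>
  have par: "(vnorm (s n - s k))\<^sup>2 \<le> 2 / (real n + 1) + 2 / (real k + 1)" for n k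
  proof -
    have "(scale (1/2) (s n + s k), (1/2) * (t n + t k)) \<in> G"
      using st G_add G_scale by blast
    then have "m \<le> (vnorm (scale (1/2) (s n + s k)))\<^sup>2 - Re (t n + t k)"
      using m[of "(scale (1/2) (s n + s k), (1/2) * (t n + t k))"]
      by (simp add: J_def add_divide_distrib)
    then have "4 * m \<le> (vnorm (s n + s k))\<^sup>2 - 4 * Re (t n + t k)"
      using sV by (simp add: vnorm_scale add_in power_mult_distrib power_divide)
    then show ?thesis
      using st(2)[of n] st(2)[of k] sV by (simp add: vnorm_add_sq vnorm_diff_sq)
  qed
  have "\<forall>e>0. \<exists>N. \<forall>k\<ge>N. \<forall>n\<ge>N. vnorm (s k - s n) < e"
  proof safe
    fix e :: real assume "e > 0"
    then obtain N where N: "4 / e\<^sup>2 < real N" using reals_Archimedean2 by blast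
    have "vnorm (s k - s n) < e" if "k \<ge> N" "n \<ge> N" for k n
    proof (rule power2_less_imp_less)
      have "(vnorm (s k - s n))\<^sup>2 \<le> 2 / (real k + 1) + 2 / (real n + 1)" by (rule par)
      also have "\<dots> \<le> 2 / (real N + 1) + 2 / (real N + 1)"
        using that by (intro add_mono divide_left_mono) auto
      also have "\<dots> = 4 / (real N + 1)" by simp
      also have "\<dots> < e\<^sup>2"
      proof -
        have "4 < real N * e\<^sup>2" using N \<open>e > 0\<close> by (simp add: field_simps)
        also have "\<dots> \<le> e\<^sup>2 * (real N + 1)" by (simp add: algebra_simps)
        finally show ?thesis by (simp add: pos_divide_less_eq)
      qed
      finally show "(vnorm (s k - s n))\<^sup>2 < e\<^sup>2" .
    qed (use \<open>e > 0\<close> in simp)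
    then show "\<exists>N. \<forall>k\<ge>N. \<forall>n\<ge>N. vnorm (s k - s n) < e" by blast
  qed
  then obtain x where x: "x \<in> V" "(\<lambda>n. vnorm (s n - x)) \<longlonglongrightarrow> 0"
    using complete[of s] sV by blast
  have Re_eq: "Re (ip u x) = Re a" if ua: "(u, a) \<in> G" for u a
  proof -
    have uV: "u \<in> V" using ua G_in by blast
    \<comment> \<open>Moving \<open>s n\<close> by \<open>r u\<close> lowers the cost by at most
      \<open>1 / (n + 1)\<close>. In the limit a quadratic in \<open>r\<close> that vanishes at
      \<open>0\<close> is nonnegative, which forces its linear coefficient to vanish.\<close>
    have key: "0 \<le> 2 * r * (Re (ip u x) - Re a) + r\<^sup>2 * (vnorm u)\<^sup>2" for r :: real
    proof -
      have low: "- (1 / (real n + 1)) \<le> 2 * r * (Re (ip u (s n)) - Re a) + r\<^sup>2 * (vnorm u)\<^sup>2" for n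
      proof -
        have "(s n + scale (of_real r) u, t n + of_real r * a) \<in> G"
          using st ua G_add G_scale by blast
        then have "m \<le> J (s n + scale (of_real r) u, t n + of_real r * a)" by (rule m)
        also have "\<dots> = (vnorm (s n))\<^sup>2 + 2 * r * Re (ip u (s n)) + r\<^sup>2 * (vnorm u)\<^sup>2
            - 2 * Re (t n) - 2 * r * Re a"
          using sV uV Re_ip_commute[OF uV sV[of n]]
          by (simp add: J_def vnorm_add_sq scale_in ip_scale_right vnorm_scale power_mult_distrib)
        finally show ?thesis using st(2)[of n] by (simp add: algebra_simps)
      qed
      have lim: "(\<lambda>n. 2 * r * (Re (ip u (s n)) - Re a) + r\<^sup>2 * (vnorm u)\<^sup>2) \<longlonglongrightarrow>
          2 * r * (Re (ip u x) - Re a) + r\<^sup>2 * (vnorm u)\<^sup>2"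
        by (intro tendsto_intros tendsto_ip_right sV x uV)
      have "(\<lambda>n. - (1 / (real n + 1))) \<longlonglongrightarrow> - 0"
        using LIMSEQ_inverse_real_of_nat by (intro tendsto_minus) (simp add: inverse_eq_divide add.commute)
      then show ?thesis using LIMSEQ_le[OF _ lim] low by simp
    qed
    \<comment> \<open>The choice \<open>r = - A / B\<close> nearly minimises the quadratic; the
      \<open>+ 1\<close> in \<open>B\<close> covers \<open>u = 0\<close>.\<close>
    define A B where "A = Re (ip u x) - Re a" and "B = (vnorm u)\<^sup>2 + 1"
    have B: "B > 0" by (simp add: B_def add_nonneg_pos)
    have "0 \<le> 2 * (- (A / B)) * A + (- (A / B))\<^sup>2 * (vnorm u)\<^sup>2"
      using key unfolding A_def by blast
    also have "\<dots> \<le> 2 * (- (A / B)) * A + (- (A / B))\<^sup>2 * B"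
      unfolding B_def by (intro add_left_mono mult_left_mono) auto
    also have "\<dots> = - (A\<^sup>2 / B)" using B by (simp add: power2_eq_square)
    finally have "A\<^sup>2 \<le> 0" using B by (simp add: divide_le_0_iff)
    then show ?thesis by (simp add: A_def)
  qed
  have eq: "ip u x = a" if ua: "(u, a) \<in> G" for u a
  proof -
    have uV: "u \<in> V" using ua G_in by blast
    have "Re (ip (scale \<i> u) x) = Re (\<i> * a)" using Re_eq ua G_scale by blast
    then have "Im (ip u x) = Im a" using uV x by (simp add: ip_scale_left)
    with Re_eq[OF ua] show ?thesis by (simp add: complex_eq_iff)
  qed
  \<comment> \<open>The vector \<open>x\<close> need not lie in the domain of the graph, so the
    bound is used for \<open>s n\<close> and passed to the limit.\<close>
  have "(\<lambda>n. cmod (ip (s n) x)) \<longlonglongrightarrow> cmod (ip x x)"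
    by (intro tendsto_norm tendsto_ip_left sV x)
  moreover have "(\<lambda>n. M * vnorm (s n)) \<longlonglongrightarrow> M * vnorm x"
    by (intro tendsto_mult tendsto_const tendsto_vnorm sV x)
  moreover have "cmod (ip (s n) x) \<le> M * vnorm (s n)" for n
    using eq[OF st(1)] bound[OF st(1)] by simp
  ultimately have "cmod (ip x x) \<le> M * vnorm x" by (meson LIMSEQ_le)
  then have "vnorm x * vnorm x \<le> M * vnorm x"
    using x by (simp add: ip_self norm_power power2_eq_square norm_mult)
  then have "vnorm x \<le> M" using x M by (cases "vnorm x = 0") (auto simp: mult_le_cancel_right)
  moreover have "s n \<in> fst ` G" for n using st by force
  ultimately show thesis using that x eq by blast
qed

text \<open>The bound makes the functional sending \<open>v z\<close> to \<open>cnj (a z)\<close>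
  well defined and bounded on the span even if the family is linearly dependent; its graph is what
  \<open>riesz_graph\<close> takes. The conjugate is there because \<open>riesz_graph\<close> puts
  the solution into the conjugate-linear slot.\<close>

lemma interpolation:
  fixes v :: "'i \<Rightarrow> 'v"
  assumes v: "\<And>z. v z \<in> V" and M: "M \<ge> 0"
    and bound: "\<And>Y c. finite Y \<Longrightarrow> cmod (\<Sum>z\<in>Y. c z * cnj (a z)) \<le> M * vnorm (\<Sum>z\<in>Y. scale (c z) (v z))"
  obtains x where "x \<in> V" "vnorm x \<le> M" "\<And>z. ip x (v z) = a z"
proof -
  define G where "G = {((\<Sum>z\<in>Y. scale (c z) (v z)), (\<Sum>z\<in>Y. c z * cnj (a z))) | Y c. finite Y}"
  have single: "(v z, cnj (a z)) \<in> G" for z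
    unfolding G_def by (rule CollectI, rule exI[of _ "{z}"], rule exI[of _ "\<lambda>_. 1"]) simp
  obtain x where x: "x \<in> V" "vnorm x \<le> M" "\<And>u b. (u, b) \<in> G \<Longrightarrow> ip u x = b"
  proof (rule riesz_graph[of G M])
    fix u b w d assume ub: "(u, b) \<in> G" and wd: "(w, d) \<in> G"
    obtain Y c where Y: "finite Y" "u = (\<Sum>z\<in>Y. scale (c z) (v z))" "b = (\<Sum>z\<in>Y. c z * cnj (a z))"
      using ub by (auto simp: G_def)
    obtain Z e where Z: "finite Z" "w = (\<Sum>z\<in>Z. scale (e z) (v z))" "d = (\<Sum>z\<in>Z. e z * cnj (a z))"
      using wd by (auto simp: G_def)
    define f where "f z = (if z \<in> Y then c z else 0) + (if z \<in> Z then e z else 0)" for z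
    have "u = (\<Sum>z\<in>Y \<union> Z. scale (if z \<in> Y then c z else 0) (v z))"
      "w = (\<Sum>z\<in>Y \<union> Z. scale (if z \<in> Z then e z else 0) (v z))"
      "b = (\<Sum>z\<in>Y \<union> Z. (if z \<in> Y then c z else 0) * cnj (a z))"
      "d = (\<Sum>z\<in>Y \<union> Z. (if z \<in> Z then e z else 0) * cnj (a z))"
      unfolding Y Z by (rule sum.mono_neutral_cong_left; use Y(1) Z(1) in auto)+
    then have "u + w = (\<Sum>z\<in>Y \<union> Z. scale (f z) (v z))" "b + d = (\<Sum>z\<in>Y \<union> Z. f z * cnj (a z))"
      by (simp_all add: f_def scale_left_distrib distrib_right sum.distrib)
    then show "(u + w, b + d) \<in> G" unfolding G_def using Y Z by blast
  next
    fix u b c assume "(u, b) \<in> G"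
    then obtain Y e where "finite Y" "u = (\<Sum>z\<in>Y. scale (e z) (v z))" "b = (\<Sum>z\<in>Y. e z * cnj (a z))"
      by (auto simp: G_def)
    then have "finite Y" "scale c u = (\<Sum>z\<in>Y. scale (c * e z) (v z))" "c * b = (\<Sum>z\<in>Y. (c * e z) * cnj (a z))"
      by (simp_all add: scale_sum_right sum_distrib_left mult.assoc)
    then show "(scale c u, c * b) \<in> G"
      unfolding G_def mem_Collect_eq by (intro exI[of _ Y] exI[of _ "\<lambda>z. c * e z"]) simp
  next
    show "(0, 0) \<in> G" unfolding G_def
      by (rule CollectI, rule exI[of _ "{}"]) simp
  qed (use bound v M in \<open>auto simp: G_def intro!: sum_in scale_in\<close>)
  have "ip x (v z) = a z" for z
    using x(3)[OF single[of z]] ip_commute[OF v x(1)] by simp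
  then show thesis using that x by blast
qed

text \<open>Since \<open>D\<close> need not be closed, \<open>x\<close> is the projection of
  \<open>p\<close> onto the closure, obtained as the Riesz vector of the functional sending
  \<open>d\<close> to \<open>ip d p\<close>; the sequence \<open>s\<close> records that
  \<open>x\<close> is a limit from \<open>D\<close>.\<close>

lemma projection:
  assumes D: "subspace D" "D \<subseteq> V" and p: "p \<in> V"
  obtains x s where "x \<in> V" "\<And>d. d \<in> D \<Longrightarrow> ip d (p - x) = 0"
    "\<And>n::nat. s n \<in> D" "(\<lambda>n. vnorm (s n - x)) \<longlonglongrightarrow> 0"
proof -
  define G where "G = (\<lambda>d. (d, ip d p)) ` D"
  have in_G: "(u, a) \<in> G \<longleftrightarrow> u \<in> D \<and> a = ip u p" for u a by (auto simp: G_def)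
  obtain x s where x: "x \<in> V" "\<And>u a. (u, a) \<in> G \<Longrightarrow> ip u x = a"
    "\<And>n::nat. s n \<in> fst ` G" "(\<lambda>n. vnorm (s n - x)) \<longlonglongrightarrow> 0"
  proof (rule riesz_graph[of G "vnorm p"])
    show "\<And>u a. (u, a) \<in> G \<Longrightarrow> cmod a \<le> vnorm p * vnorm u"
      using D p Cauchy_Schwarz by (auto simp: in_G mult.commute)
  qed (use D p in \<open>auto simp: in_G ip_add_left ip_scale_left subspace_0 subspace_add subspace_scale subset_iff\<close>)
  moreover have "ip d (p - x) = 0" if "d \<in> D" for d
    using x(2)[of d "ip d p"] that D p x(1) by (auto simp: in_G ip_diff_right subset_iff)
  moreover have "s n \<in> D" for n using x(3)[of n] by (auto simp: in_G)
  ultimately show thesis using that by blast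
qed

end


section \<open>Orthonormal families, Parseval's identity and coordinates\<close>

context complex_hilbert_space
begin

definition orthonormal_family :: "('i \<Rightarrow> 'v) \<Rightarrow> 'i set \<Rightarrow> bool" where
  "orthonormal_family e I \<longleftrightarrow>
    (\<forall>i\<in>I. e i \<in> V) \<and> (\<forall>i\<in>I. \<forall>j\<in>I. ip (e i) (e j) = (if i = j then 1 else 0))"

lemma orthonormal_family_subset:
  "orthonormal_family e I \<Longrightarrow> J \<subseteq> I \<Longrightarrow> orthonormal_family e J"
  unfolding orthonormal_family_def by blast

lemma ip_lincomb_orthonormal:
  assumes "orthonormal_family e F" "finite F" "i \<in> F"
  shows "ip (\<Sum>j\<in>F. scale (c j) (e j)) (e i) = c i"
proof -
  have e: "\<And>j. j \<in> F \<Longrightarrow> e j \<in> V" "\<And>j. j \<in> F \<Longrightarrow> ip (e j) (e i) = (if j = i then 1 else 0)"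
    using assms by (auto simp: orthonormal_family_def)
  have "ip (\<Sum>j\<in>F. scale (c j) (e j)) (e i) = (\<Sum>j\<in>F. c j * (if j = i then 1 else 0))"
    using e assms(3) by (subst ip_sum_left) (auto simp: scale_in ip_scale_left intro!: sum.cong)
  also have "\<dots> = c i"
    using assms(2,3) by (simp add: if_distrib[of "\<lambda>x. c _ * x"] cong: if_cong)
  finally show ?thesis .
qed

lemma vnorm_lincomb_orthonormal:
  assumes "orthonormal_family e F" "finite F"
  shows "(vnorm (\<Sum>j\<in>F. scale (c j) (e j)))\<^sup>2 = (\<Sum>j\<in>F. (cmod (c j))\<^sup>2)"
proof -
  let ?x = "\<Sum>j\<in>F. scale (c j) (e j)"
  have e: "\<And>j. j \<in> F \<Longrightarrow> e j \<in> V" using assms by (auto simp: orthonormal_family_def)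
  have x: "?x \<in> V" using e by (auto intro!: sum_in scale_in)
  have "ip ?x ?x = (\<Sum>i\<in>F. cnj (c i) * ip ?x (e i))"
    using e x by (subst ip_sum_right) (auto simp: scale_in ip_scale_right intro!: sum.cong)
  also have "\<dots> = (\<Sum>i\<in>F. cnj (c i) * c i)"
    using assms by (intro sum.cong) (auto simp: ip_lincomb_orthonormal)
  also have "\<dots> = of_real (\<Sum>i\<in>F. (cmod (c i))\<^sup>2)"
    unfolding of_real_sum complex_norm_square by (intro sum.cong) (simp_all only: mult.commute)
  finally show ?thesis using x by (simp only: vnorm_sq Re_complex_of_real)
qed

text \<open>Pythagoras, as the residual is orthogonal to every \<open>e j\<close>. Taking
  \<open>c = 0\<close> gives Bessel's inequality, and general \<open>c\<close> the minimality of the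
  Fourier coefficients.\<close>

lemma best_approximation:
  assumes "orthonormal_family e F" "finite F" "v \<in> V"
  shows "(vnorm (v - (\<Sum>j\<in>F. scale (ip v (e j)) (e j))))\<^sup>2 + (vnorm (\<Sum>j\<in>F. scale (ip v (e j) - c j) (e j)))\<^sup>2
      = (vnorm (v - (\<Sum>j\<in>F. scale (c j) (e j))))\<^sup>2"
proof -
  have e: "\<And>j. j \<in> F \<Longrightarrow> e j \<in> V" using assms by (auto simp: orthonormal_family_def)
  let ?y = "v - (\<Sum>j\<in>F. scale (ip v (e j)) (e j))" and ?x = "\<Sum>j\<in>F. scale (ip v (e j) - c j) (e j)"
  have x: "?x \<in> V" and y: "?y \<in> V" and s: "(\<Sum>j\<in>F. scale (ip v (e j)) (e j)) \<in> V"
    using e assms(3) by (auto intro!: sum_in scale_in diff_in)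
  have "ip ?y (e i) = 0" if "i \<in> F" for i
    using ip_diff_left[OF assms(3) s e[OF that]] ip_lincomb_orthonormal[OF assms(1,2) that] by simp
  then have "ip ?y ?x = 0"
    using e y by (subst ip_sum_right) (auto simp: scale_in ip_scale_right)
  moreover have "?y + ?x = v - (\<Sum>j\<in>F. scale (c j) (e j))"
    by (simp add: scale_left_diff_distrib sum_subtractf)
  ultimately show ?thesis using vnorm_add_sq[OF y x] by (simp only: zero_complex.sel mult_zero_right add_0_right)
qed

lemma bessel:
  assumes "orthonormal_family e F" "finite F" "v \<in> V"
  shows "(\<Sum>j\<in>F. (cmod (ip v (e j)))\<^sup>2) \<le> (vnorm v)\<^sup>2"
proof -
  have "(vnorm (\<Sum>j\<in>F. scale (ip v (e j)) (e j)))\<^sup>2 \<le> (vnorm v)\<^sup>2"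
    using best_approximation[OF assms, of "\<lambda>_. 0"]
      zero_le_power2[of "vnorm (v - (\<Sum>j\<in>F. scale (ip v (e j)) (e j)))"]
    by (simp only: diff_0_right scale_zero_left sum.neutral_const)
  then show ?thesis using vnorm_lincomb_orthonormal[OF assms(1,2)] by simp
qed

text \<open>Zorn's lemma: normalising a nonzero vector orthogonal to a maximal orthonormal set would
  enlarge that set.\<close>

lemma ex_complete_orthonormal_family:
  "\<exists>S. orthonormal_family (\<lambda>s. s) S \<and> (\<forall>v\<in>V. (\<forall>s\<in>S. ip s v = 0) \<longrightarrow> v = 0)"
proof -
  define A where "A = {S. orthonormal_family (\<lambda>s::'v. s) S}"
  have "\<exists>M\<in>A. \<forall>X\<in>A. M \<subseteq> X \<longrightarrow> X = M"
  proof (rule subset_Zorn')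
    fix C assume C: "subset.chain A C"
    show "\<Union>C \<in> A"
      unfolding A_def mem_Collect_eq orthonormal_family_def
    proof (intro conjI ballI)
      fix s assume "s \<in> \<Union>C" then show "s \<in> V"
        using C by (auto simp: subset_chain_def A_def orthonormal_family_def)
    next
      fix s t assume "s \<in> \<Union>C" "t \<in> \<Union>C"
      then obtain X Y where XY: "X \<in> C" "Y \<in> C" "s \<in> X" "t \<in> Y" by blast
      then have "X \<subseteq> Y \<or> Y \<subseteq> X" using C by (auto simp: subset_chain_def)
      then obtain Z where "Z \<in> C" "s \<in> Z" "t \<in> Z" using XY by blast
      moreover from this have "orthonormal_family (\<lambda>s. s) Z"
        using C by (auto simp: subset_chain_def A_def)
      ultimately show "ip s t = (if s = t then 1 else 0)"
        unfolding orthonormal_family_def by blast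
    qed
  qed
  then obtain S where S: "orthonormal_family (\<lambda>s::'v. s) S"
    and max: "\<And>X. orthonormal_family (\<lambda>s::'v. s) X \<Longrightarrow> S \<subseteq> X \<Longrightarrow> X = S"
    by (auto simp: A_def)
  have "v = 0" if v: "v \<in> V" and perp: "\<forall>s\<in>S. ip s v = 0" for v
  proof (rule ccontr)
    assume "v \<noteq> 0"
    then have n: "vnorm v > 0" using v vnorm_eq_0[of v] vnorm_nonneg[OF v] by linarith
    define u where "u = scale (of_real (1 / vnorm v)) v"
    have u: "u \<in> V" using v by (auto simp: u_def)
    have "vnorm u = 1" using n v by (simp add: u_def vnorm_scale norm_divide)
    then have uu: "ip u u = 1" by (simp add: ip_self[OF u])
    have su: "ip s u = 0" "ip u s = 0" "s \<in> V" if "s \<in> S" for s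
    proof -
      show "s \<in> V" using S that by (auto simp: orthonormal_family_def)
      then show "ip s u = 0" using perp v that by (simp add: u_def ip_scale_right)
      then show "ip u s = 0" using ip_commute[OF \<open>s \<in> V\<close> u] by simp
    qed
    have "orthonormal_family (\<lambda>s. s) (insert u S)"
      unfolding orthonormal_family_def
    proof (intro conjI ballI)
      fix s t assume "s \<in> insert u S" "t \<in> insert u S"
      then consider "s = u" "t = u" | "s = u" "t \<in> S" | "s \<in> S" "t = u" | "s \<in> S" "t \<in> S" by blast
      then show "ip s t = (if s = t then 1 else 0)"
      proof cases
        case 2
        then have "s \<noteq> t" using su uu by auto
        then show ?thesis using su 2 by simp
      next
        case 3
        then have "s \<noteq> t" using su uu by auto
        then show ?thesis using su 3 by simp
      next
        case 4
        then show ?thesis using S unfolding orthonormal_family_def by blast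
      qed (simp add: uu)
    qed (use u su in auto)
    then have "u \<in> S" using max by blast
    then show False using su uu by simp
  qed
  with S show ?thesis by blast
qed

text \<open>Totality kills the component of \<open>v\<close> orthogonal to the span, so
  \<open>v\<close> is a limit of finite combinations. By \<open>best_approximation\<close> every
  finite set containing the vectors of such a combination does at least as well, which is
  convergence along the net of finite sets.\<close>

lemma parseval:
  assumes S: "orthonormal_family (\<lambda>s. s) S" and total: "\<And>v. v \<in> V \<Longrightarrow> (\<And>s. s \<in> S \<Longrightarrow> ip s v = 0) \<Longrightarrow> v = 0"
    and u: "u \<in> V" and v: "v \<in> V"
  shows "((\<lambda>s. ip u s * ip s v) has_sum ip u v) S"
proof -
  have SV: "S \<subseteq> V" using S by (auto simp: orthonormal_family_def)
  have "span S \<subseteq> V" using SV subspace_V by (rule span_minimal)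
  from projection[OF subspace_span this v] obtain x s where x: "x \<in> V"
    "\<And>d. d \<in> span S \<Longrightarrow> ip d (v - x) = 0"
    "\<And>n::nat. s n \<in> span S" "(\<lambda>n. vnorm (s n - x)) \<longlonglongrightarrow> 0" by metis
  have "v - x = 0" using x v by (intro total) (auto intro: span_base)
  then have lim: "(\<lambda>n. vnorm (s n - v)) \<longlonglongrightarrow> 0" using x by simp
  show ?thesis
    unfolding has_sum_def tendsto_iff
  proof safe
    fix e :: real assume "e > 0"
    then have "e / (vnorm u + 1) > 0" using u by (simp add: add_nonneg_pos)
    obtain n where "vnorm (s n - v) < e / (vnorm u + 1)"
      using LIMSEQ_D[OF lim \<open>e / (vnorm u + 1) > 0\<close>] vnorm_nonneg[OF diff_in] x(3) \<open>span S \<subseteq> V\<close> v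
      by (metis abs_of_nonneg diff_zero le_refl real_norm_def subsetD)
    then have n: "(vnorm u + 1) * vnorm (s n - v) < e"
      using u by (simp add: pos_less_divide_eq add_nonneg_pos mult.commute)
    have snV: "s n \<in> V" using x(3) \<open>span S \<subseteq> V\<close> by blast
    obtain T c where T: "finite T" "T \<subseteq> S" "s n = (\<Sum>a\<in>T. scale (c a) a)"
      using x(3)[of n] unfolding span_explicit by blast
    have "dist (\<Sum>s\<in>F. ip u s * ip s v) (ip u v) < e" if F: "finite F" "F \<subseteq> S" "T \<subseteq> F" for F
    proof -
      have oF: "orthonormal_family (\<lambda>s. s) F" using orthonormal_family_subset[OF S F(2)] .
      have FV: "a \<in> V" if "a \<in> F" for a using that F SV by blast
      have sn: "s n = (\<Sum>a\<in>F. scale (if a \<in> T then c a else 0) a)"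
        unfolding T(3) by (rule sum.mono_neutral_cong_left) (use F in auto)
      let ?y = "v - (\<Sum>a\<in>F. scale (ip v a) a)"
      have sum: "(\<Sum>a\<in>F. scale (ip v a) a) \<in> V" using FV by (auto intro!: sum_in scale_in)
      have y: "?y \<in> V" using sum v by (rule diff_in[rotated])
      have "(vnorm ?y)\<^sup>2 \<le> (vnorm (v - s n))\<^sup>2"
        unfolding sn best_approximation[OF oF F(1) v, of "\<lambda>a. if a \<in> T then c a else 0", symmetric] by simp
      then have le: "vnorm ?y \<le> vnorm (s n - v)"
        using power2_le_imp_le[OF _ vnorm_nonneg[OF diff_in[OF v snV]]] vnorm_minus[OF v snV] by simp
      have "ip u (\<Sum>a\<in>F. scale (ip v a) a) = (\<Sum>a\<in>F. ip u a * ip a v)"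
        using FV u v by (subst ip_sum_right) (auto simp: scale_in ip_scale_right ip_commute[of v] intro!: sum.cong)
      then have "ip u v - (\<Sum>s\<in>F. ip u s * ip s v) = ip u ?y"
        using ip_diff_right[OF v sum u] by simp
      then have "dist (\<Sum>s\<in>F. ip u s * ip s v) (ip u v) = cmod (ip u ?y)"
        by (metis dist_commute dist_norm)
      also have "\<dots> \<le> vnorm u * vnorm (s n - v)"
        using Cauchy_Schwarz[OF u y] le u by (meson mult_left_mono order_trans vnorm_nonneg)
      also have "\<dots> \<le> (vnorm u + 1) * vnorm (s n - v)"
        using snV v by (intro mult_right_mono) (auto simp: diff_in)
      finally show ?thesis using n by simp
    qed
    then show "\<forall>\<^sub>F F in finite_subsets_at_top S. dist (\<Sum>s\<in>F. ip u s * ip s v) (ip u v) < e"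
      unfolding eventually_finite_subsets_at_top using T by blast
  qed
qed

text \<open>Coordinates are extended by zero to the whole type \<open>'v\<close>, so that the index
  type does not depend on the orthonormal set. For the auxiliary space the indices later serve as
  letters of the Fock space.\<close>

lemma ex_coordinates:
  "\<exists>c :: 'v \<Rightarrow> 'v \<Rightarrow> complex. \<forall>u\<in>V. \<forall>v\<in>V. ((\<lambda>s. c u s * cnj (c v s)) has_sum ip u v) UNIV"
proof -
  obtain S where S: "orthonormal_family (\<lambda>s. s) S" "\<And>v. v \<in> V \<Longrightarrow> (\<And>s. s \<in> S \<Longrightarrow> ip s v = 0) \<Longrightarrow> v = 0"
    using ex_complete_orthonormal_family by blast
  have SV: "s \<in> V" if "s \<in> S" for s using S that by (auto simp: orthonormal_family_def)
  define c where "c u s = (if s \<in> S then ip u s else 0)" for u s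
  have "((\<lambda>s. c u s * cnj (c v s)) has_sum ip u v) UNIV" if "u \<in> V" "v \<in> V" for u v
  proof -
    have "((\<lambda>s. ip u s * ip s v) has_sum ip u v) S"
      using parseval S that by blast
    then show ?thesis
      by (rule has_sum_cong_neutral[THEN iffD1, rotated 3])
         (use SV that in \<open>auto simp: c_def ip_commute[of v]\<close>)
  qed
  then show ?thesis by blast
qed

end

lemma (in complex_hilbert_space) ip_span_eq_0:
  assumes d: "d \<in> span A" and z: "z \<in> V" and A: "\<And>a. a \<in> A \<Longrightarrow> a \<in> V \<and> ip a z = 0"
  shows "ip d z = 0"
proof -
  have "subspace {d \<in> V. ip d z = 0}"
    using z by (intro subspaceI) (auto simp: ip_add_left ip_scale_left)
  moreover have "A \<subseteq> {d \<in> V. ip d z = 0}" using A by auto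
  ultimately have "span A \<subseteq> {d \<in> V. ip d z = 0}" by (rule span_minimal[rotated])
  with d show ?thesis by auto
qed

section \<open>Banach function spaces\<close>

text \<open>The axiom \<open>series\<close> combines the triangle inequality, completeness and
  compatibility of sums with pointwise values. It is the form in which completeness of the weak
  product comes naturally.\<close>

locale banach_function_space =
  fixes B :: "('x \<Rightarrow> complex) set" and nrm :: "('x \<Rightarrow> complex) \<Rightarrow> real"
  assumes nrm_nonneg: "f \<in> B \<Longrightarrow> 0 \<le> nrm f"
    and zero_mem: "0 \<in> B"
    and scale_mem: "f \<in> B \<Longrightarrow> (\<lambda>z. c * f z) \<in> B"
    and nrm_scale: "f \<in> B \<Longrightarrow> nrm (\<lambda>z. c * f z) = cmod c * nrm f"
    and series: "\<lbrakk>\<And>n. h n \<in> B; summable (\<lambda>n. nrm (h n)); \<And>z. (\<lambda>n. h n z) sums f z\<rbrakk>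
      \<Longrightarrow> f \<in> B \<and> nrm f \<le> (\<Sum>n. nrm (h n))"
    and eval_bounded: "\<exists>C. \<forall>f\<in>B. cmod (f z) \<le> C * nrm f"
begin

lemma nrm_zero: "nrm 0 = 0"
  using nrm_scale[OF zero_mem, of 0] by (simp add: zero_fun_def)

lemma add_mem: "\<lbrakk>f \<in> B; g \<in> B\<rbrakk> \<Longrightarrow> f + g \<in> B \<and> nrm (f + g) \<le> nrm f + nrm g"
proof -
  assume f: "f \<in> B" and g: "g \<in> B"
  define h where "h n = (if n = 0 then f else if n = 1 then g else 0)" for n :: nat
  have "(\<lambda>n. nrm (h n)) sums (\<Sum>n\<in>{0,1}. nrm (h n))"
    by (rule sums_finite) (auto simp: h_def nrm_zero)
  then have s: "(\<lambda>n. nrm (h n)) sums (nrm f + nrm g)" by (simp add: h_def)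
  have "(\<lambda>n. h n z) sums (\<Sum>n\<in>{0,1}. h n z)" for z
    by (rule sums_finite) (auto simp: h_def)
  then have z: "(\<lambda>n. h n z) sums (f + g) z" for z by (simp add: h_def)
  have "h n \<in> B" for n using f g zero_mem by (simp add: h_def)
  from series[of h "f + g", OF this sums_summable[OF s] z] show ?thesis using sums_unique[OF s] by simp
qed

lemma diff_mem: "\<lbrakk>f \<in> B; g \<in> B\<rbrakk> \<Longrightarrow> f - g \<in> B \<and> nrm (f - g) \<le> nrm f + nrm g"
proof -
  assume f: "f \<in> B" and g: "g \<in> B"
  have "(\<lambda>z. (-1) * g z) \<in> B \<and> nrm (\<lambda>z. (-1) * g z) = nrm g"
    using scale_mem[OF g, of "-1"] nrm_scale[OF g, of "-1"] by (simp del: mult_minus1)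
  moreover have "f + (\<lambda>z. (-1) * g z) = f - g" by (auto simp: fun_eq_iff)
  ultimately show ?thesis using add_mem[OF f, of "\<lambda>z. (-1) * g z"] by simp
qed

lemma eval_bounded_pos: "\<exists>C\<ge>0. \<forall>f\<in>B. cmod (f z) \<le> C * nrm f"
proof -
  obtain C where C: "\<forall>f\<in>B. cmod (f z) \<le> C * nrm f" using eval_bounded by blast
  have "\<forall>f\<in>B. cmod (f z) \<le> \<bar>C\<bar> * nrm f"
    using C nrm_nonneg by (meson abs_ge_self mult_right_mono order_trans)
  then show ?thesis by (meson abs_ge_zero)
qed

lemma nrm_eq_0: "f \<in> B \<Longrightarrow> nrm f = 0 \<Longrightarrow> f = 0"
  using eval_bounded by (fastforce simp: fun_eq_iff)

text \<open>The closed graph theorem for multiplication operators, proved like Zabreiko's lemma: the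
  seminorm \<open>f \<mapsto> nrm (\<phi> * f)\<close> is countably subadditive, so that Baire's argument applies.\<close>

theorem multiplication_bounded:
  assumes \<phi>: "\<phi> \<in> Mult B"
  shows "\<exists>C\<ge>0. \<forall>f\<in>B. nrm (\<phi> * f) \<le> C * nrm f"
proof -
  define p where "p f = nrm (\<phi> * f)" for f
  have \<phi>B: "\<phi> * f \<in> B" if "f \<in> B" for f using \<phi> that by (simp add: Mult_def)
  have p0: "0 \<le> p f" if "f \<in> B" for f using that \<phi>B nrm_nonneg by (simp add: p_def)
  have p_diff: "p (f - g) \<le> p f + p g" if "f \<in> B" "g \<in> B" for f g
    using diff_mem[OF \<phi>B[OF that(1)] \<phi>B[OF that(2)]] by (simp add: p_def right_diff_distrib)
  have p_scale: "p (\<lambda>z. c * f z) = cmod c * p f" if "f \<in> B" for c f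
  proof -
    have "\<phi> * (\<lambda>z. c * f z) = (\<lambda>z. c * (\<phi> * f) z)" by (auto simp: fun_eq_iff)
    then show ?thesis using nrm_scale[OF \<phi>B[OF that], of c] by (simp add: p_def)
  qed
  have nrm_minus: "nrm (f - g) = nrm (g - f)" if "f \<in> B" "g \<in> B" for f g
  proof -
    have "f - g = (\<lambda>z. (-1) * (g - f) z)" by (auto simp: fun_eq_iff)
    then show ?thesis using nrm_scale[of "g - f" "-1"] diff_mem[OF that(2,1)] by simp
  qed
  \<comment> \<open>Baire's argument: otherwise there are nested balls with \<open>p > n\<close> on
    the \<open>n\<close>-th, and at a common point \<open>p\<close> has no finite value.\<close>
  have "\<exists>C h0 r. h0 \<in> B \<and> r > 0 \<and>
    (\<forall>k\<in>B. nrm (k - h0) \<le> r \<longrightarrow> (\<forall>\<delta>>0. \<exists>a\<in>B. nrm (a - k) < \<delta> \<and> p a \<le> C))"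
  proof (rule ccontr)
    assume neg: "\<not> ?thesis"
    have step: "\<exists>k\<in>B. nrm (k - h0) \<le> r \<and> (\<exists>\<delta>>0. \<forall>a\<in>B. nrm (a - k) < \<delta> \<longrightarrow> p a > C)"
      if "h0 \<in> B" "r > 0" for C h0 r
    proof (rule ccontr)
      assume no: "\<not> ?thesis"
      have "\<exists>a\<in>B. nrm (a - k) < \<delta> \<and> p a \<le> C" if "k \<in> B" "nrm (k - h0) \<le> r" "\<delta> > 0" for k \<delta>
      proof (rule ccontr)
        assume "\<not> ?thesis"
        then have "\<forall>a\<in>B. nrm (a - k) < \<delta> \<longrightarrow> p a > C" by (auto simp: not_le)
        with no that show False by blast
      qed
      with neg \<open>h0 \<in> B\<close> \<open>r > 0\<close> show False by blast
    qed
    \<comment> \<open>The pair \<open>x\<close> is a closed ball, given by centre and radius. Each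
      centre moves by at most half the radius and radii at least halve, so the displacements
      \<open>r/2 + r/4 + ...\<close> keep the limit in every ball.\<close>
    define P where "P n x \<longleftrightarrow> (case x of (h, r) \<Rightarrow>
      h \<in> B \<and> r > 0 \<and> (\<forall>a\<in>B. nrm (a - h) \<le> r \<longrightarrow> p a > real n))" for n :: nat and x :: "('x \<Rightarrow> complex) \<times> real"
    define Q where "Q x y \<longleftrightarrow> (case x of (h, r) \<Rightarrow> case y of (h', r') \<Rightarrow>
      nrm (h' - h) \<le> r / 2 \<and> r' \<le> r / 2)" for x y :: "('x \<Rightarrow> complex) \<times> real"
    have "\<exists>f. \<forall>n. P n (f n) \<and> Q (f n) (f (Suc n))"
    proof (rule dependent_nat_choice)
      obtain k \<delta> where "k \<in> B" "\<delta> > 0" "\<forall>a\<in>B. nrm (a - k) < \<delta> \<longrightarrow> p a > 0"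
        using step[of 0 1 0] zero_mem by auto
      then have "P 0 (k, \<delta> / 2)" by (auto simp: P_def)
      then show "\<exists>x. P 0 x" by blast
    next
      fix x n assume "P n x"
      then obtain h r where x: "x = (h, r)" "h \<in> B" "r > 0" by (auto simp: P_def)
      obtain k \<delta> where k: "k \<in> B" "nrm (k - h) \<le> r / 2" "\<delta> > 0"
        "\<forall>a\<in>B. nrm (a - k) < \<delta> \<longrightarrow> p a > real (Suc n)"
        using step[of h "r / 2" "real (Suc n)"] x by auto
      define r' where "r' = min (r / 2) (\<delta> / 2)"
      have r': "r' > 0" "r' < \<delta>" "r' \<le> r / 2" using k(3) x(3) by (auto simp: r'_def)
      have "p a > real (Suc n)" if "a \<in> B" "nrm (a - k) \<le> r'" for a
        using k(4) that r'(2) by (meson order_le_less_trans)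
      then have "P (Suc n) (k, r')" "Q x (k, r')"
        using k(1,2) r' x by (simp_all add: P_def Q_def)
      then show "\<exists>y. P (Suc n) y \<and> Q x y" by blast
    qed
    then obtain F where F: "\<And>n. P n (F n)" "\<And>n. Q (F n) (F (Suc n))" by blast
    define h where "h n = fst (F n)" for n
    define r where "r n = snd (F n)" for n
    have h: "h n \<in> B" "r n > 0" "\<And>a. a \<in> B \<Longrightarrow> nrm (a - h n) \<le> r n \<Longrightarrow> p a > real n"
      "nrm (h (Suc n) - h n) \<le> r n / 2" "r (Suc n) \<le> r n / 2" for n
      using F(1)[of n] F(2)[of n] by (auto simp: P_def Q_def h_def r_def split: prod.splits)
    have r_pow: "r (n + m) \<le> r m * (1/2)^n" for n m
    proof (induction n)
      case (Suc n)
      then show ?case using h(5)[of "n + m"] by simp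
    qed simp
    define d where "d n = h (Suc n) - h n" for n
    have dB: "d n \<in> B" for n using diff_mem h by (simp add: d_def)
    have nd: "nrm (d (n + m)) \<le> r m / 2 * (1/2)^n" for n m
      using h(4)[of "n + m"] r_pow[of n m] by (simp add: d_def)
    have geo: "(\<lambda>n. r m / 2 * (1/2::real)^n) sums r m" for m
      using sums_mult[OF geometric_sums[of "1/2::real"], of "r m / 2"] by simp
    have sum_d: "summable (\<lambda>n. nrm (d (n + m)))" "(\<Sum>n. nrm (d (n + m))) \<le> r m" for m
    proof -
      show 1: "summable (\<lambda>n. nrm (d (n + m)))"
        by (rule summable_comparison_test'[OF sums_summable[OF geo[of m]], of 0])
           (use nd nrm_nonneg dB in auto)
      show "(\<Sum>n. nrm (d (n + m))) \<le> r m"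
        using suminf_le[OF nd 1 sums_summable[OF geo]] sums_unique[OF geo[of m]] by simp
    qed
    have pw: "summable (\<lambda>n. d n z)" for z
    proof -
      obtain C where C: "\<forall>f\<in>B. cmod (f z) \<le> C * nrm f" using eval_bounded by blast
      have "summable (\<lambda>n. C * nrm (d n))" using sum_d(1)[of 0] by (simp add: summable_mult)
      then show ?thesis
        by (rule summable_comparison_test'[of _ 0]) (use C dB in auto)
    qed
    define f where "f z = h 0 z + (\<Sum>n. d n z)" for z
    have tail: "(\<lambda>n. d (n + m) z) sums (f - h m) z" for m z
    proof -
      have "(\<Sum>i<m. d i z) = h m z - h 0 z" by (induction m) (auto simp: d_def)
      then show ?thesis
        using sums_iff_shift[of "\<lambda>n. d n z" m] summable_sums[OF pw[of z]] 
        by (simp add: f_def sums_iff summable_iff_shift suminf_minus_initial_segment pw)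
    qed
    have fh: "f - h m \<in> B" "nrm (f - h m) \<le> r m" for m
      using series[of "\<lambda>n. d (n + m)" "f - h m", OF dB sum_d(1) tail] sum_d(2)[of m] by auto
    have fB: "f \<in> B" using add_mem[OF fh(1)[of 0] h(1)[of 0]] by simp
    obtain m where "p f < real m" using reals_Archimedean2 by blast
    moreover have "p f > real m" using h(3)[OF fB fh(2)] .
    ultimately show False by simp
  qed
  then obtain C h0 r where h0: "h0 \<in> B" and r: "r > 0" and
    dense: "\<And>k \<delta>. \<lbrakk>k \<in> B; nrm (k - h0) \<le> r; \<delta> > 0\<rbrakk> \<Longrightarrow> \<exists>a\<in>B. nrm (a - k) < \<delta> \<and> p a \<le> C"
    by blast
  \<comment> \<open>Recentring at the origin: approximants of \<open>h0 + k\<close> and of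
    \<open>h0\<close> are subtracted, at the price of a factor 2.\<close>
  have dense0: "\<exists>a\<in>B. nrm (a - k) < \<delta> \<and> p a \<le> 2 * C" if k: "k \<in> B" "nrm k \<le> r" and \<delta>: "\<delta> > 0" for k \<delta>
  proof -
    have "h0 + k \<in> B" "nrm ((h0 + k) - h0) \<le> r" using add_mem[OF h0 k(1)] k by auto
    then obtain a where a: "a \<in> B" "nrm (a - (h0 + k)) < \<delta> / 2" "p a \<le> C"
      using dense[of "h0 + k" "\<delta> / 2"] \<delta> by auto
    obtain a' where a': "a' \<in> B" "nrm (a' - h0) < \<delta> / 2" "p a' \<le> C"
      using dense[of h0 "\<delta> / 2"] \<delta> h0 r nrm_zero by auto
    have "(a - a') - k = (a - (h0 + k)) - (a' - h0)" by simp
    then have "nrm ((a - a') - k) \<le> nrm (a - (h0 + k)) + nrm (a' - h0)"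
      using diff_mem[of "a - (h0 + k)" "a' - h0"] diff_mem[OF a(1) \<open>h0 + k \<in> B\<close>] diff_mem[OF a'(1) h0] by metis
    then have "nrm ((a - a') - k) < \<delta>" using a(2) a'(2) by simp
    then show ?thesis using p_diff[OF a(1) a'(1)] a a' diff_mem[OF a(1) a'(1)] by force
  qed
  have dense_scaled: "\<exists>a\<in>B. nrm (k - a) \<le> r * t / 2 \<and> p a \<le> 2 * C * t"
    if k: "k \<in> B" "nrm k \<le> r * t" and t: "t > 0" for k t
  proof -
    define k' where "k' = (\<lambda>z. of_real (1 / t) * k z)"
    have k': "k' \<in> B" "nrm k' \<le> r"
      using k t scale_mem[OF k(1), of "of_real (1 / t)"] nrm_scale[OF k(1), of "of_real (1 / t)"]
      unfolding k'_def by (auto simp: norm_divide pos_divide_le_eq)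
    then obtain a where a: "a \<in> B" "nrm (a - k') < r / 2" "p a \<le> 2 * C"
      using dense0[of k' "r / 2"] r by auto
    define b where "b = (\<lambda>z. of_real t * a z)"
    have b: "b \<in> B" using a by (simp add: b_def scale_mem)
    have "b - k = (\<lambda>z. of_real t * (a - k') z)" using t by (auto simp: b_def k'_def fun_eq_iff algebra_simps)
    then have "nrm (b - k) = t * nrm (a - k')" using nrm_scale[of "a - k'" "of_real t"] diff_mem[OF a(1) k'(1)] t by simp
    then have "nrm (k - b) \<le> r * t / 2" using a t nrm_minus[OF k(1) b] by simp
    moreover have "p b \<le> 2 * C * t" using p_scale[OF a(1), of "of_real t"] a t by (simp add: b_def)
    ultimately show ?thesis using b by blast
  qed
  have C0: "C \<ge> 0" using dense[of h0 1] h0 r nrm_zero p0 by force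
  \<comment> \<open>Successive approximation: the remainders \<open>x n\<close> have norm at most
    \<open>r / 2^n\<close>, and \<open>k\<close> is the sum of the pieces \<open>a n\<close> with
    \<open>p (a n)\<close> at most \<open>2 C / 2^n\<close>. Countable subadditivity gives
    \<open>4 C\<close>.\<close>
  have bound: "p k \<le> 4 * C" if k: "k \<in> B" "nrm k \<le> r" for k
  proof -
    define P where "P n x \<longleftrightarrow> x \<in> B \<and> nrm x \<le> r * (1/2)^n" for n :: nat and x
    define Q where "Q n x y \<longleftrightarrow> p (x - y) \<le> 2 * C * (1/2)^n" for n :: nat and x y
    have "\<exists>f. f 0 = k \<and> (\<forall>n. P n (f n)) \<and> (\<forall>n. Q n (f n) (f (Suc n)))"
    proof -
      have "\<exists>f. \<forall>n. (P n (f n) \<and> (n = 0 \<longrightarrow> f n = k)) \<and> Q n (f n) (f (Suc n))"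
      proof (rule dependent_nat_choice)
        show "\<exists>x. P 0 x \<and> ((0::nat) = 0 \<longrightarrow> x = k)" using k by (auto simp: P_def)
      next
        fix x n assume "P n x \<and> (n = 0 \<longrightarrow> x = k)"
        then have x: "x \<in> B" "nrm x \<le> r * (1/2)^n" by (auto simp: P_def)
        then obtain a where a: "a \<in> B" "nrm (x - a) \<le> r * (1/2)^n / 2" "p a \<le> 2 * C * (1/2)^n"
          using dense_scaled[of x "(1/2)^n"] by auto
        have "P (Suc n) (x - a)"  "Q n x (x - a)"
          using a x diff_mem[OF x(1) a(1)] by (auto simp: P_def Q_def)
        then show "\<exists>y. (P (Suc n) y \<and> (Suc n = 0 \<longrightarrow> y = k)) \<and> Q n x y" by blast
      qed
      then show ?thesis by blast
    qed
    then obtain x where x0: "x 0 = k" and xP: "\<And>n. P n (x n)" and xQ: "\<And>n. Q n (x n) (x (Suc n))" by blast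
    define a where "a n = x n - x (Suc n)" for n
    have xB: "x n \<in> B" "nrm (x n) \<le> r * (1/2)^n" for n using xP[of n] by (auto simp: P_def)
    have aB: "a n \<in> B" for n using diff_mem xB by (simp add: a_def)
    have pa: "p (a n) \<le> 2 * C * (1/2)^n" for n using xQ[of n] by (simp add: Q_def a_def)
    have geo: "(\<lambda>n. 2 * C * (1/2::real)^n) sums (4 * C)"
      using sums_mult[OF geometric_sums[of "1/2::real"], of "2 * C"] by simp
    have sp: "summable (\<lambda>n. p (a n))"
      by (rule summable_comparison_test'[OF sums_summable[OF geo], of 0]) (use pa p0 aB in auto)
    have "(\<lambda>n. a n z) sums k z" for z
    proof -
      obtain M where M: "M \<ge> 0" "\<forall>f\<in>B. cmod (f z) \<le> M * nrm f" using eval_bounded_pos by blast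
      have "(\<lambda>n. x n z) \<longlonglongrightarrow> 0"
      proof (rule Lim_null_comparison)
        show "\<forall>\<^sub>F n in sequentially. cmod (x n z) \<le> M * r * (1/2)^n"
        proof (intro always_eventually allI)
          fix n
          have "cmod (x n z) \<le> M * nrm (x n)" using M xB by blast
          also have "\<dots> \<le> M * (r * (1/2)^n)" using M xB by (intro mult_left_mono) auto
          finally show "cmod (x n z) \<le> M * r * (1/2)^n" by (simp add: mult.assoc)
        qed
        show "(\<lambda>n. M * r * (1/2)^n) \<longlonglongrightarrow> 0"
          by (intro tendsto_mult_right_zero LIMSEQ_realpow_zero) auto
      qed
      then have "(\<lambda>n. x n z - x (Suc n) z) sums (x 0 z - 0)" by (rule telescope_sums')
      then show ?thesis by (simp add: a_def x0)
    qed
    then have "(\<lambda>n. (\<phi> * a n) z) sums (\<phi> * k) z" for z by (simp add: sums_mult)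
    from series[of "\<lambda>n. \<phi> * a n" "\<phi> * k", OF \<phi>B[OF aB] _ this] sp have "p k \<le> (\<Sum>n. p (a n))" by (auto simp: p_def)
    also have "\<dots> \<le> 4 * C" using suminf_le[OF pa sp sums_summable[OF geo]] sums_unique[OF geo] by simp
    finally show ?thesis .
  qed
  have "p f \<le> 4 * C / r * nrm f" if f: "f \<in> B" for f
  proof (cases "nrm f = 0")
    case True
    then have "f = 0" using nrm_eq_0 f by blast
    then show ?thesis using True nrm_zero by (simp add: p_def)
  next
    case False
    then have n: "nrm f > 0" using nrm_nonneg[OF f] by simp
    have "nrm (\<lambda>z. of_real (r / nrm f) * f z) = r"
      unfolding nrm_scale[OF f] norm_of_real using n r by simp
    then have "p (\<lambda>z. of_real (r / nrm f) * f z) \<le> 4 * C" using bound scale_mem[OF f] by (metis order_refl)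
    then have "r / nrm f * p f \<le> 4 * C" using n r unfolding p_scale[OF f] norm_of_real by simp
    then show ?thesis using n r by (simp add: field_simps)
  qed
  moreover have "4 * C / r \<ge> 0" using C0 r by simp
  ultimately show ?thesis unfolding p_def by blast
qed

end

section \<open>A finite minimax principle\<close>

text \<open>The proof descends the convex function
  \<open>\<Sum>j. (max 0 (s j - r j))\<^sup>2\<close>, whose gradient supplies the weights.\<close>

lemma finite_minimax:
  fixes S :: "('j \<Rightarrow> real) set" and r R :: "'j \<Rightarrow> real"
  assumes J: "finite J" and convex: "\<And>s t u. \<lbrakk>s \<in> S; t \<in> S; 0 < u; u < 1\<rbrakk> \<Longrightarrow> (\<lambda>j. (1 - u) * s j + u * t j) \<in> S"
    and nonneg: "\<And>s j. s \<in> S \<Longrightarrow> j \<in> J \<Longrightarrow> 0 \<le> s j" and r: "\<And>j. j \<in> J \<Longrightarrow> 0 \<le> r j" and R: "\<And>j. j \<in> J \<Longrightarrow> r j < R j"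
    and weights: "\<And>c. (\<And>j. j \<in> J \<Longrightarrow> 0 < c j) \<Longrightarrow> \<exists>s\<in>S. (\<Sum>j\<in>J. c j * s j) \<le> (\<Sum>j\<in>J. c j * r j)"
  shows "\<exists>s\<in>S. \<forall>j\<in>J. s j \<le> R j"
proof (cases "J = {}")
  case True
  then show ?thesis using weights[of "\<lambda>_. 1"] by auto
next
  case False
  define D where "D s = (\<Sum>j\<in>J. (max 0 (s j - r j))\<^sup>2)" for s
  define m where "m = Min ((\<lambda>j. R j - r j) ` J)"
  have m: "m > 0" "\<And>j. j \<in> J \<Longrightarrow> m \<le> R j - r j"
    using J False R by (auto simp: m_def)
  \<comment> \<open>If \<open>D s < m^2\<close>, every single excess is below the smallest gap
    \<open>m\<close>. In the contrary case the infimum \<open>\<delta>\<close> of \<open>D\<close>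
    is positive, and a small convex step will undercut it.\<close>
  have "\<exists>s\<in>S. D s < m\<^sup>2"
  proof (rule ccontr)
    assume "\<not> ?thesis"
    then have ge: "m\<^sup>2 \<le> D s" if "s \<in> S" for s using that by force
    have ne: "S \<noteq> {}" using weights[of "\<lambda>_. 1"] by auto
    define \<delta> where "\<delta> = Inf (D ` S)"
    have bdd: "bdd_below (D ` S)" using ge by (intro bdd_belowI2)
    have "m\<^sup>2 \<le> \<delta>" unfolding \<delta>_def using ne ge by (rule cINF_greatest)
    then have \<delta>: "\<delta> > 0" using m(1) by (meson less_le_trans zero_less_power)
    have \<delta>_le: "\<delta> \<le> D s" if "s \<in> S" for s using cINF_lower[OF bdd that] by (simp add: \<delta>_def)
    define R0 where "R0 = (\<Sum>j\<in>J. r j)"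
    have R0: "R0 \<ge> 0" "\<And>j. j \<in> J \<Longrightarrow> r j \<le> R0"
      using r J by (auto simp: R0_def intro: sum_nonneg member_le_sum)
    \<comment> \<open>The gradient \<open>c\<close> may have zero entries while the hypothesis wants
      positive weights. Adding \<open>\<eta>\<close> to each of them costs at most
      \<open>\<eta> * R0 \<le> \<delta> / 2\<close>.\<close>
    define \<eta> where "\<eta> = \<delta> / (2 * (R0 + 1))"
    have \<eta>: "\<eta> > 0" "\<eta> * R0 \<le> \<delta> / 2" using \<delta> R0 by (auto simp: \<eta>_def field_simps)
    define a where "a = sqrt (2 * \<delta>)"
    \<comment> \<open>A bound for \<open>\<bar>t j - s j\<bar>\<close>: \<open>s j\<close> is at
      most \<open>R0 + a\<close>, and \<open>t j\<close> is controlled because its weight is at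
      least \<open>\<eta>\<close>.\<close>
    define b where "b = R0 + a + (a + \<eta>) * R0 / \<eta>"
    define K where "K = real (card J) * b\<^sup>2"
    \<comment> \<open>The step length is small enough for the quadratic error \<open>u^2 K\<close>
      to be at most \<open>u \<delta> / 2\<close>.\<close>
    define u where "u = min (1/2) (\<delta> / (2 * (K + 1)))"
    have a0: "a \<ge> 0" using \<delta> by (simp add: a_def)
    have b0: "b \<ge> 0" using a0 R0 \<eta> by (simp add: b_def)
    have K0: "K \<ge> 0" by (simp add: K_def)
    have u: "0 < u" "u < 1" using \<delta> K0 by (auto simp: u_def)
    have uK: "u * K \<le> \<delta> / 2"
    proof -
      have "u * K \<le> \<delta> / (2 * (K + 1)) * K" using K0 by (intro mult_right_mono) (auto simp: u_def)
      also have "\<dots> \<le> \<delta> / 2" using \<delta> K0 by (simp add: field_simps)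
      finally show ?thesis .
    qed
    \<comment> \<open>The point \<open>s\<close> is so close to optimal that the gain
      \<open>u \<delta> / 2\<close> of the step brings the value below the infimum.\<close>
    have "\<exists>x\<in>D ` S. x < \<delta> + u * \<delta> / 2"
      unfolding \<delta>_def[symmetric] using cInf_lessD[of "D ` S" "\<delta> + u * \<delta> / 2"] ne \<delta> u by (auto simp: \<delta>_def)
    then obtain s where s: "s \<in> S" "D s < \<delta> + u * \<delta> / 2" by blast
    define c where "c j = max 0 (s j - r j)" for j
    have "u * \<delta> \<le> 1 * \<delta>" using u \<delta> by (intro mult_right_mono) auto
    then have Ds: "D s \<le> 2 * \<delta>" using s(2) \<delta> by linarith
    have c: "0 \<le> c j" "c j \<le> a" if "j \<in> J" for j
    proof -
      show "0 \<le> c j" by (simp add: c_def)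
      have "(c j)\<^sup>2 \<le> D s"
        unfolding D_def c_def using J that by (intro member_le_sum) auto
      then have "(c j)\<^sup>2 \<le> 2 * \<delta>" using Ds by simp
      then show "c j \<le> a" unfolding a_def by (rule real_le_rsqrt)
    qed
    obtain t where t: "t \<in> S" "(\<Sum>j\<in>J. (c j + \<eta>) * t j) \<le> (\<Sum>j\<in>J. (c j + \<eta>) * r j)"
      using weights[of "\<lambda>j. c j + \<eta>"] c \<eta> by (auto simp: add_nonneg_pos)
    have t_le: "t j \<le> (a + \<eta>) * R0 / \<eta>" if "j \<in> J" for j
    proof -
      have "\<eta> * t j \<le> (c j + \<eta>) * t j"
        using c that nonneg[OF t(1)] by (intro mult_right_mono) auto
      also have "\<dots> \<le> (\<Sum>j\<in>J. (c j + \<eta>) * t j)"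
        using J that c \<eta> nonneg[OF t(1)] by (intro member_le_sum[of j J "\<lambda>j. (c j + \<eta>) * t j"]) auto
      also have "\<dots> \<le> (\<Sum>j\<in>J. (a + \<eta>) * r j)"
        using t(2) c r by (elim order_trans, intro sum_mono mult_right_mono) auto
      also have "\<dots> = (a + \<eta>) * R0" by (simp add: R0_def sum_distrib_left)
      finally show ?thesis using \<eta> by (simp add: pos_le_divide_eq mult.commute)
    qed
    have diff: "(t j - s j)\<^sup>2 \<le> b\<^sup>2" if j: "j \<in> J" for j
    proof -
      have "s j \<le> R0 + a" using c(2)[OF j] R0(2)[OF j] by (simp add: c_def)
      moreover have "0 \<le> (a + \<eta>) * R0 / \<eta>" using a0 \<eta> R0 by simp
      ultimately have "\<bar>t j - s j\<bar> \<le> b"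
        using t_le[OF j] nonneg[OF s(1) j] nonneg[OF t(1) j] a0 R0(1) unfolding b_def by linarith
      then show ?thesis using b0 by (intro power2_le_iff_abs_le[THEN iffD2]) auto
    qed
    define w where "w j = (1 - u) * s j + u * t j" for j
    have sq: "(max 0 (x + y))\<^sup>2 \<le> (max 0 x)\<^sup>2 + 2 * max 0 x * y + y\<^sup>2" for x y :: real
    proof (cases "x \<ge> 0")
      case True
      have "0 \<le> (x + y)\<^sup>2" by simp
      then show ?thesis using True by (cases "x + y \<ge> 0") (auto simp: power2_sum)
    next
      case False
      then have "\<bar>max 0 (x + y)\<bar> \<le> \<bar>y\<bar>" by auto
      then have "(max 0 (x + y))\<^sup>2 \<le> y\<^sup>2" by (rule abs_le_square_iff[THEN iffD1])
      then show ?thesis using False by simp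
    qed
    have "D w \<le> (\<Sum>j\<in>J. (c j)\<^sup>2 + 2 * u * (c j * (t j - s j)) + u\<^sup>2 * b\<^sup>2)"
      unfolding D_def
    proof (rule sum_mono)
      fix j assume j: "j \<in> J"
      have "w j - r j = (s j - r j) + u * (t j - s j)" by (simp add: w_def algebra_simps)
      then have "(max 0 (w j - r j))\<^sup>2 \<le> (c j)\<^sup>2 + 2 * c j * (u * (t j - s j)) + (u * (t j - s j))\<^sup>2"
        using sq[of "s j - r j" "u * (t j - s j)"] by (simp only: c_def)
      also have "(u * (t j - s j))\<^sup>2 \<le> u\<^sup>2 * b\<^sup>2"
        using diff[OF j] by (simp add: power_mult_distrib mult_left_mono)
      finally show "(max 0 (w j - r j))\<^sup>2 \<le> (c j)\<^sup>2 + 2 * u * (c j * (t j - s j)) + u\<^sup>2 * b\<^sup>2"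
        by (simp add: algebra_simps)
    qed
    also have "\<dots> = D s + 2 * u * (\<Sum>j\<in>J. c j * (t j - s j)) + u * (u * K)"
      by (simp add: D_def c_def sum.distrib sum_distrib_left K_def power2_eq_square)
    \<comment> \<open>The first-order gain: the inequality for the weights bounds the sum of
      \<open>c j * (t j - r j)\<close>, while the sum of \<open>c j * (s j - r j)\<close> is exactly
      \<open>D s\<close>.\<close>
    also have "(\<Sum>j\<in>J. c j * (t j - s j)) \<le> \<eta> * R0 - D s"
    proof -
      have "c j * (s j - r j) = (c j)\<^sup>2" for j by (auto simp: c_def max_def power2_eq_square)
      then have 1: "(\<Sum>j\<in>J. c j * (s j - r j)) = D s" by (simp add: D_def c_def)
      have "(\<Sum>j\<in>J. c j * t j) + \<eta> * (\<Sum>j\<in>J. t j) \<le> (\<Sum>j\<in>J. c j * r j) + \<eta> * R0"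
        using t(2) by (simp add: distrib_right sum.distrib sum_distrib_left R0_def)
      moreover have "0 \<le> \<eta> * (\<Sum>j\<in>J. t j)" using \<eta> nonneg[OF t(1)] by (simp add: sum_nonneg)
      ultimately have "(\<Sum>j\<in>J. c j * (t j - r j)) \<le> \<eta> * R0"
        by (simp add: right_diff_distrib sum_subtractf)
      then show ?thesis using 1 by (simp add: right_diff_distrib sum_subtractf)
    qed
    also have "D s + 2 * u * (\<eta> * R0 - D s) + u * (u * K) \<le> D s + 2 * u * (\<delta> / 2 - \<delta>) + u * (\<delta> / 2)"
      using u \<eta> \<delta>_le[OF s(1)] uK by (intro add_mono mult_left_mono) auto
    also have "\<dots> = D s - u * \<delta> / 2" by (simp add: algebra_simps)
    finally have "D w < \<delta>" using s(2) u by simp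
    moreover have "w \<in> S" unfolding w_def using convex[OF s(1) t(1) u] .
    ultimately show False using \<delta>_le by force
  qed
  then obtain s where s: "s \<in> S" "D s < m\<^sup>2" by blast
  have "s j \<le> R j" if j: "j \<in> J" for j
  proof -
    have "(max 0 (s j - r j))\<^sup>2 \<le> D s"
      unfolding D_def using J j by (intro member_le_sum) auto
    then have "max 0 (s j - r j) < m" using s(2) m(1) by (intro power2_less_imp_less[of _ m]) auto
    then show ?thesis using m(2)[OF j] by simp
  qed
  then show ?thesis using s(1) by blast
qed


section \<open>The Hilbert space of square-summable families\<close>

lemma sum_fun_apply: "sum f I x = (\<Sum>i\<in>I. f i x)" for f :: "'i \<Rightarrow> 'a \<Rightarrow> 'b::comm_monoid_add"
  by (induction I rule: infinite_finite_induct) auto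

text \<open>Unordered summation over an arbitrary index type, since an orthonormal set in the
  auxiliary space may be uncountable.\<close>

definition ell2 :: "('a \<Rightarrow> complex) set" where
  "ell2 = {x. (\<lambda>i. (cmod (x i))\<^sup>2) summable_on UNIV}"

definition ell2_ip :: "('a \<Rightarrow> complex) \<Rightarrow> ('a \<Rightarrow> complex) \<Rightarrow> complex" where
  "ell2_ip x y = (\<Sum>\<^sub>\<infinity>i. x i * cnj (y i))"

lemma ell2_prod_abs_summable:
  assumes "x \<in> ell2" "y \<in> ell2"
  shows "(\<lambda>i. norm (x i * y i)) summable_on UNIV"
  by (rule abs_summable_product) (use assms in \<open>simp_all add: ell2_def norm_mult power2_eq_square\<close>)

lemma ell2_cnj [simp]: "(\<lambda>i. cnj (x i)) \<in> ell2 \<longleftrightarrow> x \<in> ell2"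
  by (simp add: ell2_def)

lemma ell2_ip_summable:
  "x \<in> ell2 \<Longrightarrow> y \<in> ell2 \<Longrightarrow> (\<lambda>i. x i * cnj (y i)) summable_on UNIV"
  using ell2_prod_abs_summable[of x "\<lambda>i. cnj (y i)"] by (auto intro: abs_summable_summable)

lemma ell2_ip_self: "ell2_ip x x = of_real (\<Sum>\<^sub>\<infinity>i. (cmod (x i))\<^sup>2)"
proof -
  have "ell2_ip x x = (\<Sum>\<^sub>\<infinity>i. of_real ((cmod (x i))\<^sup>2))"
    unfolding ell2_ip_def complex_norm_square ..
  also have "\<dots> = of_real (\<Sum>\<^sub>\<infinity>i. (cmod (x i))\<^sup>2)"
  proof (cases "(\<lambda>i. (cmod (x i))\<^sup>2) summable_on UNIV")
    case True
    then show ?thesis by (intro infsumI has_sum_of_real has_sum_infsum)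
  next
    case False
    have "\<not> (\<lambda>i. complex_of_real ((cmod (x i))\<^sup>2)) summable_on UNIV"
    proof
      assume "(\<lambda>i. complex_of_real ((cmod (x i))\<^sup>2)) summable_on UNIV"
      from summable_on_Re[OF this] False show False by (simp only: Re_complex_of_real)
    qed
    from infsum_not_exists[OF this] infsum_not_exists[OF False] show ?thesis by (simp only: of_real_0)
  qed
  finally show ?thesis .
qed

lemma ell2_norm_sq: "(ip_norm ell2_ip x)\<^sup>2 = (\<Sum>\<^sub>\<infinity>i. (cmod (x i))\<^sup>2)"
  by (simp add: ip_norm_def ell2_ip_self infsum_nonneg)

lemma ell2_norm_nonneg: "0 \<le> ip_norm ell2_ip x"
  by (simp add: ip_norm_def ell2_ip_self infsum_nonneg)

lemma ell2I:
  assumes "\<And>F. finite F \<Longrightarrow> (\<Sum>i\<in>F. (cmod (x i))\<^sup>2) \<le> C\<^sup>2" and "C \<ge> 0"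
  shows "x \<in> ell2" "ip_norm ell2_ip x \<le> C"
proof -
  have *: "(\<lambda>i. (cmod (x i))\<^sup>2) summable_on UNIV"
    by (rule nonneg_bdd_above_summable_on) (use assms(1) in \<open>auto intro!: bdd_aboveI2\<close>)
  then show "x \<in> ell2" by (simp add: ell2_def)
  have "(ip_norm ell2_ip x)\<^sup>2 \<le> C\<^sup>2"
    unfolding ell2_norm_sq by (rule infsum_le_finite_sums[OF *]) (use assms(1) in auto)
  then show "ip_norm ell2_ip x \<le> C" using assms(2) by (rule power2_le_imp_le)
qed

lemma ell2_sum_le: "x \<in> ell2 \<Longrightarrow> finite F \<Longrightarrow> (\<Sum>i\<in>F. (cmod (x i))\<^sup>2) \<le> (ip_norm ell2_ip x)\<^sup>2"
  unfolding ell2_norm_sq by (rule finite_sum_le_infsum) (auto simp: ell2_def)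

lemma ell2_component_le: "x \<in> ell2 \<Longrightarrow> cmod (x i) \<le> ip_norm ell2_ip x"
  using ell2_sum_le[of x "{i}"] by (auto intro: power2_le_imp_le ell2_norm_nonneg)

lemma vector_space_fun: "vector_space (\<lambda>c (f :: 'a \<Rightarrow> complex) z. c * f z)"
  by unfold_locales (auto simp: fun_eq_iff algebra_simps)

lemma ell2_add: 
  assumes "x \<in> ell2" "y \<in> ell2" shows "x + y \<in> ell2"
proof -
  have "(\<lambda>i. 2 * (cmod (x i))\<^sup>2 + 2 * (cmod (y i))\<^sup>2) summable_on UNIV"
    using assms by (intro summable_on_add summable_on_cmult_right) (auto simp: ell2_def)
  moreover have "(cmod ((x + y) i))\<^sup>2 \<le> 2 * (cmod (x i))\<^sup>2 + 2 * (cmod (y i))\<^sup>2" for i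
  proof -
    have "(cmod (x i + y i))\<^sup>2 \<le> (cmod (x i) + cmod (y i))\<^sup>2"
      by (intro power_mono norm_triangle_ineq) auto
    moreover have "0 \<le> (cmod (x i) - cmod (y i))\<^sup>2" by simp
    ultimately show ?thesis by (simp add: power2_sum power2_diff)
  qed
  ultimately show ?thesis
    unfolding ell2_def mem_Collect_eq by (rule summable_on_comparison_test) auto
qed

lemma ell2_scale: "x \<in> ell2 \<Longrightarrow> (\<lambda>i. c * x i) \<in> ell2"
  by (simp add: ell2_def norm_mult power_mult_distrib summable_on_cmult_right)

lemma ell2_zero: "0 \<in> ell2" by (simp add: ell2_def)

lemma ell2_diff: "x \<in> ell2 \<Longrightarrow> y \<in> ell2 \<Longrightarrow> x - y \<in> ell2"
  using ell2_add[of x "\<lambda>i. (-1) * y i"] ell2_scale[of y "-1"] by (simp add: plus_fun_def fun_diff_def)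

lemma ell2_complete:
  assumes s: "\<And>n. s n \<in> ell2"
    and Cauchy: "\<forall>e>0. \<exists>N. \<forall>m\<ge>N. \<forall>n\<ge>N. ip_norm ell2_ip (s m - s n) < e"
  shows "\<exists>l\<in>ell2. (\<lambda>n. ip_norm ell2_ip (s n - l)) \<longlonglongrightarrow> 0"
proof -
  have "Cauchy (\<lambda>n. s n i)" for i
  proof (rule metric_CauchyI)
    fix e :: real assume "e > 0"
    then obtain N where N: "\<forall>m\<ge>N. \<forall>n\<ge>N. ip_norm ell2_ip (s m - s n) < e" using Cauchy by blast
    have "dist (s m i) (s n i) < e" if "m \<ge> N" "n \<ge> N" for m n
    proof -
      have "dist (s m i) (s n i) = cmod ((s m - s n) i)" by (simp add: dist_norm)
      also have "\<dots> \<le> ip_norm ell2_ip (s m - s n)" by (rule ell2_component_le[OF ell2_diff[OF s s]])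
      also have "\<dots> < e" using N that by blast
      finally show ?thesis .
    qed
    then show "\<exists>M. \<forall>m\<ge>M. \<forall>n\<ge>M. dist (s m i) (s n i) < e" by blast
  qed
  then have l: "(\<lambda>n. s n i) \<longlonglongrightarrow> lim (\<lambda>n. s n i)" for i
    by (simp add: Cauchy_convergent_iff convergent_LIMSEQ_iff)
  define l where "l i = lim (\<lambda>n. s n i)" for i
  note l = l[folded l_def]
  have close: "s m - l \<in> ell2 \<and> ip_norm ell2_ip (s m - l) \<le> e"
    if e: "e > 0" "\<forall>m\<ge>N. \<forall>n\<ge>N. ip_norm ell2_ip (s m - s n) < e" and m: "m \<ge> N" for e N m
  proof -
    have "(\<Sum>i\<in>F. (cmod ((s m - l) i))\<^sup>2) \<le> e\<^sup>2" if F: "finite F" for F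
    proof (rule LIMSEQ_le_const2)
      show "(\<lambda>n. \<Sum>i\<in>F. (cmod (s m i - s n i))\<^sup>2) \<longlonglongrightarrow> (\<Sum>i\<in>F. (cmod ((s m - l) i))\<^sup>2)"
        unfolding minus_apply by (intro tendsto_intros l)
      have "(\<Sum>i\<in>F. (cmod (s m i - s n i))\<^sup>2) \<le> e\<^sup>2" if "n \<ge> N" for n
      proof -
        have "(\<Sum>i\<in>F. (cmod (s m i - s n i))\<^sup>2) \<le> (ip_norm ell2_ip (s m - s n))\<^sup>2"
          using ell2_sum_le[OF ell2_diff[OF s s] F, of m n] by simp
        also have "\<dots> \<le> e\<^sup>2" using e(2) m that ell2_norm_nonneg by (intro power_mono) (auto intro: less_imp_le)
        finally show ?thesis .
      qed
      then show "\<exists>N. \<forall>n\<ge>N. (\<Sum>i\<in>F. (cmod (s m i - s n i))\<^sup>2) \<le> e\<^sup>2" by blast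
    qed
    then show ?thesis using ell2I[of "s m - l" e] e(1) by simp
  qed
  obtain N where "\<forall>m\<ge>N. \<forall>n\<ge>N. ip_norm ell2_ip (s m - s n) < 1" using Cauchy zero_less_one by blast
  then have "s N - l \<in> ell2" using close[of 1 N N] by simp
  then have "l \<in> ell2" using ell2_diff[OF s[of N]] by force
  moreover have "(\<lambda>n. ip_norm ell2_ip (s n - l)) \<longlonglongrightarrow> 0"
  proof (rule LIMSEQ_I)
    fix r :: real assume "r > 0"
    then obtain N where N: "\<forall>m\<ge>N. \<forall>n\<ge>N. ip_norm ell2_ip (s m - s n) < r / 2" 
      using Cauchy half_gt_zero by blast
    then have "ip_norm ell2_ip (s m - l) < r" if "m \<ge> N" for m
      using close[of "r / 2" N m] that \<open>r > 0\<close> by simp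
    then show "\<exists>no. \<forall>n\<ge>no. norm (ip_norm ell2_ip (s n - l) - 0) < r"
      by (intro exI[of _ N]) (simp add: ell2_norm_nonneg)
  qed
  ultimately show ?thesis by blast
qed

interpretation ell2: complex_hilbert_space "\<lambda>c (f :: 'a \<Rightarrow> complex) z. c * f z" ell2 ell2_ip
proof -
  interpret vector_space "\<lambda>c (f :: 'a \<Rightarrow> complex) z. c * f z" by (rule vector_space_fun)
  show "complex_hilbert_space (\<lambda>c (f :: 'a \<Rightarrow> complex) z. c * f z) ell2 ell2_ip"
  proof
    show "subspace (ell2 :: ('a \<Rightarrow> complex) set)"
      by (intro subspaceI ell2_zero ell2_add ell2_scale)
  next
    fix u v w :: "'a \<Rightarrow> complex" assume "u \<in> ell2" "v \<in> ell2" "w \<in> ell2"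
    then show "ell2_ip (u + v) w = ell2_ip u w + ell2_ip v w"
      by (simp add: ell2_ip_def distrib_right infsum_add ell2_ip_summable)
  next
    fix v w :: "'a \<Rightarrow> complex" and c assume "v \<in> ell2" "w \<in> ell2"
    then show "ell2_ip (\<lambda>z. c * v z) w = c * ell2_ip v w"
      by (simp add: ell2_ip_def mult.assoc infsum_cmult_right ell2_ip_summable)
  next
    fix v w :: "'a \<Rightarrow> complex" assume "v \<in> ell2" "w \<in> ell2"
    show "ell2_ip w v = cnj (ell2_ip v w)"
      by (simp add: ell2_ip_def mult.commute flip: infsum_cnj)
  next
    fix v :: "'a \<Rightarrow> complex" assume v: "v \<in> ell2"
    show "0 \<le> Re (ell2_ip v v)" by (simp add: ell2_ip_self infsum_nonneg)
    assume "ell2_ip v v = 0"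
    then have "ip_norm ell2_ip v = 0" by (simp add: ip_norm_def)
    then show "v = 0" using ell2_component_le[OF v] by (auto simp: fun_eq_iff)
  qed (rule ell2_complete)
qed

definition unit_vec :: "'a \<Rightarrow> 'a \<Rightarrow> complex" where
  "unit_vec a = (\<lambda>i. if i = a then 1 else 0)"

lemma unit_vec_ell2: "unit_vec a \<in> ell2"
  unfolding ell2_def mem_Collect_eq
  by (rule finite_nonzero_values_imp_summable_on, rule finite_subset[of _ "{a}"]) (auto simp: unit_vec_def)

lemma ell2_ip_unit_vec: "ell2_ip x (unit_vec a) = x a"
proof -
  have "ell2_ip x (unit_vec a) = (\<Sum>\<^sub>\<infinity>i\<in>{a}. x i * cnj (unit_vec a i))"
    unfolding ell2_ip_def by (rule infsum_cong_neutral) (auto simp: unit_vec_def)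
  then show ?thesis by (simp add: unit_vec_def)
qed

lemma tendsto_ell2_component:
  assumes "\<And>n. s n \<in> ell2" "l \<in> ell2" "(\<lambda>n. ip_norm ell2_ip (s n - l)) \<longlonglongrightarrow> 0"
  shows "(\<lambda>n. s n i) \<longlonglongrightarrow> l i"
  using ell2.tendsto_ip_left[OF assms unit_vec_ell2[of i]] by (simp add: ell2_ip_unit_vec)

section \<open>Inner-outer factorization on the full Fock space\<close>

text \<open>\<open>ell2 :: ('e list \<times> nat \<Rightarrow> complex) set\<close> is the tensor product of \<open>\<ell>\<^sup>2\<close> and the full Fock space,
  which has the words over \<open>'e\<close> as an orthonormal basis, and \<open>shift w\<close> is right multiplication
  by the word \<open>w\<close>.\<close>

definition shift :: "'e list \<Rightarrow> ('e list \<times> nat \<Rightarrow> complex) \<Rightarrow> 'e list \<times> nat \<Rightarrow> complex" where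
  "shift w x = (\<lambda>(v, i). if suffix w v then x (take (length v - length w) v, i) else 0)"

lemma shift_append [simp]: "shift w x (u @ w, i) = x (u, i)"
  by (simp add: shift_def suffix_def)

lemma shift_not_suffix [simp]: "\<not> suffix w v \<Longrightarrow> shift w x (v, i) = 0"
  by (simp add: shift_def)

lemma shift_Nil [simp]: "shift [] x = x"
  by (auto simp: shift_def fun_eq_iff)

lemma shift_shift: "shift w (shift v x) = shift (v @ w) x"
proof
  fix p :: "'a list \<times> nat"
  obtain a i where p: "p = (a, i)" by (cases p)
  show "shift w (shift v x) p = shift (v @ w) x p"
  proof (cases "suffix w a")
    case True
    then obtain u where a: "a = u @ w" by (auto simp: suffix_def)
    show ?thesis
    proof (cases "suffix v u")
      case True
      then obtain t where u: "u = t @ v" by (auto simp: suffix_def)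
      have "shift (v @ w) x (t @ (v @ w), i) = x (t, i)" by (rule shift_append)
      moreover have "shift w (shift v x) ((t @ v) @ w, i) = x (t, i)" by (simp only: shift_append)
      ultimately show ?thesis by (simp add: p a u)
    next
      case False
      then have "\<not> suffix (v @ w) a" by (auto simp: a suffix_def)
      then show ?thesis using False by (simp add: p a)
    qed
  next
    case False
    then have "\<not> suffix (v @ w) a" by (auto simp: suffix_def)
    then show ?thesis using False by (simp add: p)
  qed
qed

lemma shift_add: "shift w (x + y) = shift w x + shift w y"
  and shift_diff: "shift w (x - y) = shift w x - shift w y"
  and shift_scale: "shift w (\<lambda>p. c * x p) = (\<lambda>p. c * shift w x p)"
  and shift_zero: "shift w 0 = 0"
  by (auto simp: shift_def fun_eq_iff)

lemma ell2_ip_shift: "ell2_ip (shift w x) (shift w y) = ell2_ip x y"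
proof -
  let ?h = "\<lambda>(u, i :: nat). (u @ w, i)"
  have "ell2_ip (shift w x) (shift w y) = (\<Sum>\<^sub>\<infinity>p\<in>range ?h. shift w x p * cnj (shift w y p))"
    unfolding ell2_ip_def
  proof (rule infsum_cong_neutral)
    fix p assume "p \<in> UNIV - range ?h"
    then have "\<not> suffix w (fst p)" by (cases p) (auto simp: suffix_def image_iff)
    then show "shift w x p * cnj (shift w y p) = 0" by (cases p) auto
  qed auto
  also have "\<dots> = (\<Sum>\<^sub>\<infinity>p. shift w x (?h p) * cnj (shift w y (?h p)))"
    by (subst infsum_reindex) (auto simp: inj_on_def o_def)
  also have "\<dots> = ell2_ip x y"
    unfolding ell2_ip_def by (intro infsum_cong) auto
  finally show ?thesis .
qed

lemma ell2_norm_shift: "ip_norm ell2_ip (shift w x) = ip_norm ell2_ip x"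
  by (simp add: ip_norm_def ell2_ip_shift)

lemma shift_ell2:
  assumes x: "x \<in> ell2" shows "shift w x \<in> ell2"
proof -
  let ?h = "\<lambda>(u, i :: nat). (u @ w, i)"
  have "(\<lambda>p. (cmod (shift w x p))\<^sup>2) summable_on range ?h"
    using x by (subst summable_on_reindex)
      (auto simp: inj_on_def o_def ell2_def case_prod_beta)
  then show ?thesis unfolding ell2_def mem_Collect_eq
  proof (rule summable_on_cong_neutral[THEN iffD1, rotated 3])
    fix p assume "p \<in> UNIV - range ?h"
    then have "\<not> suffix w (fst p)" by (cases p) (auto simp: suffix_def image_iff)
    then show "(cmod (shift w x p))\<^sup>2 = 0" by (cases p) auto
  qed auto
qed

text \<open>Two suffixes of one word are comparable, so the supports are disjoint.\<close>

lemma ell2_ip_shift_incomparable: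
  assumes "\<not> suffix w v" "\<not> suffix v w"
  shows "ell2_ip (shift w x) (shift v y) = 0"
proof -
  have "shift w x p * cnj (shift v y p) = 0" for p
  proof -
    obtain a i where p: "p = (a, i)" by (cases p)
    have "\<not> suffix w a \<or> \<not> suffix v a" using assms suffix_same_cases by blast
    then show ?thesis by (auto simp: p)
  qed
  then show ?thesis by (simp only: ell2_ip_def infsum_0_simp)
qed

text \<open>The product of noncommutative power series, with \<open>y\<close> scalar and
  \<open>x\<close> a column. A word has finitely many suffixes, so every coefficient is a finite sum
  and no convergence is involved.\<close>

definition fock_mult :: "('e list \<times> nat \<Rightarrow> complex) \<Rightarrow> ('e list \<Rightarrow> complex) \<Rightarrow> 'e list \<times> nat \<Rightarrow> complex" where
  "fock_mult x y = (\<lambda>(v, i). \<Sum>w | suffix w v. y w * shift w x (v, i))"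

lemma finite_suffix: "finite {w. suffix w v}"
  by (rule finite_subset[of _ "set (suffixes v)"]) auto

text \<open>Multiplication by an inner \<open>x\<close> takes the standard basis to the orthonormal
  shifts of \<open>x\<close>; the contractive half of the isometry is what is stated.\<close>

lemma fock_mult_isometry:
  assumes x: "ell2.orthonormal_family (\<lambda>w. shift w x) UNIV" and y: "y \<in> ell2"
  shows "fock_mult x y \<in> ell2" "ip_norm ell2_ip (fock_mult x y) \<le> ip_norm ell2_ip y"
proof -
  have sx: "shift w x \<in> ell2" for w using x by (simp add: ell2.orthonormal_family_def)
  have "(\<Sum>p\<in>F. (cmod (fock_mult x y p))\<^sup>2) \<le> (ip_norm ell2_ip y)\<^sup>2" if F: "finite F" for F
  proof -
    \<comment> \<open>The coordinates in \<open>F\<close> see only coefficients at suffixes of their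
      words, so a finite orthonormal combination can replace \<open>fock_mult x y\<close>.\<close>
    define W where "W = (\<Union>p\<in>F. {w. suffix w (fst p)})"
    have W: "finite W" using F finite_suffix by (auto simp: W_def)
    define g where "g = (\<Sum>w\<in>W. (\<lambda>p. y w * shift w x p))"
    have g: "g \<in> ell2" unfolding g_def using sx by (intro ell2.sum_in ell2.scale_in)
    have gp: "fock_mult x y p = g p" if "p \<in> F" for p
    proof -
      obtain v i where p: "p = (v, i)" by (cases p)
      have "(\<Sum>w | suffix w v. y w * shift w x (v, i)) = (\<Sum>w\<in>W. y w * shift w x (v, i))"
        by (rule sum.mono_neutral_left) (use W that p in \<open>auto simp: W_def\<close>)
      then show ?thesis by (simp add: fock_mult_def g_def p sum_fun_apply)
    qed
    have "(\<Sum>p\<in>F. (cmod (fock_mult x y p))\<^sup>2) = (\<Sum>p\<in>F. (cmod (g p))\<^sup>2)"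
      using gp by simp
    also have "\<dots> \<le> (ip_norm ell2_ip g)\<^sup>2" using g F by (rule ell2_sum_le)
    also have "\<dots> = (\<Sum>w\<in>W. (cmod (y w))\<^sup>2)"
      unfolding g_def using ell2.orthonormal_family_subset[OF x] W by (intro ell2.vnorm_lincomb_orthonormal) auto
    also have "\<dots> \<le> (ip_norm ell2_ip y)\<^sup>2" using y W by (rule ell2_sum_le)
    finally show ?thesis .
  qed
  from ell2I[OF this ell2_norm_nonneg]
  show "fock_mult x y \<in> ell2" "ip_norm ell2_ip (fock_mult x y) \<le> ip_norm ell2_ip y" by auto
qed


text \<open>The wandering vector \<open>T\<close> of the cyclic subspace generated by \<open>X\<close> is the component of \<open>X\<close>
  orthogonal to all \<open>shift w X\<close> with \<open>w \<noteq> []\<close>.\<close>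

theorem inner_outer_factorization:
  assumes X: "X \<in> ell2" "X \<noteq> 0"
  obtains x y where "ell2.orthonormal_family (\<lambda>w. shift w x) UNIV" "y \<in> ell2"
    "ip_norm ell2_ip y \<le> ip_norm ell2_ip X" "X = fock_mult x y"
proof -
  \<comment> \<open>\<open>D u\<close> is the translate by \<open>u\<close> of the span of the
    proper shifts of \<open>X\<close>; the closure of \<open>D []\<close> is what is split off from
    \<open>X\<close>.\<close>
  define D where "D u = ell2.span {shift (w @ u) X | w. w \<noteq> []}" for u
  have sX: "shift w X \<in> ell2" for w using X(1) by (rule shift_ell2)
  have D_ell2: "D u \<subseteq> ell2" for u
    unfolding D_def using sX by (intro ell2.span_minimal ell2.subspace_V) auto
  have D_sub: "ell2.subspace (D u)" for u unfolding D_def by (rule ell2.subspace_span)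
  have D_shift: "shift u d \<in> D u" if "d \<in> D []" for u d
    using that unfolding D_def
  proof (rule ell2.span_induct)
    show "ell2.subspace {d. shift u d \<in> ell2.span {shift (w @ u) X |w. w \<noteq> []}}"
      by (rule ell2.subspaceI)
        (auto simp: shift_zero shift_add shift_scale ell2.span_zero ell2.span_add ell2.span_scale)
  qed (auto intro!: ell2.span_base simp: shift_shift)
  obtain x0 s where x0: "x0 \<in> ell2" "\<And>d. d \<in> D [] \<Longrightarrow> ell2_ip d (X - x0) = 0"
    "\<And>n::nat. s n \<in> D []" "(\<lambda>n. ip_norm ell2_ip (s n - x0)) \<longlonglongrightarrow> 0"
    using ell2.projection[OF D_sub D_ell2 X(1)] by metis
  have s_ell2: "s n \<in> ell2" for n using x0(3) D_ell2 by blast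
  have lim_shift: "(\<lambda>n. ell2_ip (shift u (s n)) z) \<longlonglongrightarrow> ell2_ip (shift u x0) z" if "z \<in> ell2" for u z
  proof (rule ell2.tendsto_ip_left)
    show "(\<lambda>n. ip_norm ell2_ip (shift u (s n) - shift u x0)) \<longlonglongrightarrow> 0"
      using x0(4) by (simp only: shift_diff[symmetric] ell2_norm_shift)
  qed (use that x0 s_ell2 in \<open>auto intro: shift_ell2\<close>)
  \<comment> \<open>\<open>shift u x0\<close> is only a limit of elements of \<open>D u\<close>, so
    orthogonality to \<open>D u\<close> carries over by continuity.\<close>
  have x0_perp: "ell2_ip (shift u x0) z = 0" if z: "z \<in> ell2" "\<And>d. d \<in> D u \<Longrightarrow> ell2_ip d z = 0" for u z
    using lim_shift[OF z(1), of u] z(2)[OF D_shift[OF x0(3)]] by (simp add: LIMSEQ_const_iff)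
  define T where "T = X - x0"
  have T: "T \<in> ell2" using X x0 by (auto simp: T_def intro: ell2_diff)
  have XT: "shift u X = shift u T + shift u x0" for u by (simp add: T_def shift_diff)
  have TX: "ell2_ip (shift w X) T = 0" if "w \<noteq> []" for w
    unfolding T_def using that by (intro x0(2)) (auto simp: D_def intro!: ell2.span_base exI[of _ w])
  have T_perp_D: "ell2_ip d T = 0" if d: "d \<in> D u" for d u
    by (rule ell2.ip_span_eq_0[OF d[unfolded D_def] T]) (auto simp: sX TX)
  have TT: "ell2_ip (shift w T) T = 0" if "w \<noteq> []" for w
  proof -
    have "ell2_ip (shift w X) T = ell2_ip (shift w T) T + ell2_ip (shift w x0) T"
      unfolding XT using T x0 by (intro ell2.ip_add_left shift_ell2)
    then show ?thesis using TX[OF that] x0_perp[OF T T_perp_D] by simp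
  qed
  \<comment> \<open>Otherwise \<open>X\<close> is a limit of combinations of proper shifts of
    itself. Their values at a word are combinations of values of \<open>X\<close> at shorter words,
    so \<open>X\<close> vanishes by induction on the length.\<close>
  have "T \<noteq> 0"
  proof
    assume "T = 0"
    then have Xx0: "X = x0" by (simp add: T_def)
    have "X (v, i) = 0" for v i
    proof (induction "length v" arbitrary: v i rule: less_induct)
      case less
      have "d (v, i) = 0" if "d \<in> D []" for d
        using that unfolding D_def
      proof (rule ell2.span_induct)
        show "ell2.subspace {d. d (v, i) = 0}" by (rule ell2.subspaceI) auto
        fix d assume "d \<in> {shift (w @ []) X |w. w \<noteq> []}"
        then obtain w where w: "w \<noteq> []" "d = shift w X" by auto
        show "d (v, i) = 0"
        proof (cases "suffix w v")
          case True
          then obtain u where "v = u @ w" by (auto simp: suffix_def)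
          then show ?thesis using less[of u i] w by simp
        qed (simp add: w)
      qed
      then have "s n (v, i) = 0" for n using x0(3) by blast
      then have "(\<lambda>n. 0) \<longlonglongrightarrow> x0 (v, i)"
        using tendsto_ell2_component[OF s_ell2 x0(1,4), of "(v, i)"] by simp
      then show ?case using Xx0 by (simp add: LIMSEQ_const_iff)
    qed
    then show False using X(2) by (auto simp: fun_eq_iff)
  qed
  then have nT: "ip_norm ell2_ip T > 0"
    using ell2.vnorm_eq_0[OF T] ell2_norm_nonneg[of T] by linarith
  define c where "c = complex_of_real (1 / ip_norm ell2_ip T)"
  define x where "x = (\<lambda>p. c * T p)"
  have x: "x \<in> ell2" unfolding x_def using T by (rule ell2_scale)
  have sx: "shift w x \<in> ell2" for w using x by (rule shift_ell2)
  have nx: "ell2_ip x x = 1"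
  proof -
    have "ip_norm ell2_ip x = 1" using nT unfolding x_def ell2.vnorm_scale[OF T] c_def norm_of_real by simp
    then show ?thesis using ell2.ip_self[OF x] by simp
  qed
  have xx: "ell2_ip (shift w x) x = 0" if "w \<noteq> []" for w
    unfolding x_def shift_scale using TT[OF that] T
    by (simp add: ell2.ip_scale_left ell2.ip_scale_right shift_ell2 ell2_scale)
  have Xx: "ell2_ip (shift u X) (shift w x) = 0" if "\<not> suffix u w" for u w
  proof (cases "suffix w u")
    case True
    then obtain t where u: "u = t @ w" by (auto simp: suffix_def)
    then have "t \<noteq> []" using that by auto
    have "ell2_ip (shift u X) (shift w x) = ell2_ip (shift t X) x"
      unfolding u shift_shift[symmetric] ell2_ip_shift ..
    also have "\<dots> = 0" unfolding x_def using TX[OF \<open>t \<noteq> []\<close>] T sX by (simp add: ell2.ip_scale_right)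
    finally show ?thesis .
  qed (use that in \<open>rule ell2_ip_shift_incomparable\<close>)
  have ort: "ell2.orthonormal_family (\<lambda>w. shift w x) UNIV"
    unfolding ell2.orthonormal_family_def
  proof (intro conjI ballI sx)
    fix w v
    have suff: "ell2_ip (shift w x) (shift v x) = 0" if suf: "suffix v w" "w \<noteq> v" for v w
    proof -
      obtain t where w: "w = t @ v" using suf(1) by (auto simp: suffix_def)
      then have "t \<noteq> []" using suf(2) by auto
      then show ?thesis unfolding w shift_shift[symmetric] ell2_ip_shift by (rule xx)
    qed
    show "ell2_ip (shift w x) (shift v x) = (if w = v then 1 else 0)"
    proof (cases "w = v")
      case False
      then show ?thesis
        using suff[of v w] suff[of w v] ell2_ip_shift_incomparable[of w v x x]
          ell2.ip_commute[OF sx[of v] sx[of w]] by (cases "suffix w v"; cases "suffix v w") auto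
    qed (simp add: ell2_ip_shift nx)
  qed
  define y where "y w = ell2_ip X (shift w x)" for w
  have "(\<Sum>w\<in>F. (cmod (y w))\<^sup>2) \<le> (ip_norm ell2_ip X)\<^sup>2" if "finite F" for F
    unfolding y_def using ell2.orthonormal_family_subset[OF ort] that X by (intro ell2.bessel) auto
  from ell2I[OF this ell2_norm_nonneg]
  have y: "y \<in> ell2" "ip_norm ell2_ip y \<le> ip_norm ell2_ip X" by auto
  \<comment> \<open>Instead of placing \<open>X\<close> in the closed span of the shifts of
    \<open>x\<close>, each coordinate is checked. With \<open>P\<close> the projection of the unit
    vector \<open>Z\<close> onto the shifts by suffixes of \<open>v\<close>, the claim becomes
    orthogonality of \<open>X\<close> and \<open>q = Z - P\<close>.\<close>
  have "X (v, i) = fock_mult x y (v, i)" for v i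
  proof -
    define Z where "Z = unit_vec (v, i)"
    have Z: "Z \<in> ell2" by (simp add: Z_def unit_vec_ell2)
    define W where "W = {w. suffix w v}"
    have W: "finite W" by (simp add: W_def finite_suffix)
    define P where "P = (\<Sum>w\<in>W. (\<lambda>p. ell2_ip Z (shift w x) * shift w x p))"
    have P: "P \<in> ell2" unfolding P_def using sx by (intro ell2.sum_in ell2.scale_in)
    define q where "q = Z - P"
    have q: "q \<in> ell2" using Z P by (simp add: q_def ell2_diff)
    have ip_P: "ell2_ip a P = (\<Sum>w\<in>W. cnj (ell2_ip Z (shift w x)) * ell2_ip a (shift w x))" if "a \<in> ell2" for a
      unfolding P_def using that sx by (subst ell2.ip_sum_right) (auto simp: ell2.ip_scale_right intro: ell2_scale)
    have perp0: "ell2_ip (shift u X) q = 0" if "\<not> suffix u v" for u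
    proof -
      have "\<not> suffix u w" if "w \<in> W" for w
        using that \<open>\<not> suffix u v\<close> suffix_order.trans by (auto simp: W_def)
      then have "ell2_ip (shift u X) P = 0" using ip_P[OF sX] Xx by simp
      moreover have "ell2_ip (shift u X) Z = 0" using that by (simp add: Z_def ell2_ip_unit_vec)
      ultimately show ?thesis using Z P sX by (simp add: q_def ell2.ip_diff_right)
    qed
    \<comment> \<open>Downward induction on the length of \<open>u\<close>: the part
      \<open>shift u x0\<close> comes from longer shifts, and \<open>shift u T\<close> is a multiple
      of \<open>shift u x\<close>, to which \<open>q\<close> is orthogonal by construction. Words
      that are not suffixes of \<open>v\<close> form the base.\<close>
    have perp: "ell2_ip (shift u X) q = 0" for u
    proof (induction "length v - length u" arbitrary: u rule: less_induct)
      case less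
      show ?case
      proof (cases "suffix u v")
        case True
        have "ell2_ip (shift (w @ u) X) q = 0" if "w \<noteq> []" for w
        proof (cases "suffix (w @ u) v")
          case True
          then have "length (w @ u) \<le> length v" by (rule suffix_length_le)
          moreover have "length w > 0" using that by simp
          ultimately have "length v - length (w @ u) < length v - length u"
            unfolding length_append by arith
          then show ?thesis by (rule less)
        qed (rule perp0)
        then have "ell2_ip d q = 0" if "d \<in> D u" for d
          by (intro ell2.ip_span_eq_0[OF that[unfolded D_def] q]) (auto simp: sX)
        then have 1: "ell2_ip (shift u x0) q = 0" using q by (intro x0_perp)
        have "ell2_ip P (shift u x) = ell2_ip Z (shift u x)"
          unfolding P_def using True W ort ell2.orthonormal_family_subset[OF ort]
          by (intro ell2.ip_lincomb_orthonormal) (auto simp: W_def)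
        then have "ell2_ip q (shift u x) = 0" using Z P sx by (simp add: q_def ell2.ip_diff_left)
        then have "ell2_ip (shift u x) q = 0" using ell2.ip_commute[OF q sx[of u]] by simp
        then have "c * ell2_ip (shift u T) q = 0"
          unfolding x_def shift_scale using q T by (simp add: ell2.ip_scale_left shift_ell2)
        then have "ell2_ip (shift u T) q = 0" using nT by (simp add: c_def)
        with 1 show ?thesis
          unfolding XT using q T x0 by (simp add: ell2.ip_add_left shift_ell2)
      qed (rule perp0)
    qed
    have "ell2_ip X Z = ell2_ip X P"
      using perp[of "[]"] X Z P by (simp add: q_def ell2.ip_diff_right)
    then have "X (v, i) = (\<Sum>w\<in>W. cnj (ell2_ip Z (shift w x)) * y w)"
      using ip_P[OF X(1)] by (simp add: Z_def ell2_ip_unit_vec y_def)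
    moreover have "cnj (ell2_ip Z (shift w x)) = shift w x (v, i)" for w
      using ell2.ip_commute[OF Z sx[of w]] by (simp add: Z_def ell2_ip_unit_vec)
    ultimately show ?thesis by (simp add: fock_mult_def W_def mult.commute)
  qed
  then show thesis using that[OF ort y] by (simp add: fun_eq_iff)
qed


section \<open>Column factorization in complete Nevanlinna--Pick spaces\<close>

lemma has_sum_prod_complex:
  fixes f :: "'a \<Rightarrow> complex" and g :: "'b \<Rightarrow> complex"
  assumes f: "(\<lambda>x. norm (f x)) summable_on UNIV" and g: "(\<lambda>y. norm (g y)) summable_on UNIV"
  shows "((\<lambda>(x, y). f x * g y) has_sum (infsum f UNIV * infsum g UNIV)) UNIV"
proof -
  have "(\<lambda>p. norm (case p of (x, y) \<Rightarrow> f x * g y)) summable_on (UNIV \<times> UNIV)"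
    unfolding Infinite_Sum.abs_summable_on_Sigma_iff
    using summable_on_cmult_left[OF f, of "\<Sum>\<^sub>\<infinity>y. norm (g y)"]
    by (auto simp: norm_mult infsum_cmult_right' intro!: summable_on_cmult_right g infsum_nonneg
        simp: abs_of_nonneg infsum_nonneg)
  then have s: "(\<lambda>(x, y). f x * g y) summable_on (UNIV \<times> UNIV)"
    by (rule abs_summable_summable)
  have "infsum (\<lambda>(x, y). f x * g y) (UNIV \<times> UNIV) = (\<Sum>\<^sub>\<infinity>x. \<Sum>\<^sub>\<infinity>y. f x * g y)"
    by (rule infsum_Sigma'_banach[symmetric, OF s])
  also have "\<dots> = infsum f UNIV * infsum g UNIV"
    by (simp add: infsum_cmult_right' infsum_cmult_left')
  finally show ?thesis using has_sum_infsum[OF s] by simp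
qed

text \<open>Equal Gram matrices give combinations with equal coefficients the same norm, so a
  functional on one span satisfies the same bound on the other and \<open>interpolation\<close>
  applies. It is used in both directions between the Fock space and \<open>H\<close>.\<close>

lemma gram_transfer:
  fixes v1 :: "'i \<Rightarrow> 'a::ab_group_add" and v2 :: "'i \<Rightarrow> 'b::ab_group_add"
  assumes "complex_hilbert_space scale1 V1 ip1" "complex_hilbert_space scale2 V2 ip2"
    and v: "\<And>z. v1 z \<in> V1" "\<And>z. v2 z \<in> V2" and gram: "\<And>z w. ip1 (v1 z) (v1 w) = ip2 (v2 z) (v2 w)"
    and x: "x \<in> V1"
  obtains y where "y \<in> V2" "ip_norm ip2 y \<le> ip_norm ip1 x" "\<And>z. ip2 y (v2 z) = ip1 x (v1 z)"
proof -
  interpret h1: complex_hilbert_space scale1 V1 ip1 by fact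
  interpret h2: complex_hilbert_space scale2 V2 ip2 by fact
  have in1: "(\<Sum>z\<in>Y. scale1 (c z) (v1 z)) \<in> V1" and in2: "(\<Sum>z\<in>Y. scale2 (c z) (v2 z)) \<in> V2" for Y c
    using v by (auto intro: h1.sum_in h2.sum_in h1.scale_in h2.scale_in)
  have same: "h1.vnorm (\<Sum>z\<in>Y. scale1 (c z) (v1 z)) = h2.vnorm (\<Sum>z\<in>Y. scale2 (c z) (v2 z))" for Y c
  proof -
    have "ip1 (\<Sum>z\<in>Y. scale1 (c z) (v1 z)) (\<Sum>z\<in>Y. scale1 (c z) (v1 z)) =
        (\<Sum>z\<in>Y. \<Sum>w\<in>Y. cnj (c z) * (c w * ip1 (v1 w) (v1 z)))"
      using v in1 by (simp add: h1.ip_sum_left h1.ip_sum_right h1.scale_in h1.ip_scale_left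
          h1.ip_scale_right sum_distrib_left)
    moreover have "ip2 (\<Sum>z\<in>Y. scale2 (c z) (v2 z)) (\<Sum>z\<in>Y. scale2 (c z) (v2 z)) =
        (\<Sum>z\<in>Y. \<Sum>w\<in>Y. cnj (c z) * (c w * ip2 (v2 w) (v2 z)))"
      using v in2 by (simp add: h2.ip_sum_left h2.ip_sum_right h2.scale_in h2.ip_scale_left
          h2.ip_scale_right sum_distrib_left)
    ultimately show ?thesis by (simp add: ip_norm_def gram)
  qed
  show thesis
  proof (rule h2.interpolation[of v2 "h1.vnorm x" "\<lambda>z. ip1 x (v1 z)"])
    fix Y c
    have "(\<Sum>z\<in>Y. c z * cnj (ip1 x (v1 z))) = ip1 (\<Sum>z\<in>Y. scale1 (c z) (v1 z)) x"
      using v x by (simp add: h1.ip_sum_left h1.scale_in h1.ip_scale_left h1.ip_commute[OF x v(1)])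
    then show "cmod (\<Sum>z\<in>Y. c z * cnj (ip1 x (v1 z))) \<le> h1.vnorm x * h2.vnorm (\<Sum>z\<in>Y. scale2 (c z) (v2 z))"
      using h1.Cauchy_Schwarz[OF in1 x] by (simp add: same mult.commute)
  qed (use v x that in auto)
qed

text \<open>Tonelli's theorem; it matches a family on words times naturals with the realisation
  \<open>tensor_l2\<close> of the Hilbert space tensor product.\<close>

lemma ell2_column_iff:
  "X \<in> ell2 \<longleftrightarrow> (\<forall>i. (\<lambda>v. X (v, i)) \<in> ell2) \<and> summable (\<lambda>i::nat. (ip_norm ell2_ip (\<lambda>v. X (v, i)))\<^sup>2)"
proof -
  have "X \<in> ell2 \<longleftrightarrow> (\<lambda>p. norm ((\<lambda>(i, v). (cmod (X (v, i)))\<^sup>2) p)) summable_on (UNIV \<times> UNIV)"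
  proof -
    have "X \<in> ell2 \<longleftrightarrow> (\<lambda>p. (cmod (X p))\<^sup>2) summable_on (UNIV \<times> UNIV)" by (simp add: ell2_def)
    also have "\<dots> \<longleftrightarrow> (\<lambda>(i, v). (cmod (X (v, i)))\<^sup>2) summable_on (UNIV \<times> UNIV)" by (rule summable_on_swap)
    finally show ?thesis by (simp add: case_prod_unfold)
  qed
  also have "\<dots> \<longleftrightarrow> (\<forall>i. (\<lambda>v. X (v, i)) \<in> ell2) \<and> summable (\<lambda>i. (ip_norm ell2_ip (\<lambda>v. X (v, i)))\<^sup>2)"
    unfolding Infinite_Sum.abs_summable_on_Sigma_iff ell2_norm_sq
    by (simp add: ell2_def abs_of_nonneg infsum_nonneg summable_on_UNIV_nonneg_real_iff)
  finally show ?thesis .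
qed

lemma ell2_column_norm:
  assumes X: "X \<in> ell2"
  shows "(\<Sum>i::nat. (ip_norm ell2_ip (\<lambda>v. X (v, i)))\<^sup>2) = (ip_norm ell2_ip X)\<^sup>2"
proof -
  have s: "(\<lambda>(i, v). (cmod (X (v, i)))\<^sup>2) summable_on (UNIV \<times> UNIV)"
    using X summable_on_swap[of "\<lambda>p. (cmod (X p))\<^sup>2" UNIV UNIV] by (simp add: ell2_def)
  have "summable (\<lambda>i. (ip_norm ell2_ip (\<lambda>v. X (v, i)))\<^sup>2)" using X ell2_column_iff by blast
  then have "(\<lambda>i. (ip_norm ell2_ip (\<lambda>v. X (v, i)))\<^sup>2) summable_on UNIV"
    by (simp add: summable_on_UNIV_nonneg_real_iff)
  from has_sum_imp_sums[OF has_sum_infsum[OF this]]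
  have "(\<Sum>i. (ip_norm ell2_ip (\<lambda>v. X (v, i)))\<^sup>2) = (\<Sum>\<^sub>\<infinity>i. (ip_norm ell2_ip (\<lambda>v. X (v, i)))\<^sup>2)"
    by (rule sums_unique[symmetric])
  also have "\<dots> = infsum (\<lambda>(i, v). (cmod (X (v, i)))\<^sup>2) (UNIV \<times> UNIV)"
    unfolding ell2_norm_sq by (rule infsum_Sigma'_banach[OF s])
  also have "\<dots> = infsum (\<lambda>p. (cmod (X p))\<^sup>2) (UNIV \<times> UNIV)"
    by (rule infsum_reindex_bij_witness[of _ "\<lambda>(v, i). (i, v)" "\<lambda>(i, v). (v, i)"]) auto
  also have "\<dots> = (ip_norm ell2_ip X)\<^sup>2" by (simp add: ell2_norm_sq)
  finally show ?thesis .
qed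

section \<open>Evaluation of noncommutative power series at points of the ball\<close>

lemma inj_Cons_pair: "inj (\<lambda>(s, w). s # w)"
  by (auto simp: inj_on_def)

text \<open>Commuting scalars are substituted for the letters. As \<open>w\<close> varies this is,
  up to conjugation, the vector of the full Fock space that represents evaluation at
  \<open>x\<close>.\<close>

definition monomial :: "('e \<Rightarrow> complex) \<Rightarrow> 'e list \<Rightarrow> complex" where
  "monomial x w = prod_list (map x w)"

lemma monomial_append: "monomial x (u @ w) = monomial x u * monomial x w"
  by (simp add: monomial_def)

text \<open>Splitting off the first letter bounds the sum over longer words by
  \<open>1 + p * S\<close>, where \<open>p\<close> is the squared norm of \<open>x\<close> and
  \<open>S\<close> the bound for shorter ones; \<open>1 / (1 - p)\<close> is the fixed
  point.\<close>

lemma monomial_sum_le: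
  assumes x: "x \<in> ell2" "ip_norm ell2_ip x < 1" and A: "finite A" "\<And>w. w \<in> A \<Longrightarrow> length w \<le> n"
  shows "(\<Sum>w\<in>A. (cmod (monomial x w))\<^sup>2) \<le> 1 / (1 - (ip_norm ell2_ip x)\<^sup>2)"
  using A
proof (induction n arbitrary: A)
  define p where "p = (ip_norm ell2_ip x)\<^sup>2"
  have p: "0 \<le> p" "p < 1" using x(2) ell2_norm_nonneg[of x] by (auto simp: p_def power_less_one_iff)
  have q: "1 \<le> 1 / (1 - p)" "1 + p * (1 / (1 - p)) = 1 / (1 - p)" using p by (auto simp: field_simps)
  {
    case 0
    have "(\<Sum>w\<in>A. (cmod (monomial x w))\<^sup>2) \<le> (\<Sum>w\<in>{[]}. (cmod (monomial x w))\<^sup>2)"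
      using 0 by (intro sum_mono2) auto
    also have "\<dots> = 1" by (simp add: monomial_def)
    finally show ?case using q(1) by (simp add: p_def)
  next
    case (Suc n)
    define T A' where "T = hd ` (A - {[]})" and "A' = tl ` (A - {[]})"
    have fin: "finite T" "finite A'" using Suc by (auto simp: T_def A'_def)
    have sub: "A \<subseteq> insert [] ((\<lambda>(s, w). s # w) ` (T \<times> A'))"
    proof
      fix w assume "w \<in> A"
      then show "w \<in> insert [] ((\<lambda>(s, w). s # w) ` (T \<times> A'))"
        by (cases w) (force simp: T_def A'_def image_iff)+
    qed
    have "(\<Sum>w\<in>A. (cmod (monomial x w))\<^sup>2) \<le>
        (\<Sum>w\<in>insert [] ((\<lambda>(s, w). s # w) ` (T \<times> A')). (cmod (monomial x w))\<^sup>2)"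
      using fin sub by (intro sum_mono2) auto
    also have "\<dots> = 1 + (\<Sum>w\<in>(\<lambda>(s, w). s # w) ` (T \<times> A'). (cmod (monomial x w))\<^sup>2)"
      using fin by (subst sum.insert) (auto simp: monomial_def)
    also have "(\<Sum>w\<in>(\<lambda>(s, w). s # w) ` (T \<times> A'). (cmod (monomial x w))\<^sup>2)
        = (\<Sum>(s, w)\<in>T \<times> A'. (cmod (x s))\<^sup>2 * (cmod (monomial x w))\<^sup>2)"
      by (subst sum.reindex) (auto simp: monomial_def norm_mult power_mult_distrib
          intro!: sum.cong inj_on_subset[OF inj_Cons_pair])
    also have "\<dots> = (\<Sum>s\<in>T. (cmod (x s))\<^sup>2) * (\<Sum>w\<in>A'. (cmod (monomial x w))\<^sup>2)"
      by (simp add: sum_product sum.cartesian_product)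
    also have "\<dots> \<le> p * (1 / (1 - p))"
      unfolding p_def using Suc.prems fin
      by (intro mult_mono ell2_sum_le x Suc.IH sum_nonneg) (auto simp: A'_def le_diff_conv)
    finally show ?case using q(2) by (simp add: p_def)
  }
qed

lemma monomial_ell2:
  assumes x: "x \<in> ell2" "ip_norm ell2_ip x < 1"
  shows "monomial x \<in> ell2"
proof -
  have p: "(ip_norm ell2_ip x)\<^sup>2 < 1" using x(2) ell2_norm_nonneg[of x] by (auto simp: power_less_one_iff)
  have "(\<Sum>w\<in>A. (cmod (monomial x w))\<^sup>2) \<le> (sqrt (1 / (1 - (ip_norm ell2_ip x)\<^sup>2)))\<^sup>2" if "finite A" for A
    using monomial_sum_le[OF x that, of "Max (length ` A)"] that p by simp
  from ell2I(1)[OF this] show ?thesis using p by simp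
qed

text \<open>Splitting off the first letter shows that the value \<open>S\<close> satisfies
  \<open>S = 1 + ell2_ip x y * S\<close>. This by itself excludes \<open>ell2_ip x y = 1\<close>, so
  the division is legitimate.\<close>

lemma ell2_ip_monomial:
  fixes x y :: "'a \<Rightarrow> complex"
  assumes x: "x \<in> ell2" "ip_norm ell2_ip x < 1" and y: "y \<in> ell2" "ip_norm ell2_ip y < 1"
  shows "ell2_ip (monomial x) (monomial y) = 1 / (1 - ell2_ip x y)"
proof -
  let ?h = "\<lambda>w. monomial x w * cnj (monomial y w)"
  have mx: "monomial x \<in> ell2" "monomial y \<in> ell2" using x y by (auto intro: monomial_ell2)
  have abs1: "(\<lambda>w. norm (?h w)) summable_on UNIV"
    using ell2_prod_abs_summable[of "monomial x" "\<lambda>w. cnj (monomial y w)"] mx by simp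
  have abs2: "(\<lambda>s. norm (x s * cnj (y s))) summable_on UNIV"
    using ell2_prod_abs_summable[of x "\<lambda>w. cnj (y w)"] x y by simp
  have "((\<lambda>(s, w). (x s * cnj (y s)) * ?h w) has_sum (ell2_ip x y * ell2_ip (monomial x) (monomial y))) UNIV"
    unfolding ell2_ip_def by (rule has_sum_prod_complex[OF abs2 abs1])
  also have "(\<lambda>(s, w). (x s * cnj (y s)) * ?h w) = ?h \<circ> (\<lambda>(s, w). s # w)"
    by (auto simp: fun_eq_iff monomial_def)
  finally have "(?h has_sum (ell2_ip x y * ell2_ip (monomial x) (monomial y))) (range (\<lambda>(s, w). s # w))"
    by (subst has_sum_reindex[OF inj_Cons_pair])
  then have hs: "(?h has_sum (?h [] + ell2_ip x y * ell2_ip (monomial x) (monomial y))) (insert [] (range (\<lambda>(s, w). s # w)))"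
    by (intro has_sum_insert) auto
  have uni: "insert [] (range (\<lambda>(s :: 'a, w). s # w)) = UNIV"
    by (auto simp: image_iff) (metis list.exhaust)
  have "ell2_ip (monomial x) (monomial y) = 1 + ell2_ip x y * ell2_ip (monomial x) (monomial y)"
  proof -
    have "?h [] = 1" by (simp add: monomial_def)
    with hs[unfolded uni] have "infsum ?h UNIV = 1 + ell2_ip x y * ell2_ip (monomial x) (monomial y)"
      by (simp only: infsumI)
    then show ?thesis by (simp only: ell2_ip_def)
  qed
  then have "ell2_ip (monomial x) (monomial y) * (1 - ell2_ip x y) = 1" by (simp add: algebra_simps)
  then show ?thesis by (metis div_by_0 mult_zero_right nonzero_eq_divide_eq zero_neq_one)
qed

text \<open>Evaluation is multiplicative because a pair \<open>(u, w)\<close> is the same as the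
  word \<open>u @ w\<close> with a marked suffix; absolute convergence allows summing over the
  suffixes of each word.\<close>

lemma fock_mult_monomial:
  assumes x: "(\<lambda>v. x (v, i)) \<in> ell2" and y: "y \<in> ell2" and m: "monomial a \<in> ell2"
  shows "(\<Sum>\<^sub>\<infinity>v. fock_mult x y (v, i) * monomial a v) =
    (\<Sum>\<^sub>\<infinity>v. x (v, i) * monomial a v) * (\<Sum>\<^sub>\<infinity>w. y w * monomial a w)"
proof -
  let ?B = "\<lambda>v. {w. suffix w v}"
  define h where "h = (\<lambda>(v, w). y w * shift w x (v, i) * monomial a v)"
  have "((\<lambda>(u, w). (x (u, i) * monomial a u) * (y w * monomial a w)) has_sum
      (\<Sum>\<^sub>\<infinity>v. x (v, i) * monomial a v) * (\<Sum>\<^sub>\<infinity>w. y w * monomial a w)) UNIV"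
    using ell2_prod_abs_summable[OF x m] ell2_prod_abs_summable[OF y m] by (rule has_sum_prod_complex)
  also have "(\<lambda>(u, w). (x (u, i) * monomial a u) * (y w * monomial a w)) = (\<lambda>p. h ((\<lambda>(u, w). (u @ w, w)) p))"
    by (auto simp: fun_eq_iff h_def monomial_append)
  finally have hs: "(h has_sum (\<Sum>\<^sub>\<infinity>v. x (v, i) * monomial a v) * (\<Sum>\<^sub>\<infinity>w. y w * monomial a w)) (Sigma UNIV ?B)"
  proof (rule has_sum_reindex_bij_betw[THEN iffD1, rotated])
    show "bij_betw (\<lambda>(u, w). (u @ w, w)) UNIV (Sigma UNIV ?B)"
      by (auto simp: bij_betw_def inj_on_def suffix_def image_iff)
  qed
  have "((\<lambda>w. h (v, w)) has_sum (fock_mult x y (v, i) * monomial a v)) (?B v)" for v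
    by (rule has_sum_finiteI) (auto simp: finite_suffix h_def fock_mult_def sum_distrib_right)
  from has_sum_SigmaD[OF hs this] show ?thesis by (simp add: infsumI)
qed

context normalized_cnp_space
begin

text \<open>The coordinates of \<open>b z\<close> in an orthonormal basis are substituted for the
  letters. The form of the kernel enters here: it is the Gram matrix of the vectors
  \<open>m z\<close>.\<close>

lemma ex_fock_coordinates:
  obtains m :: "'x \<Rightarrow> 'e list \<Rightarrow> complex"
  where "\<And>z. m z \<in> ell2" "\<And>z w. ell2_ip (m z) (m w) = 1 / (1 - ipE (b z) (b w))"
    "\<And>z x y i. \<lbrakk>(\<lambda>v. x (v, i)) \<in> ell2; y \<in> ell2\<rbrakk> \<Longrightarrow>
      (\<Sum>\<^sub>\<infinity>v. fock_mult x y (v, i :: nat) * m z v) = (\<Sum>\<^sub>\<infinity>v. x (v, i) * m z v) * (\<Sum>\<^sub>\<infinity>w. y w * m z w)"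
proof -
  obtain c where c: "\<And>u v. \<lbrakk>u \<in> E; v \<in> E\<rbrakk> \<Longrightarrow> ((\<lambda>s. c u s * cnj (c v s)) has_sum ipE u v) (UNIV :: 'e set)"
    using aux.ex_coordinates by blast
  define \<beta> where "\<beta> z = c (b z)" for z
  have ip\<beta>: "ell2_ip (\<beta> z) (\<beta> w) = ipE (b z) (b w)" for z w
    unfolding ell2_ip_def \<beta>_def using c[OF b_in b_in] by (rule infsumI)
  have \<beta>: "\<beta> z \<in> ell2" for z
  proof -
    have "(\<lambda>s. \<beta> z s * cnj (\<beta> z s)) summable_on UNIV"
      using c[OF b_in b_in] by (auto simp: \<beta>_def summable_on_def)
    then have "(\<lambda>s. complex_of_real ((cmod (\<beta> z s))\<^sup>2)) summable_on UNIV" by (simp only: complex_norm_square)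
    from summable_on_Re[OF this] show ?thesis by (simp only: ell2_def mem_Collect_eq Re_complex_of_real)
  qed
  have n\<beta>: "ip_norm ell2_ip (\<beta> z) < 1" for z
    using b_ball[of z] by (simp add: ip_norm_def ip\<beta>)
  show thesis
  proof (rule that[of "\<lambda>z. monomial (\<beta> z)"])
    show "monomial (\<beta> z) \<in> ell2" for z using \<beta> n\<beta> by (rule monomial_ell2)
    then show "\<lbrakk>(\<lambda>v. x (v, i)) \<in> ell2; y \<in> ell2\<rbrakk> \<Longrightarrow>
      (\<Sum>\<^sub>\<infinity>v. fock_mult x y (v, i) * monomial (\<beta> z) v) =
      (\<Sum>\<^sub>\<infinity>v. x (v, i) * monomial (\<beta> z) v) * (\<Sum>\<^sub>\<infinity>w. y w * monomial (\<beta> z) w)" for z x y i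
      using fock_mult_monomial by blast
    show "ell2_ip (monomial (\<beta> z)) (monomial (\<beta> w)) = 1 / (1 - ipE (b z) (b w))" for z w
      using ell2_ip_monomial[OF \<beta> n\<beta> \<beta> n\<beta>] by (simp add: ip\<beta>)
  qed
qed

text \<open>Evaluation \<open>\<pi>\<close> is multiplicative, maps the Fock space contractively
  onto \<open>H\<close>, and admits lifts that do not increase the norm. So the inner and the outer
  factor of a lift of \<open>F\<close> project to a contractive column of multipliers and to a
  function \<open>f\<close> of no larger norm.\<close>

theorem column_factorization:
  assumes F: "F \<in> tensor_l2 H ip"
  obtains \<phi> f where "f \<in> H" "ip_norm ip f \<le> tensor_l2_norm ip F" "\<And>n. \<phi> n \<in> Mult H"
    "column_norm_le H ip \<phi> 1" "\<And>n. F n = \<phi> n * f"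
proof -
  obtain m :: "'x \<Rightarrow> 'e list \<Rightarrow> complex" where m: "\<And>z. m z \<in> ell2"
    and gram: "\<And>z w. ell2_ip (m z) (m w) = 1 / (1 - ipE (b z) (b w))"
    and mult: "\<And>z x y i. \<lbrakk>(\<lambda>v. x (v, i)) \<in> ell2; y \<in> ell2\<rbrakk> \<Longrightarrow>
      (\<Sum>\<^sub>\<infinity>v. fock_mult x y (v, i :: nat) * m z v) = (\<Sum>\<^sub>\<infinity>v. x (v, i) * m z v) * (\<Sum>\<^sub>\<infinity>w. y w * m z w)"
    using ex_fock_coordinates by blast
  define K where "K z w = 1 / (1 - ipE (b z) (b w))" for z w
  have k: "(\<lambda>z. K z w) \<in> H" "\<And>f. f \<in> H \<Longrightarrow> ip f (\<lambda>z. K z w) = f w" for w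
    using kernel unfolding reproducing_kernel_def K_def by auto
  \<comment> \<open>\<open>\<kappa> z\<close> is the vector representing evaluation at
    \<open>z\<close>, hence the conjugate; it is unrelated to the column-row constant.\<close>
  define \<kappa> where "\<kappa> z = (\<lambda>w. cnj (m z w))" for z
  have \<kappa>: "\<kappa> z \<in> ell2" for z using m[of z] by (simp add: \<kappa>_def)
  have \<kappa>_gram: "ell2_ip (\<kappa> z) (\<kappa> w) = ip (\<lambda>v. K v z) (\<lambda>v. K v w)" for z w
  proof -
    have "ell2_ip (\<kappa> z) (\<kappa> w) = ell2_ip (m w) (m z)" by (simp add: ell2_ip_def \<kappa>_def mult.commute)
    then show ?thesis using k gram by (simp add: K_def)
  qed
  define \<pi> where "\<pi> x z = (\<Sum>\<^sub>\<infinity>v. x v * m z v)" for x z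
  have \<pi>: "\<pi> x z = ell2_ip x (\<kappa> z)" for x z by (simp add: \<pi>_def ell2_ip_def \<kappa>_def)
  have project: "\<pi> x \<in> H \<and> ip_norm ip (\<pi> x) \<le> ip_norm ell2_ip x" if x: "x \<in> ell2" for x
  proof -
    obtain f where f: "f \<in> H" "ip_norm ip f \<le> ip_norm ell2_ip x" "\<And>z. ip f (\<lambda>v. K v z) = ell2_ip x (\<kappa> z)"
      using gram_transfer[where ?v1.0 = \<kappa> and ?v2.0 = "\<lambda>z v. K v z", OF ell2.complex_hilbert_space_axioms complex_hilbert_space_axioms \<kappa> k(1) \<kappa>_gram x] by metis
    then have "f = \<pi> x" using k(2) by (auto simp: fun_eq_iff \<pi>)
    then show ?thesis using f by simp
  qed
  have lift: "\<exists>x\<in>ell2. ip_norm ell2_ip x \<le> ip_norm ip f \<and> \<pi> x = f" if f: "f \<in> H" for f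
  proof -
    obtain x where x: "x \<in> ell2" "ip_norm ell2_ip x \<le> ip_norm ip f" "\<And>z. ell2_ip x (\<kappa> z) = ip f (\<lambda>v. K v z)"
      using gram_transfer[where ?v2.0 = \<kappa> and ?v1.0 = "\<lambda>z v. K v z", OF complex_hilbert_space_axioms ell2.complex_hilbert_space_axioms k(1) \<kappa> \<kappa>_gram[symmetric] f] by metis
    then have "\<pi> x = f" using k(2) that by (auto simp: fun_eq_iff \<pi>)
    then show ?thesis using x by blast
  qed
  have FH: "F n \<in> H" and Fs: "summable (\<lambda>n. (ip_norm ip (F n))\<^sup>2)" for n
    using F by (auto simp: tensor_l2_def)
  obtain x where x: "\<And>n. x n \<in> ell2" "\<And>n. ip_norm ell2_ip (x n) \<le> ip_norm ip (F n)" "\<And>n. \<pi> (x n) = F n"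
    using lift[OF FH] by metis
  define X where "X = (\<lambda>(v, n). x n v)"
  have le: "(ip_norm ell2_ip (x n))\<^sup>2 \<le> (ip_norm ip (F n))\<^sup>2" for n
    using x(2) ell2_norm_nonneg by (intro power_mono) auto
  then have xs: "summable (\<lambda>n. (ip_norm ell2_ip (x n))\<^sup>2)"
    by (intro summable_comparison_test'[OF Fs, of 0]) auto
  have X: "X \<in> ell2" unfolding ell2_column_iff using x xs by (simp add: X_def)
  have nX: "ip_norm ell2_ip X \<le> tensor_l2_norm ip F"
  proof -
    have "(ip_norm ell2_ip X)\<^sup>2 \<le> (\<Sum>n. (ip_norm ip (F n))\<^sup>2)"
      unfolding ell2_column_norm[OF X, symmetric] using suminf_le[OF le xs Fs] by (simp add: X_def)
    then show ?thesis unfolding tensor_l2_norm_def by (rule real_le_rsqrt)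
  qed
  show thesis
  proof (cases "X = 0")
    case True
    then have x0: "x n v = 0" for n v by (auto simp: X_def fun_eq_iff split: prod.splits)
    have "F n = 0" for n using x(3)[of n] by (auto simp: fun_eq_iff \<pi>_def x0)
    moreover have "0 \<le> tensor_l2_norm ip F"
      using order_trans[OF ell2_norm_nonneg nX] .
    moreover have "column_norm_le H ip (\<lambda>n. 0) 1"
      by (auto simp: column_norm_le_def tensor_l2_def tensor_l2_norm_def)
    ultimately show thesis using that[of 0 "\<lambda>n. 0"] by (simp add: Mult_def)
  next
    case False
    obtain t y where t: "ell2.orthonormal_family (\<lambda>w. shift w t) UNIV" and y: "y \<in> ell2"
      "ip_norm ell2_ip y \<le> ip_norm ell2_ip X" and Xty: "X = fock_mult t y"
      using inner_outer_factorization[OF X False] by blast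
    have "shift [] t \<in> ell2" using t unfolding ell2.orthonormal_family_def by blast
    then have t_ell2: "(\<lambda>v. t (v, n)) \<in> ell2" for n unfolding shift_Nil ell2_column_iff by blast
    define \<phi> where "\<phi> n = \<pi> (\<lambda>v. t (v, n))" for n
    have \<phi>_mult: "\<phi> n * \<pi> u = \<pi> (\<lambda>v. fock_mult t u (v, n))" if "u \<in> ell2" for n u
      using mult[OF t_ell2 that] by (auto simp: fun_eq_iff \<phi>_def \<pi>_def)
    \<comment> \<open>The function \<open>u\<close> is lifted before multiplying: neither the lift,
      nor multiplication by the inner \<open>t\<close>, nor projecting the columns increases the
      norm.\<close>
    have column: "(\<forall>n. \<phi> n * u \<in> H) \<and> summable (\<lambda>n. (ip_norm ip (\<phi> n * u))\<^sup>2) \<and>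
        (\<Sum>n. (ip_norm ip (\<phi> n * u))\<^sup>2) \<le> (ip_norm ip u)\<^sup>2" if u: "u \<in> H" for u
    proof -
      obtain a where a: "a \<in> ell2" "ip_norm ell2_ip a \<le> ip_norm ip u" "\<pi> a = u"
        using lift[OF u] by blast
      let ?Y = "fock_mult t a"
      have Y: "?Y \<in> ell2" "ip_norm ell2_ip ?Y \<le> ip_norm ell2_ip a"
        using fock_mult_isometry[OF t a(1)] by auto
      have Yn: "(\<lambda>v. ?Y (v, n)) \<in> ell2" "summable (\<lambda>n. (ip_norm ell2_ip (\<lambda>v. ?Y (v, n)))\<^sup>2)" for n
        using Y(1) ell2_column_iff by blast+
      have eq: "\<phi> n * u = \<pi> (\<lambda>v. ?Y (v, n))" for n using \<phi>_mult[OF a(1)] a(3) by simp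
      have inH: "\<phi> n * u \<in> H" for n using project[OF Yn(1)] eq by simp
      have le: "(ip_norm ip (\<phi> n * u))\<^sup>2 \<le> (ip_norm ell2_ip (\<lambda>v. ?Y (v, n)))\<^sup>2" for n
        using project[OF Yn(1)] vnorm_nonneg[OF inH] by (intro power_mono) (auto simp: eq)
      have s: "summable (\<lambda>n. (ip_norm ip (\<phi> n * u))\<^sup>2)"
        using le by (intro summable_comparison_test'[OF Yn(2), of 0]) auto
      have "(\<Sum>n. (ip_norm ip (\<phi> n * u))\<^sup>2) \<le> (ip_norm ell2_ip ?Y)\<^sup>2"
        using suminf_le[OF le s Yn(2)] by (simp add: ell2_column_norm[OF Y(1)])
      also have "\<dots> \<le> (ip_norm ip u)\<^sup>2"
        using Y(2) a(2) ell2_norm_nonneg by (intro power_mono) (auto intro: order_trans)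
      finally show ?thesis using s inH by blast
    qed
    show thesis
    proof (rule that[of "\<pi> y" \<phi>])
      show "\<pi> y \<in> H" using project y by blast
      show "ip_norm ip (\<pi> y) \<le> tensor_l2_norm ip F" using project[OF y(1)] y(2) nX by linarith
      show "\<phi> n \<in> Mult H" for n using column by (auto simp: Mult_def)
      show "column_norm_le H ip \<phi> 1"
        unfolding column_norm_le_def tensor_l2_def tensor_l2_norm_def
        using column vnorm_nonneg by (auto intro!: real_le_lsqrt)
      show "F n = \<phi> n * \<pi> y" for n
        using \<phi>_mult[OF y(1), of n] x(3)[of n] by (simp add: Xty[symmetric] X_def)
    qed
  qed
qed

end


section \<open>The weak product\<close>

text \<open>Absolute convergence of the rows and of their totals justifies enumerating all terms
  along \<open>prod_decode\<close>; this merges countably many product representations into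
  one.\<close>

lemma double_sums:
  fixes c :: "nat \<Rightarrow> nat \<Rightarrow> 'b::banach"
  assumes inner: "\<And>n. summable (\<lambda>i. norm (c n i))" and outer: "summable (\<lambda>n. \<Sum>i. norm (c n i))"
  shows "(\<lambda>k. case_prod c (prod_decode k)) sums (\<Sum>n. \<Sum>i. c n i)"
proof -
  have eq_real: "infsum f UNIV = (\<Sum>n. f n)" if "f summable_on UNIV" for f :: "nat \<Rightarrow> real"
    using sums_unique[OF has_sum_imp_sums[OF has_sum_infsum[OF that]]] .
  have eq: "infsum f UNIV = (\<Sum>n. f n)" if "f summable_on UNIV" for f :: "nat \<Rightarrow> 'b"
    using sums_unique[OF has_sum_imp_sums[OF has_sum_infsum[OF that]]] .
  have 1: "(\<lambda>i. norm (c n i)) summable_on UNIV" for n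
    using inner by (simp add: summable_on_UNIV_nonneg_real_iff)
  have 2: "(\<lambda>n. \<Sum>i. norm (c n i)) summable_on UNIV"
    using outer by (simp add: summable_on_UNIV_nonneg_real_iff suminf_nonneg inner)
  have "(\<lambda>p. norm (case_prod c p)) summable_on (UNIV \<times> UNIV)"
    unfolding Infinite_Sum.abs_summable_on_Sigma_iff
    using 1 2 by (simp add: eq_real suminf_nonneg inner)
  then have s: "case_prod c summable_on (UNIV \<times> UNIV)" by (rule abs_summable_summable)
  have s_inner: "c n summable_on UNIV" for n using 1[of n] by (rule abs_summable_summable)
  have s_outer: "(\<lambda>n. infsum (c n) UNIV) summable_on UNIV"
    using summable_on_Sigma_banach[OF s] .
  have "(case_prod c has_sum (\<Sum>n. \<Sum>i. c n i)) UNIV"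
  proof -
    have "infsum (case_prod c) (UNIV \<times> UNIV) = (\<Sum>\<^sub>\<infinity>n. infsum (c n) UNIV)"
      by (rule infsum_Sigma'_banach[OF s, symmetric])
    also have "\<dots> = (\<Sum>n. \<Sum>i. c n i)"
      using s_outer unfolding eq[OF s_inner] by (rule eq)
    finally show ?thesis using has_sum_infsum[OF s] by simp
  qed
  then have "((\<lambda>k. case_prod c (prod_decode k)) has_sum (\<Sum>n. \<Sum>i. c n i)) UNIV"
    using has_sum_reindex_bij_betw[OF bij_prod_decode, of "case_prod c"] by blast
  then show ?thesis by (rule has_sum_imp_sums)
qed

section \<open>Norms of multiplication operators\<close>

context banach_function_space
begin

text \<open>A real supremum is an upper bound only when the set is bounded, which
  \<open>multiplication_bounded\<close> provides.\<close>

lemma mult_norm_bound: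
  assumes \<phi>: "\<phi> \<in> Mult B"
  shows "0 \<le> mult_norm B nrm \<phi>" "f \<in> B \<Longrightarrow> nrm (\<phi> * f) \<le> mult_norm B nrm \<phi> * nrm f"
proof -
  obtain C where C: "C \<ge> 0" "\<forall>f\<in>B. nrm (\<phi> * f) \<le> C * nrm f"
    using multiplication_bounded[OF \<phi>] by blast
  have "nrm (\<phi> * f) \<le> C" if "f \<in> B" "nrm f \<le> 1" for f
    using C(2)[rule_format, OF that(1)] mult_left_le[OF that(2) C(1)] by linarith
  then have "bdd_above ((\<lambda>f. nrm (\<phi> * f)) ` {f \<in> B. nrm f \<le> 1})" by (auto intro!: bdd_aboveI2)
  then have up: "nrm (\<phi> * f) \<le> mult_norm B nrm \<phi>" if "f \<in> B" "nrm f \<le> 1" for f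
    unfolding mult_norm_def using that by (intro cSUP_upper) auto
  show pos: "0 \<le> mult_norm B nrm \<phi>"
    using up[OF zero_mem] by (simp add: nrm_zero)
  assume f: "f \<in> B"
  show "nrm (\<phi> * f) \<le> mult_norm B nrm \<phi> * nrm f"
  proof (cases "nrm f = 0")
    case True
    then have "f = 0" using f nrm_eq_0 by blast
    then show ?thesis by (simp add: nrm_zero)
  next
    case False
    then have n: "nrm f > 0" using nrm_nonneg[OF f] by simp
    define g where "g = (\<lambda>z. of_real (1 / nrm f) * f z)"
    have "nrm g = 1" unfolding g_def nrm_scale[OF f] norm_of_real using n by simp
    moreover have "g \<in> B" unfolding g_def using f by (rule scale_mem)
    ultimately have "nrm (\<phi> * g) \<le> mult_norm B nrm \<phi>" by (intro up) auto
    moreover have "\<phi> * g = (\<lambda>z. of_real (1 / nrm f) * (\<phi> * f) z)" by (auto simp: g_def fun_eq_iff)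
    then have "nrm (\<phi> * g) = 1 / nrm f * nrm (\<phi> * f)"
      using nrm_scale[of "\<phi> * f" "of_real (1 / nrm f)"] \<phi> f n unfolding norm_of_real by (simp add: Mult_def)
    ultimately show ?thesis using n by (simp add: field_simps)
  qed
qed

lemma mult_norm_le:
  assumes "C \<ge> 0" "\<And>f. f \<in> B \<Longrightarrow> nrm (\<phi> * f) \<le> C * nrm f"
  shows "mult_norm B nrm \<phi> \<le> C"
  unfolding mult_norm_def
proof (rule cSUP_least)
  show "{f \<in> B. nrm f \<le> 1} \<noteq> {}" using zero_mem nrm_zero by force
  show "nrm (\<phi> * f) \<le> C" if "f \<in> {f \<in> B. nrm f \<le> 1}" for f
    using assms(2)[of f] that mult_left_le[of "nrm f" C] assms(1) by force
qed

end

section \<open>The Hilbert space and its weak product as Banach function spaces\<close>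

context rkhs
begin

lemma evaluation_le: "\<exists>C\<ge>0. \<forall>f\<in>H. cmod (f z) \<le> C * vnorm f"
proof -
  obtain C where C: "\<forall>f\<in>H. cmod (f z) \<le> C * vnorm f" using bounded_evaluation by blast
  have "\<forall>f\<in>H. cmod (f z) \<le> \<bar>C\<bar> * vnorm f"
    using C vnorm_nonneg by (meson abs_ge_self mult_right_mono order_trans)
  then show ?thesis by (meson abs_ge_zero)
qed

lemma tendsto_evaluation:
  assumes "\<And>n. s n \<in> H" "l \<in> H" "(\<lambda>n. vnorm (s n - l)) \<longlonglongrightarrow> 0"
  shows "(\<lambda>n. s n z) \<longlonglongrightarrow> l z"
proof -
  obtain C where C: "C \<ge> 0" "\<forall>f\<in>H. cmod (f z) \<le> C * vnorm f" using evaluation_le by blast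
  have "(\<lambda>n. s n z - l z) \<longlonglongrightarrow> 0"
  proof (rule Lim_null_comparison)
    show "(\<lambda>n. C * vnorm (s n - l)) \<longlonglongrightarrow> 0" using assms(3) by (rule tendsto_mult_right_zero)
    show "\<forall>\<^sub>F n in sequentially. cmod (s n z - l z) \<le> C * vnorm (s n - l)"
      using C(2) diff_in[OF assms(1,2)] by (intro always_eventually allI) fastforce
  qed
  then show ?thesis by (simp add: LIM_zero_iff)
qed

lemma banach_function_space: "banach_function_space H (ip_norm ip)"
proof
  show "\<exists>C. \<forall>f\<in>H. cmod (f z) \<le> C * vnorm f" for z by (rule bounded_evaluation)
next
  fix h :: "nat \<Rightarrow> 'x \<Rightarrow> complex" and f
  assume h: "\<And>n. h n \<in> H" and s: "summable (\<lambda>n. vnorm (h n))" and f: "\<And>z. (\<lambda>n. h n z) sums f z"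
  define S where "S N = (\<Sum>n<N. h n)" for N
  define P where "P N = (\<Sum>n<N. vnorm (h n))" for N
  have S: "S N \<in> H" for N using h by (simp add: S_def sum_in)
  have le: "vnorm (S n - S m) \<le> \<bar>P n - P m\<bar>" if "m \<le> n" for m n
  proof -
    have "S n - S m = sum h {m..<n}" using that sum_diff_nat_ivl[of 0 m n h] by (simp add: S_def atLeast0LessThan)
    moreover have "P n - P m = (\<Sum>i\<in>{m..<n}. vnorm (h i))"
      using that sum_diff_nat_ivl[of 0 m n "\<lambda>i. vnorm (h i)"] by (simp add: P_def atLeast0LessThan)
    ultimately show ?thesis using vnorm_sum_le[of "{m..<n}" h] h by simp
  qed
  have le': "vnorm (S m - S n) \<le> \<bar>P m - P n\<bar>" for m n
    using le[of m n] le[of n m] vnorm_minus[OF S S, of m n] by (cases "m \<le> n") auto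
  have "Cauchy P" using s unfolding P_def summable_iff_convergent by (rule convergent_Cauchy)
  have "\<forall>e>0. \<exists>N. \<forall>m\<ge>N. \<forall>n\<ge>N. vnorm (S m - S n) < e"
  proof safe
    fix e :: real assume "e > 0"
    then obtain N where "\<forall>m\<ge>N. \<forall>n\<ge>N. dist (P m) (P n) < e"
      using metric_CauchyD[OF \<open>Cauchy P\<close>] by blast
    then have "\<forall>m\<ge>N. \<forall>n\<ge>N. vnorm (S m - S n) < e"
      using le' by (metis dist_real_def order_le_less_trans)
    then show "\<exists>N. \<forall>m\<ge>N. \<forall>n\<ge>N. vnorm (S m - S n) < e" by blast
  qed
  then obtain l where l: "l \<in> H" "(\<lambda>n. vnorm (S n - l)) \<longlonglongrightarrow> 0"
    using complete[of S] S by blast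
  have "l z = f z" for z
  proof (rule LIMSEQ_unique)
    show "(\<lambda>N. S N z) \<longlonglongrightarrow> l z" using S l by (rule tendsto_evaluation)
    show "(\<lambda>N. S N z) \<longlonglongrightarrow> f z" using f[of z] by (simp add: S_def sums_def sum_fun_apply)
  qed
  then have lf: "l = f" by (simp add: fun_eq_iff)
  have "vnorm l \<le> (\<Sum>n. vnorm (h n))"
  proof (rule LIMSEQ_le)
    show "(\<lambda>N. vnorm (S N)) \<longlonglongrightarrow> vnorm l" using S l by (rule tendsto_vnorm)
    show "P \<longlonglongrightarrow> (\<Sum>n. vnorm (h n))" using s unfolding P_def by (rule summable_LIMSEQ)
    show "\<exists>N. \<forall>n\<ge>N. vnorm (S n) \<le> P n" unfolding S_def P_def using h by (intro exI allI impI vnorm_sum_le)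
  qed
  then show "f \<in> H \<and> vnorm f \<le> (\<Sum>n. vnorm (h n))" using l lf by simp
qed (use scale_in vnorm_scale in auto)

abbreviation W :: "('x \<Rightarrow> complex) set" where "W \<equiv> weak_product H ip"
abbreviation wnorm :: "('x \<Rightarrow> complex) \<Rightarrow> real" where "wnorm \<equiv> weak_product_norm H ip"

lemma weak_product_norm_le:
  assumes "product_representation H ip h f g"
  shows "wnorm h \<le> (\<Sum>i. vnorm (f i) * vnorm (g i))"
  unfolding weak_product_norm_def
proof (rule cInf_lower)
  show "bdd_below {(\<Sum>i. vnorm (f i) * vnorm (g i)) |f g. product_representation H ip h f g}"
    by (rule bdd_belowI[of _ 0]) (auto simp: product_representation_def intro!: suminf_nonneg)
qed (use assms in blast)

lemma weak_product_norm_nonneg: "h \<in> W \<Longrightarrow> 0 \<le> wnorm h"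
  unfolding weak_product_norm_def
proof (rule cInf_greatest)
  assume "h \<in> W"
  then show "{(\<Sum>i. vnorm (f i) * vnorm (g i)) |f g. product_representation H ip h f g} \<noteq> {}"
    unfolding weak_product_def by blast
qed (auto simp: product_representation_def intro!: suminf_nonneg)

lemma weak_product_norm_approx:
  assumes "h \<in> W" "wnorm h < a"
  obtains f g where "product_representation H ip h f g" "(\<Sum>i. vnorm (f i) * vnorm (g i)) < a"
proof -
  have "{(\<Sum>i. vnorm (f i) * vnorm (g i)) |f g. product_representation H ip h f g} \<noteq> {}"
    using assms(1) unfolding weak_product_def by blast
  from cInf_lessD[OF this assms(2)[unfolded weak_product_norm_def]] show thesis
    using that by blast
qed

lemma product_mem_weak_product:
  assumes "f \<in> H" "g \<in> H"
  shows "f * g \<in> W" "wnorm (f * g) \<le> vnorm f * vnorm g"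
proof -
  define F G where "F i = (if i = 0 then f else 0)" and "G i = (if i = 0 then g else 0)" for i :: nat
  have s: "(\<lambda>i. vnorm (F i) * vnorm (G i)) sums (vnorm f * vnorm g)"
    using sums_finite[of "{0}" "\<lambda>i. vnorm (F i) * vnorm (G i)"] by (simp add: F_def G_def)
  have "(\<lambda>i. F i z * G i z) sums (f * g) z" for z
    using sums_finite[of "{0}" "\<lambda>i. F i z * G i z"] by (simp add: F_def G_def)
  then have r: "product_representation H ip (f * g) F G"
    using assms sums_summable[OF s] by (auto simp: product_representation_def F_def G_def)
  then show "f * g \<in> W" by (auto simp: weak_product_def)
  show "wnorm (f * g) \<le> vnorm f * vnorm g" using weak_product_norm_le[OF r] sums_unique[OF s] by simp
qed

lemma product_representation_mult:
  assumes r: "product_representation H ip h f g" and \<theta>: "\<theta> \<in> Mult H"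
    and C: "\<And>f. f \<in> H \<Longrightarrow> vnorm (\<theta> * f) \<le> C * vnorm f"
  shows "product_representation H ip (\<theta> * h) (\<lambda>i. \<theta> * f i) g"
    "(\<Sum>i. vnorm (\<theta> * f i) * vnorm (g i)) \<le> C * (\<Sum>i. vnorm (f i) * vnorm (g i))"
proof -
  have H: "f i \<in> H" "g i \<in> H" "\<theta> * f i \<in> H" for i using r \<theta> by (auto simp: product_representation_def Mult_def)
  have s: "summable (\<lambda>i. C * (vnorm (f i) * vnorm (g i)))"
    using r by (intro summable_mult) (auto simp: product_representation_def)
  have le: "vnorm (\<theta> * f i) * vnorm (g i) \<le> C * (vnorm (f i) * vnorm (g i))" for i
    using mult_right_mono[OF C[OF H(1)] vnorm_nonneg[OF H(2)]] by (simp add: mult.assoc)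
  have s': "summable (\<lambda>i. vnorm (\<theta> * f i) * vnorm (g i))"
    using le H by (intro summable_comparison_test'[OF s, of 0]) auto
  have "(\<lambda>i. (\<theta> * f i) z * g i z) sums (\<theta> * h) z" for z
    using r sums_mult[of "\<lambda>i. f i z * g i z" "h z" "\<theta> z"]
    by (simp add: product_representation_def mult.assoc)
  then show "product_representation H ip (\<theta> * h) (\<lambda>i. \<theta> * f i) g"
    using H s' by (simp add: product_representation_def)
  show "(\<Sum>i. vnorm (\<theta> * f i) * vnorm (g i)) \<le> C * (\<Sum>i. vnorm (f i) * vnorm (g i))"
    using suminf_le[OF le s' s] r by (simp add: suminf_mult product_representation_def)
qed

text \<open>The multiplier is absorbed into the first factor of every product in a near-optimal
  representation.\<close>

lemma mult_weak_product:
  assumes \<theta>: "\<theta> \<in> Mult H" and C: "C \<ge> 0" "\<And>f. f \<in> H \<Longrightarrow> vnorm (\<theta> * f) \<le> C * vnorm f"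
    and h: "h \<in> W"
  shows "\<theta> * h \<in> W" "wnorm (\<theta> * h) \<le> C * wnorm h"
proof -
  obtain f g where "product_representation H ip h f g" using h by (auto simp: weak_product_def)
  from product_representation_mult(1)[OF this \<theta> C(2)] show "\<theta> * h \<in> W"
    by (auto simp: weak_product_def)
  show "wnorm (\<theta> * h) \<le> C * wnorm h"
  proof (rule field_le_epsilon)
    fix e :: real assume e: "e > 0"
    define d where "d = e / (C + 1)"
    have d: "d > 0" "C * d \<le> e" using e C by (auto simp: d_def field_simps)
    obtain f g where r: "product_representation H ip h f g" "(\<Sum>i. vnorm (f i) * vnorm (g i)) < wnorm h + d"
      using weak_product_norm_approx[OF h, of "wnorm h + d"] d by auto
    have "wnorm (\<theta> * h) \<le> C * (\<Sum>i. vnorm (f i) * vnorm (g i))"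
      using weak_product_norm_le[OF product_representation_mult(1)[OF r(1) \<theta> C(2)]]
        product_representation_mult(2)[OF r(1) \<theta> C(2)] by simp
    also have "\<dots> \<le> C * (wnorm h + d)" using r(2) C(1) by (intro mult_left_mono) auto
    also have "\<dots> \<le> C * wnorm h + e" using d(2) by (simp add: distrib_left)
    finally show "wnorm (\<theta> * h) \<le> C * wnorm h + e" .
  qed
qed

lemma evaluation_representation:
  assumes C: "C \<ge> 0" "\<forall>f\<in>H. cmod (f z) \<le> C * vnorm f" and f: "f \<in> H" "g \<in> H"
  shows "cmod (f z * g z) \<le> C\<^sup>2 * (vnorm f * vnorm g)"
proof -
  have "cmod (f z * g z) \<le> (C * vnorm f) * (C * vnorm g)"
    unfolding norm_mult using C f by (intro mult_mono) auto
  then show ?thesis by (simp add: power2_eq_square mult_ac)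
qed

lemma weak_product_banach_function_space: "banach_function_space W wnorm"
proof
  show "0 \<le> wnorm f" if "f \<in> W" for f using that by (rule weak_product_norm_nonneg)
next
  show "0 \<in> W" using product_mem_weak_product(1)[OF zero_in zero_in] by simp
next
  fix f c assume f: "f \<in> W"
  define \<theta> where "\<theta> c = (\<lambda>z :: 'x. c :: complex)" for c
  have \<theta>: "\<theta> c * f = (\<lambda>z. c * f z)" for c f by (auto simp: \<theta>_def fun_eq_iff)
  \<comment> \<open>Scalars are constant multipliers of \<open>H\<close>, so this is a case of
    \<open>mult_weak_product\<close>; scaling back with \<open>inverse c\<close> gives the reverse
    inequality below.\<close>
  have mul: "(\<lambda>z. c * f z) \<in> W \<and> wnorm (\<lambda>z. c * f z) \<le> cmod c * wnorm f" if f: "f \<in> W" for c f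
  proof -
    have m1: "\<theta> c \<in> Mult H" using scale_in by (auto simp: Mult_def \<theta>)
    have m2: "vnorm (\<theta> c * h) \<le> cmod c * vnorm h" if "h \<in> H" for h
      using vnorm_scale[OF that] by (simp add: \<theta>)
    show ?thesis using mult_weak_product[OF m1 norm_ge_zero m2 f, unfolded \<theta>] by simp
  qed
  then show "(\<lambda>z. c * f z) \<in> W" using f by blast
  show "wnorm (\<lambda>z. c * f z) = cmod c * wnorm f"
  proof (cases "c = 0")
    case True
    have 0: "(\<lambda>z. c * f z) = 0 * 0" using True by (auto simp: fun_eq_iff)
    have "wnorm (\<lambda>z. c * f z) \<le> 0"
      unfolding 0 using product_mem_weak_product(2)[OF zero_in zero_in] by simp
    moreover have "0 \<le> wnorm (\<lambda>z. c * f z)"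
      using mul[OF f, of c] weak_product_norm_nonneg by blast
    ultimately show ?thesis using True by simp
  next
    case False
    have "wnorm (\<lambda>z. inverse c * (c * f z)) \<le> cmod (inverse c) * wnorm (\<lambda>z. c * f z)"
      using mul[of "\<lambda>z. c * f z" "inverse c"] mul[OF f, of c] by blast
    then have "cmod c * wnorm f \<le> wnorm (\<lambda>z. c * f z)"
      using False by (simp add: norm_divide field_simps)
    then show ?thesis using mul[OF f, of c] by simp
  qed
next
  fix z
  obtain C where C: "C \<ge> 0" "\<forall>f\<in>H. cmod (f z) \<le> C * vnorm f" using evaluation_le by blast
  have "cmod (h z) \<le> C\<^sup>2 * wnorm h" if h: "h \<in> W" for h
  proof (rule field_le_epsilon)
    fix e :: real assume e: "e > 0"
    define d where "d = e / (C\<^sup>2 + 1)"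
    have C2: "C\<^sup>2 + 1 > 0" by (simp add: add_nonneg_pos)
    have d: "d > 0" "C\<^sup>2 * d \<le> e" using e C2 by (auto simp: d_def field_simps)
    obtain f g where r: "product_representation H ip h f g" "(\<Sum>i. vnorm (f i) * vnorm (g i)) < wnorm h + d"
      using weak_product_norm_approx[OF h, of "wnorm h + d"] d by auto
    have H: "f i \<in> H" "g i \<in> H" for i using r by (auto simp: product_representation_def)
    have s: "summable (\<lambda>i. C\<^sup>2 * (vnorm (f i) * vnorm (g i)))"
      using r by (intro summable_mult) (auto simp: product_representation_def)
    have le: "cmod (f i z * g i z) \<le> C\<^sup>2 * (vnorm (f i) * vnorm (g i))" for i
      using evaluation_representation[OF C H] .
    have s': "summable (\<lambda>i. cmod (f i z * g i z))"
      using le by (intro summable_comparison_test'[OF s, of 0]) auto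
    have "h z = (\<Sum>i. f i z * g i z)" using r by (auto simp: product_representation_def sums_iff)
    then have "cmod (h z) \<le> (\<Sum>i. cmod (f i z * g i z))" using summable_norm[OF s'] by simp
    also have "\<dots> \<le> C\<^sup>2 * (\<Sum>i. vnorm (f i) * vnorm (g i))"
      using suminf_le[OF le s' s] r by (simp add: suminf_mult product_representation_def)
    also have "\<dots> \<le> C\<^sup>2 * (wnorm h + d)" using r(2) by (intro mult_left_mono) auto
    also have "\<dots> \<le> C\<^sup>2 * wnorm h + e" using d(2) by (simp add: distrib_left)
    finally show "cmod (h z) \<le> C\<^sup>2 * wnorm h + e" .
  qed
  then show "\<exists>C. \<forall>f\<in>W. cmod (f z) \<le> C * wnorm f" by blast
next
  fix h :: "nat \<Rightarrow> 'x \<Rightarrow> complex" and f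
  assume h: "\<And>n. h n \<in> W" and s: "summable (\<lambda>n. wnorm (h n))" and f: "\<And>z. (\<lambda>n. h n z) sums f z"
  \<comment> \<open>Near-optimal representations of the \<open>h n\<close> with errors
    \<open>e / 2^(n + 1)\<close>, which add up to \<open>e\<close>, are merged into one
    representation of \<open>f\<close>.\<close>
  have main: "\<exists>F G. product_representation H ip f F G \<and> (\<Sum>i. vnorm (F i) * vnorm (G i)) \<le> (\<Sum>n. wnorm (h n)) + e"
    if e: "e > 0" for e
  proof -
    have "\<exists>F G. product_representation H ip (h n) F G \<and> (\<Sum>i. vnorm (F i) * vnorm (G i)) < wnorm (h n) + e * (1/2)^Suc n" for n
    proof -
      have "wnorm (h n) < wnorm (h n) + e * (1/2)^Suc n" using e by simp
      from weak_product_norm_approx[OF h this] show ?thesis by blast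
    qed
    then obtain a c where r: "\<And>n. product_representation H ip (h n) (a n) (c n)"
      and lt: "\<And>n. (\<Sum>i. vnorm (a n i) * vnorm (c n i)) < wnorm (h n) + e * (1/2)^Suc n" by metis
    have H: "a n i \<in> H" "c n i \<in> H" for n i using r[of n] by (auto simp: product_representation_def)
    let ?p = "\<lambda>n i. vnorm (a n i) * vnorm (c n i)"
    have p0: "0 \<le> ?p n i" for n i using H by simp
    have inner: "summable (?p n)" for n using r[of n] by (auto simp: product_representation_def)
    have geo: "(\<lambda>n. e * (1/2::real)^Suc n) sums e"
      using sums_mult[OF power_half_series, of e] by simp
    have sb: "(\<lambda>n. wnorm (h n) + e * (1/2)^Suc n) sums ((\<Sum>n. wnorm (h n)) + e)"
      using summable_sums[OF s] geo by (rule sums_add)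
    have outer: "summable (\<lambda>n. \<Sum>i. ?p n i)"
      using lt p0 inner by (intro summable_comparison_test'[OF sums_summable[OF sb], of 0])
        (auto simp: suminf_nonneg less_imp_le)
    define F G where "F k = case_prod a (prod_decode k)" and "G k = case_prod c (prod_decode k)" for k
    have "(\<lambda>k. case_prod ?p (prod_decode k)) sums (\<Sum>n. \<Sum>i. ?p n i)"
      using inner outer p0 by (intro double_sums) auto
    moreover have "(\<lambda>k. case_prod ?p (prod_decode k)) = (\<lambda>k. vnorm (F k) * vnorm (G k))"
      by (auto simp: F_def G_def fun_eq_iff split: prod.splits)
    ultimately have norms: "(\<lambda>k. vnorm (F k) * vnorm (G k)) sums (\<Sum>n. \<Sum>i. ?p n i)" by simp
    have "(\<lambda>k. F k z * G k z) sums f z" for z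
    proof -
      obtain C where C: "C \<ge> 0" "\<forall>f\<in>H. cmod (f z) \<le> C * vnorm f" using evaluation_le by blast
      have le: "cmod (a n i z * c n i z) \<le> C\<^sup>2 * ?p n i" for n i
        using evaluation_representation[OF C H] .
      have in': "summable (\<lambda>i. cmod (a n i z * c n i z))" for n
        using le by (intro summable_comparison_test'[OF summable_mult[OF inner, of "C\<^sup>2"], of 0]) auto
      have "(\<Sum>i. cmod (a n i z * c n i z)) \<le> C\<^sup>2 * (\<Sum>i. ?p n i)" for n
        using suminf_le[OF le in' summable_mult[OF inner]] by (simp add: suminf_mult[OF inner])
      then have out': "summable (\<lambda>n. \<Sum>i. cmod (a n i z * c n i z))"
        using in' by (intro summable_comparison_test'[OF summable_mult[OF outer, of "C\<^sup>2"], of 0]) (auto simp: suminf_nonneg)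
      have "(\<lambda>k. case_prod (\<lambda>n i. a n i z * c n i z) (prod_decode k)) sums (\<Sum>n. \<Sum>i. a n i z * c n i z)"
        using in' out' by (rule double_sums)
      moreover have "(\<Sum>i. a n i z * c n i z) = h n z" for n
        using r[of n] by (auto simp: product_representation_def sums_iff)
      moreover have "(\<Sum>n. h n z) = f z" using f by (simp add: sums_iff)
      moreover have "(\<lambda>k. case_prod (\<lambda>n i. a n i z * c n i z) (prod_decode k)) = (\<lambda>k. F k z * G k z)"
        by (auto simp: F_def G_def fun_eq_iff split: prod.splits)
      ultimately show ?thesis by simp
    qed
    moreover have "F k \<in> H \<and> G k \<in> H" for k using H by (auto simp: F_def G_def split: prod.splits)
    ultimately have "product_representation H ip f F G"
      using sums_summable[OF norms] by (auto simp: product_representation_def)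
    moreover have "(\<Sum>k. vnorm (F k) * vnorm (G k)) \<le> (\<Sum>n. wnorm (h n)) + e"
      using suminf_le[OF less_imp_le[OF lt] outer sums_summable[OF sb]] sums_unique[OF norms] sums_unique[OF sb] by simp
    ultimately show ?thesis by blast
  qed
  have "f \<in> W" using main[of 1] by (auto simp: weak_product_def)
  moreover have "wnorm f \<le> (\<Sum>n. wnorm (h n))"
    using main weak_product_norm_le by (meson field_le_epsilon order_trans)
  ultimately show "f \<in> W \<and> wnorm f \<le> (\<Sum>n. wnorm (h n))" by blast
qed

end


section \<open>Multipliers of the weak product\<close>

lemma sums_interleave:
  fixes f g :: "nat \<Rightarrow> complex"
  assumes "f sums x" "g sums y"
  shows "(\<lambda>n. if even n then f (n div 2) else g ((n - 1) div 2)) sums (x + y)"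
proof -
  have "(\<lambda>n. if even n then Re (f (n div 2)) else Re (g ((n - 1) div 2))) sums (Re y + Re x)"
    "(\<lambda>n. if even n then Im (f (n div 2)) else Im (g ((n - 1) div 2))) sums (Im y + Im x)"
    using assms by (auto intro!: sums_if simp: sums_complex_iff)
  then show ?thesis by (simp add: sums_complex_iff if_distrib add.commute cong: if_cong)
qed

section \<open>Representations with square-summable factors\<close>

context rkhs
begin

lemma balance_factors:
  assumes u: "u \<in> H" and v: "v \<in> H" and r: "r > 0"
  shows "\<exists>a\<in>H. \<exists>c\<in>H. (\<forall>z. a z * c z = u z * v z) \<and>
    (vnorm a)\<^sup>2 = r * (vnorm u * vnorm v) \<and> (vnorm c)\<^sup>2 = vnorm u * vnorm v / r"
proof (cases "u = 0 \<or> v = 0")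
  case True
  \<comment> \<open>Rescaling cannot make a nonzero partner of a zero factor vanish, so both factors
    are replaced by zero.\<close>
  then show ?thesis by (intro bexI[of _ 0] zero_in) auto
next
  case False
  then have n: "vnorm u > 0" "vnorm v > 0"
    using u v vnorm_eq_0 vnorm_nonneg by (metis less_eq_real_def)+
  \<comment> \<open>Solved from the requirement that \<open>t^2\<close> times the squared norm of
    \<open>u\<close> be \<open>r * (vnorm u * vnorm v)\<close>; the norm of the other factor then
    comes out as wanted.\<close>
  define t where "t = sqrt (r * vnorm v / vnorm u)"
  have t: "t > 0" "t\<^sup>2 = r * vnorm v / vnorm u" using n r by (auto simp: t_def)
  define a c where "a = (\<lambda>z. of_real t * u z)" and "c = (\<lambda>z. of_real (1 / t) * v z)"
  have "a \<in> H" "c \<in> H" unfolding a_def c_def using scale_in[OF u] scale_in[OF v] by blast+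
  moreover have "a z * c z = u z * v z" for z using t by (simp add: a_def c_def)
  moreover have "(vnorm a)\<^sup>2 = r * (vnorm u * vnorm v)"
    unfolding a_def vnorm_scale[OF u] norm_of_real power_mult_distrib power2_abs t(2)
    using n by (simp add: power2_eq_square)
  moreover have "(vnorm c)\<^sup>2 = vnorm u * vnorm v / r"
    unfolding c_def vnorm_scale[OF v] norm_of_real power_mult_distrib power2_abs power_divide t(2)
    using n r by (simp add: power2_eq_square)
  ultimately show ?thesis by blast
qed

text \<open>Balancing each product with ratio \<open>s / t\<close> splits a total below
  \<open>s * t\<close> into two sums of squares. Square-summability of each factor separately is
  what column factorization and row operators require.\<close>

lemma weak_product_balanced:
  assumes h: "h \<in> W" and M: "wnorm h < s * t" and s: "s > 0" and t: "t > 0"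
  obtains a c where "\<And>i::nat. a i \<in> H" "\<And>i. c i \<in> H" "\<And>z. (\<lambda>i. a i z * c i z) sums h z"
    "summable (\<lambda>i. (vnorm (a i))\<^sup>2)" "(\<Sum>i. (vnorm (a i))\<^sup>2) \<le> s\<^sup>2"
    "summable (\<lambda>i. (vnorm (c i))\<^sup>2)" "(\<Sum>i. (vnorm (c i))\<^sup>2) \<le> t\<^sup>2"
proof -
  obtain f g where fg: "product_representation H ip h f g" "(\<Sum>i. vnorm (f i) * vnorm (g i)) < s * t"
    using weak_product_norm_approx[OF h M] by blast
  have H: "f i \<in> H" "g i \<in> H" for i using fg by (auto simp: product_representation_def)
  let ?p = "\<lambda>i. vnorm (f i) * vnorm (g i)"
  have p: "summable ?p" using fg by (simp add: product_representation_def)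
  have r: "s / t > 0" using s t by simp
  have "\<exists>a c. a \<in> H \<and> c \<in> H \<and> (\<forall>z. a z * c z = f i z * g i z) \<and>
      (vnorm a)\<^sup>2 = s / t * ?p i \<and> (vnorm c)\<^sup>2 = ?p i / (s / t)" for i
    using balance_factors[OF H(1)[of i] H(2)[of i] r] by blast
  then obtain a c where ac: "\<And>i. a i \<in> H" "\<And>i. c i \<in> H" "\<And>i z. a i z * c i z = f i z * g i z"
    "\<And>i. (vnorm (a i))\<^sup>2 = s / t * ?p i" "\<And>i. (vnorm (c i))\<^sup>2 = ?p i / (s / t)"
    by metis
  show thesis
  proof (rule that[of a c])
    show "(\<lambda>i. a i z * c i z) sums h z" for z
      using fg by (simp add: ac(3) product_representation_def)
    show "summable (\<lambda>i. (vnorm (a i))\<^sup>2)" "summable (\<lambda>i. (vnorm (c i))\<^sup>2)"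
      unfolding ac(4,5) using summable_mult[OF p] summable_divide[OF p] by blast+
    have "s / t * (\<Sum>i. ?p i) \<le> s / t * (s * t)" using fg(2) r by (intro mult_left_mono) auto
    then show "(\<Sum>i. (vnorm (a i))\<^sup>2) \<le> s\<^sup>2"
      unfolding ac(4) suminf_mult[OF p] using s t by (simp add: power2_eq_square)
    have "(\<Sum>i. ?p i) / (s / t) \<le> (s * t) / (s / t)" using fg(2) r by (intro divide_right_mono) auto
    then show "(\<Sum>i. (vnorm (c i))\<^sup>2) \<le> t\<^sup>2"
      unfolding ac(5) suminf_divide[OF p] using s t by (simp add: power2_eq_square)
  qed (use ac in auto)
qed

lemma column_norm_leD:
  assumes "column_norm_le H ip \<phi> 1" "f \<in> H"
  shows "\<phi> n * f \<in> H" "summable (\<lambda>n. (vnorm (\<phi> n * f))\<^sup>2)" "(\<Sum>n. (vnorm (\<phi> n * f))\<^sup>2) \<le> (vnorm f)\<^sup>2"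
proof -
  have c: "(\<lambda>n. \<phi> n * f) \<in> tensor_l2 H ip" "tensor_l2_norm ip (\<lambda>n. \<phi> n * f) \<le> vnorm f"
    using assms by (auto simp: column_norm_le_def)
  then show "\<phi> n * f \<in> H" "summable (\<lambda>n. (vnorm (\<phi> n * f))\<^sup>2)" by (auto simp: tensor_l2_def)
  show "(\<Sum>n. (vnorm (\<phi> n * f))\<^sup>2) \<le> (vnorm f)\<^sup>2"
    using c(2) by (simp add: tensor_l2_norm_def sqrt_le_D)
qed

end

section \<open>The constant function, a pointwise description of balls, and the sign of the
  column-row constant\<close>

context normalized_cnp_space
begin

text \<open>The kernel function at a zero of \<open>b\<close> is constant. As a test function,
  \<open>1\<close> keeps outer factors free of zeros and puts \<open>\<psi>\<close> itself into
  \<open>H\<close>.\<close>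

lemma one_in: "1 \<in> H"
proof -
  obtain z0 where z0: "b z0 = 0" using b_zero by blast
  have "(\<lambda>z. 1 / (1 - ipE (b z) (b z0))) \<in> H" using kernel by (simp add: reproducing_kernel_def)
  moreover have "(\<lambda>z. 1 / (1 - ipE (b z) (b z0))) = 1"
    using aux.ip_zero_right[OF b_in] by (simp add: z0 fun_eq_iff)
  ultimately show ?thesis by simp
qed

text \<open>This is \<open>interpolation\<close> for the kernel functions. Every condition on the
  right involves finitely many values of \<open>h\<close>, which makes balls of \<open>H\<close>
  closed under pointwise limits.\<close>

lemma ball_iff:
  assumes M: "M \<ge> 0"
  shows "h \<in> H \<and> vnorm h \<le> M \<longleftrightarrow>
    (\<forall>Y c. finite Y \<longrightarrow> cmod (\<Sum>w\<in>Y. c w * cnj (h w)) \<le> M * vnorm (\<Sum>w\<in>Y. (\<lambda>z. c w * (1 / (1 - ipE (b z) (b w))))))"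
    (is "_ \<longleftrightarrow> ?R")
proof
  define k where "k w = (\<lambda>z. 1 / (1 - ipE (b z) (b w)))" for w
  have k: "k w \<in> H" "f \<in> H \<Longrightarrow> ip f (k w) = f w" for f w
    using kernel by (auto simp: reproducing_kernel_def k_def)
  have R: "?R \<longleftrightarrow> (\<forall>Y c. finite Y \<longrightarrow> cmod (\<Sum>w\<in>Y. c w * cnj (h w)) \<le> M * vnorm (\<Sum>w\<in>Y. (\<lambda>z. c w * k w z)))"
    by (simp only: k_def)
  {
    assume h: "h \<in> H \<and> vnorm h \<le> M"
    have "cmod (\<Sum>w\<in>Y. c w * cnj (h w)) \<le> M * vnorm (\<Sum>w\<in>Y. (\<lambda>z. c w * k w z))" for Y c
    proof -
      have S: "(\<Sum>w\<in>Y. (\<lambda>z. c w * k w z)) \<in> H" using k by (intro sum_in scale_in)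
      have "(\<Sum>w\<in>Y. c w * cnj (h w)) = ip (\<Sum>w\<in>Y. (\<lambda>z. c w * k w z)) h"
        using h k scale_in[OF k(1)] by (simp add: ip_sum_left ip_scale_left ip_commute[of h])
      also have "cmod \<dots> \<le> vnorm h * vnorm (\<Sum>w\<in>Y. (\<lambda>z. c w * k w z))"
        using Cauchy_Schwarz[OF S, of h] h by (simp add: mult.commute)
      also have "\<dots> \<le> M * vnorm (\<Sum>w\<in>Y. (\<lambda>z. c w * k w z))"
        using h vnorm_nonneg[OF S] by (intro mult_right_mono) auto
      finally show ?thesis .
    qed
    then show ?R unfolding R by blast
  next
    assume ?R
    then have "finite Y \<Longrightarrow> cmod (\<Sum>w\<in>Y. c w * cnj (h w)) \<le> M * vnorm (\<Sum>w\<in>Y. (\<lambda>z. c w * k w z))" for Y c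
      unfolding R by blast
    from interpolation[of k M h, OF k(1) M this]
    obtain x where x: "x \<in> H" "vnorm x \<le> M" "\<And>z. ip x (k z) = h z" by blast
    then have "x = h" using k(2) by (auto simp: fun_eq_iff)
    with x show "h \<in> H \<and> vnorm h \<le> M" by simp
  }
qed

text \<open>The column \<open>(1, 0, 0, ...)\<close> is contractive; the bound for its row operator
  on a nonzero vector forces the sign.\<close>

lemma column_row_constant_nonneg:
  assumes cr: "column_row_property H ip \<kappa>"
  shows "0 \<le> \<kappa>"
proof -
  define \<phi> where "\<phi> n = (if n = 0 then 1 else 0 :: 'x \<Rightarrow> complex)" for n :: nat
  have s: "(\<lambda>n. (vnorm (\<phi> n * f))\<^sup>2) sums (vnorm f)\<^sup>2" for f
    using sums_finite[of "{0}" "\<lambda>n. (vnorm (\<phi> n * f))\<^sup>2"] by (simp add: \<phi>_def)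
  have t: "(\<lambda>n. \<phi> n * f) \<in> tensor_l2 H ip" "tensor_l2_norm ip (\<lambda>n. \<phi> n * f) = vnorm f" if "f \<in> H" for f
  proof -
    have "\<phi> n * f \<in> H" for n using that by (simp add: \<phi>_def)
    then show "(\<lambda>n. \<phi> n * f) \<in> tensor_l2 H ip" using sums_summable[OF s[of f]] by (simp add: tensor_l2_def)
    show "tensor_l2_norm ip (\<lambda>n. \<phi> n * f) = vnorm f"
      using sums_unique[OF s[of f], symmetric] that by (simp add: tensor_l2_norm_def)
  qed
  have "column_norm_le H ip \<phi> 1" using t by (simp add: column_norm_le_def)
  moreover have "\<phi> n \<in> Mult H" for n by (simp add: \<phi>_def Mult_def)
  ultimately have "row_norm_le H ip \<phi> \<kappa>" using cr by (simp add: column_row_property_def)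
  from bspec[OF this[unfolded row_norm_le_def] t(1)[OF one_in]]
  obtain h where h: "h \<in> H" "vnorm h \<le> \<kappa> * vnorm 1"
    unfolding t(2)[OF one_in] by blast
  have "vnorm (1 :: 'x \<Rightarrow> complex) \<noteq> 0" using vnorm_eq_0[OF one_in] by simp
  then have "vnorm 1 > 0" using vnorm_nonneg[OF one_in] by linarith
  then show ?thesis using order_trans[OF vnorm_nonneg[OF h(1)] h(2)] by (simp add: zero_le_mult_iff)
qed

end


section \<open>Factorizations controlled on finite test families\<close>

context normalized_cnp_space
begin

text \<open>The weights enter as factors \<open>sqrt (c f)\<close> of the family, so that its common
  outer factor \<open>f0\<close> controls the weighted total of squares. Dividing a representation
  of \<open>\<theta> * (f0 * g)\<close> by \<open>f0\<close> gives \<open>\<phi>\<close>.\<close>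

lemma weighted_factorization:
  assumes \<theta>: "\<And>h. h \<in> W \<Longrightarrow> \<theta> * h \<in> W \<and> wnorm (\<theta> * h) \<le> N * wnorm h" and N: "0 \<le> N" "N < N'"
    and g: "g \<in> H" "g \<noteq> 0" and J: "finite J" "J \<subseteq> H" "1 \<in> J" and c: "\<And>f. f \<in> J \<Longrightarrow> 0 < c f"
  obtains \<phi> \<gamma> where "\<And>i::nat. \<gamma> i \<in> H" "summable (\<lambda>i. (vnorm (\<gamma> i))\<^sup>2)" "(\<Sum>i. (vnorm (\<gamma> i))\<^sup>2) \<le> (vnorm g)\<^sup>2"
    "\<And>z. (\<lambda>i. \<phi> i z * \<gamma> i z) sums (\<theta> z * g z)"
    "\<And>i f. f \<in> J \<Longrightarrow> \<phi> i * f \<in> H" "\<And>f. f \<in> J \<Longrightarrow> summable (\<lambda>i. (vnorm (\<phi> i * f))\<^sup>2)"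
    "(\<Sum>f\<in>J. c f * (\<Sum>i. (vnorm (\<phi> i * f))\<^sup>2)) \<le> (\<Sum>f\<in>J. c f * (N'\<^sup>2 * (vnorm f)\<^sup>2))"
proof -
  obtain e where e: "bij_betw e {0..<card J} J" using ex_bij_betw_nat_finite[OF J(1)] by blast
  have eJ: "e n \<in> J" if "n < card J" for n using e that by (auto simp: bij_betw_def)
  have eH: "e n \<in> H" if "n < card J" for n using eJ[OF that] J by blast
  have eS: "\<exists>n<card J. f = e n" if "f \<in> J" for f
    using bij_betw_imp_surj_on[OF e] that by (force simp: image_iff)
  define F where "F n = (if n < card J then (\<lambda>z. of_real (sqrt (c (e n))) * e n z) else 0)" for n
  have FH: "F n \<in> H" for n using eH by (auto simp: F_def intro: scale_in)
  have nF: "(vnorm (F n))\<^sup>2 = (if n < card J then c (e n) * (vnorm (e n))\<^sup>2 else 0)" for n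
  proof (cases "n < card J")
    case True
    then have "0 < c (e n)" using eJ c by blast
    with True show ?thesis
      using vnorm_scale[OF eH[OF True], of "of_real (sqrt (c (e n)))"]
      by (simp add: F_def power_mult_distrib)
  qed (simp add: F_def)
  define T where "T = (\<Sum>f\<in>J. c f * (vnorm f)\<^sup>2)"
  have "(\<lambda>n. (vnorm (F n))\<^sup>2) sums (\<Sum>n\<in>{0..<card J}. (vnorm (F n))\<^sup>2)"
    by (rule sums_finite) (auto simp: nF)
  also have "(\<Sum>n\<in>{0..<card J}. (vnorm (F n))\<^sup>2) = T"
    unfolding T_def sum.reindex_bij_betw[OF e, symmetric] by (rule sum.cong) (auto simp: nF)
  finally have sF: "(\<lambda>n. (vnorm (F n))\<^sup>2) sums T" .
  have "F \<in> tensor_l2 H ip" using FH sums_summable[OF sF] by (simp add: tensor_l2_def)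
  then obtain \<alpha> f0 where f0: "f0 \<in> H" "vnorm f0 \<le> tensor_l2_norm ip F" and \<alpha>: "\<And>n. \<alpha> n \<in> Mult H"
    "column_norm_le H ip \<alpha> 1" "\<And>n. F n = \<alpha> n * f0"
    using column_factorization by metis
  have T0: "T \<ge> 0" unfolding T_def using less_imp_le[OF c] by (intro sum_nonneg mult_nonneg_nonneg) auto
  have f0T: "(vnorm f0)\<^sup>2 \<le> T"
  proof -
    have "vnorm f0 \<le> sqrt T" using f0(2) sums_unique[OF sF] by (simp add: tensor_l2_norm_def)
    then have "(vnorm f0)\<^sup>2 \<le> (sqrt T)\<^sup>2" using f0(1) by (intro power_mono) auto
    then show ?thesis using T0 by simp
  qed
  \<comment> \<open>Since \<open>1\<close> belongs to \<open>J\<close>, some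
    \<open>\<alpha> n * f0\<close> is a nonzero constant.\<close>
  have f0z: "f0 z \<noteq> 0" for z
  proof -
    obtain n where n: "n < card J" "1 = e n" using eS[OF J(3)] by blast
    then have "\<alpha> n z * f0 z = of_real (sqrt (c 1))"
      using fun_cong[OF \<alpha>(3)[of n], of z] by (simp add: F_def n(2)[symmetric])
    then show ?thesis using c[OF J(3)] by auto
  qed
  then have "f0 \<noteq> 0" by (auto simp: fun_eq_iff)
  then have nf0: "vnorm f0 > 0" using vnorm_eq_0[OF f0(1)] vnorm_nonneg[OF f0(1)] by linarith
  have ng: "vnorm g > 0" using vnorm_eq_0[OF g(1)] vnorm_nonneg[OF g(1)] g(2) by linarith
  have fg: "f0 * g \<in> W" "wnorm (f0 * g) \<le> vnorm f0 * vnorm g"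
    using product_mem_weak_product f0(1) g(1) by auto
  have "wnorm (\<theta> * (f0 * g)) \<le> N * wnorm (f0 * g)" using \<theta>[OF fg(1)] by simp
  also have "\<dots> \<le> N * (vnorm f0 * vnorm g)" using fg(2) N(1) by (rule mult_left_mono)
  \<comment> \<open>The infimum defining \<open>wnorm\<close> need not be attained; replacing
    \<open>N\<close> by \<open>N'\<close> provides the strict inequality.\<close>
  also have "\<dots> < N' * (vnorm f0 * vnorm g)" using N nf0 ng by (intro mult_strict_right_mono) auto
  finally have lt: "wnorm (\<theta> * (f0 * g)) < (N' * vnorm f0) * vnorm g" by (simp add: mult.assoc)
  have "N' * vnorm f0 > 0" using N nf0 by simp
  then obtain a \<gamma> where a: "\<And>i::nat. a i \<in> H" "summable (\<lambda>i. (vnorm (a i))\<^sup>2)" "(\<Sum>i. (vnorm (a i))\<^sup>2) \<le> (N' * vnorm f0)\<^sup>2"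
    and \<gamma>: "\<And>i. \<gamma> i \<in> H" "summable (\<lambda>i. (vnorm (\<gamma> i))\<^sup>2)" "(\<Sum>i. (vnorm (\<gamma> i))\<^sup>2) \<le> (vnorm g)\<^sup>2"
    and sums: "\<And>z. (\<lambda>i. a i z * \<gamma> i z) sums (\<theta> * (f0 * g)) z"
    by (rule weak_product_balanced[OF conjunct1[OF \<theta>[OF fg(1)]] lt _ ng]) blast+
  define \<phi> where "\<phi> i = (\<lambda>z. a i z / f0 z)" for i
  have col: "\<alpha> n * a i \<in> H" "summable (\<lambda>n. (vnorm (\<alpha> n * a i))\<^sup>2)" "(\<Sum>n. (vnorm (\<alpha> n * a i))\<^sup>2) \<le> (vnorm (a i))\<^sup>2" for n i
    using column_norm_leD[OF \<alpha>(2) a(1)] by auto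
  have le: "(\<Sum>n\<in>I. (vnorm (\<alpha> n * a i))\<^sup>2) \<le> (vnorm (a i))\<^sup>2" if "finite I" for I i
    using sum_le_suminf[OF col(2) that] col(3)[of i] by (meson order_trans zero_le_power2)
  have sm: "summable (\<lambda>i. (vnorm (\<alpha> n * a i))\<^sup>2)" for n
    by (rule summable_comparison_test'[OF a(2), of 0]) (use le[of "{n}"] in auto)
  \<comment> \<open>The factor \<open>f0\<close> cancels: up to the weight,
    \<open>\<phi> i * e n\<close> is \<open>\<alpha> n * a i\<close>, which lies in \<open>H\<close>
    because \<open>\<alpha> n\<close> is a multiplier.\<close>
  have \<phi>e: "\<phi> i * e n \<in> H" "(vnorm (\<phi> i * e n))\<^sup>2 = (vnorm (\<alpha> n * a i))\<^sup>2 / c (e n)" if n: "n < card J" for i n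
  proof -
    define r where "r = sqrt (c (e n))"
    have r: "r > 0" "r\<^sup>2 = c (e n)" using c[OF eJ[OF n]] by (auto simp: r_def)
    have "\<phi> i * e n = (\<lambda>z. of_real (1 / r) * (\<alpha> n * a i) z)"
    proof
      fix z
      have "of_real r * e n z = \<alpha> n z * f0 z" using \<alpha>(3)[of n] n by (simp add: F_def r_def fun_eq_iff)
      then have "e n z = \<alpha> n z * f0 z / of_real r" using r by (simp add: field_simps)
      then show "(\<phi> i * e n) z = of_real (1 / r) * (\<alpha> n * a i) z" using f0z[of z] by (simp add: \<phi>_def)
    qed
    then show "\<phi> i * e n \<in> H" "(vnorm (\<phi> i * e n))\<^sup>2 = (vnorm (\<alpha> n * a i))\<^sup>2 / c (e n)"
      using scale_in[OF col(1)[of n i], of "of_real (1 / r)"] vnorm_scale[OF col(1)[of n i], of "of_real (1 / r)"] r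
      by (simp_all add: norm_divide power_divide power_mult_distrib)
  qed
  show thesis
  proof (rule that[of \<gamma> \<phi>])
    show "(\<lambda>i. \<phi> i z * \<gamma> i z) sums (\<theta> z * g z)" for z
    proof -
      have "(\<lambda>i. a i z * \<gamma> i z / f0 z) sums ((\<theta> * (f0 * g)) z / f0 z)" using sums by (rule sums_divide)
      then show ?thesis using f0z[of z] by (simp add: \<phi>_def)
    qed
    show "\<phi> i * f \<in> H" if "f \<in> J" for i f using eS[OF that] \<phi>e(1) by auto
    show "summable (\<lambda>i. (vnorm (\<phi> i * f))\<^sup>2)" if f: "f \<in> J" for f
    proof -
      obtain n where n: "n < card J" "f = e n" using eS[OF f] by blast
      show ?thesis unfolding n(2) \<phi>e(2)[OF n(1)] using sm by (rule summable_divide)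
    qed
    have "(\<Sum>f\<in>J. c f * (\<Sum>i. (vnorm (\<phi> i * f))\<^sup>2)) = (\<Sum>n\<in>{0..<card J}. c (e n) * (\<Sum>i. (vnorm (\<phi> i * e n))\<^sup>2))"
      by (rule sum.reindex_bij_betw[OF e, symmetric])
    also have "\<dots> = (\<Sum>n\<in>{0..<card J}. \<Sum>i. (vnorm (\<alpha> n * a i))\<^sup>2)"
    proof (rule sum.cong)
      fix n assume "n \<in> {0..<card J}"
      then have n: "n < card J" by simp
      have "(\<Sum>i. (vnorm (\<phi> i * e n))\<^sup>2) = (\<Sum>i. (vnorm (\<alpha> n * a i))\<^sup>2) / c (e n)"
        unfolding \<phi>e(2)[OF n] using sm by (rule suminf_divide)
      then show "c (e n) * (\<Sum>i. (vnorm (\<phi> i * e n))\<^sup>2) = (\<Sum>i. (vnorm (\<alpha> n * a i))\<^sup>2)"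
        using c[OF eJ[OF n]] by simp
    qed simp
    \<comment> \<open>After the interchange, the contractive column \<open>\<alpha>\<close> acts for
      each \<open>i\<close> on the single function \<open>a i\<close>.\<close>
    also have "\<dots> = (\<Sum>i. \<Sum>n\<in>{0..<card J}. (vnorm (\<alpha> n * a i))\<^sup>2)"
      using sm by (rule suminf_sum[symmetric])
    also have "\<dots> \<le> (\<Sum>i. (vnorm (a i))\<^sup>2)"
      using sm by (intro suminf_le le a(2) summable_sum) auto
    also have "\<dots> \<le> (N' * vnorm f0)\<^sup>2" by (rule a(3))
    also have "\<dots> \<le> N'\<^sup>2 * T" using f0T by (simp add: power_mult_distrib mult_left_mono)
    also have "\<dots> = (\<Sum>f\<in>J. c f * (N'\<^sup>2 * (vnorm f)\<^sup>2))"
      by (simp add: T_def sum_distrib_left mult_ac)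
    finally show "(\<Sum>f\<in>J. c f * (\<Sum>i. (vnorm (\<phi> i * f))\<^sup>2)) \<le> (\<Sum>f\<in>J. c f * (N'\<^sup>2 * (vnorm f)\<^sup>2))" .
  qed (use \<gamma> in auto)
qed

text \<open>The convex set for \<open>finite_minimax\<close>: its elements are the vectors of costs
  that a factorization of \<open>h\<close> incurs on the test functions. \<open>M\<close> limits a
  squared norm and is used with \<open>(vnorm g)^2\<close>; entries of \<open>s\<close> off
  \<open>J\<close> are unconstrained.\<close>

definition factorization_costs ::
  "('x \<Rightarrow> complex) set \<Rightarrow> ('x \<Rightarrow> complex) \<Rightarrow> real \<Rightarrow> (('x \<Rightarrow> complex) \<Rightarrow> real) set" where
  "factorization_costs J h M = {s. \<exists>\<phi> \<gamma> \<sigma>. (\<forall>i::nat. \<gamma> i \<in> H) \<and> (\<lambda>i. (vnorm (\<gamma> i))\<^sup>2) sums \<sigma> \<and> \<sigma> \<le> M \<and>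
    (\<forall>z. (\<lambda>i. \<phi> i z * \<gamma> i z) sums h z) \<and>
    (\<forall>f\<in>J. (\<forall>i. \<phi> i * f \<in> H) \<and> (\<lambda>i. (vnorm (\<phi> i * f))\<^sup>2) sums s f)}"

text \<open>Two factorizations are interleaved after scaling both factors of the one by
  \<open>sqrt (1 - u)\<close> and of the other by \<open>sqrt u\<close>. Products and squared norms
  alike are then weighted by \<open>1 - u\<close> and \<open>u\<close>.\<close>

lemma convex_factorization_costs:
  assumes s: "s \<in> factorization_costs J h M" and t: "t \<in> factorization_costs J h M" and u: "0 < u" "u < 1"
  shows "(\<lambda>f. (1 - u) * s f + u * t f) \<in> factorization_costs J h M"
proof -
  obtain \<phi> \<gamma> \<sigma> where 1: "\<And>i::nat. \<gamma> i \<in> H" "(\<lambda>i. (vnorm (\<gamma> i))\<^sup>2) sums \<sigma>" "\<sigma> \<le> M"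
    "\<And>z. (\<lambda>i. \<phi> i z * \<gamma> i z) sums h z" "\<And>i f. f \<in> J \<Longrightarrow> \<phi> i * f \<in> H"
    "\<And>f. f \<in> J \<Longrightarrow> (\<lambda>i. (vnorm (\<phi> i * f))\<^sup>2) sums s f"
    using s unfolding factorization_costs_def by blast
  obtain \<phi>' \<gamma>' \<sigma>' where 2: "\<And>i::nat. \<gamma>' i \<in> H" "(\<lambda>i. (vnorm (\<gamma>' i))\<^sup>2) sums \<sigma>'" "\<sigma>' \<le> M"
    "\<And>z. (\<lambda>i. \<phi>' i z * \<gamma>' i z) sums h z" "\<And>i f. f \<in> J \<Longrightarrow> \<phi>' i * f \<in> H"
    "\<And>f. f \<in> J \<Longrightarrow> (\<lambda>i. (vnorm (\<phi>' i * f))\<^sup>2) sums t f"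
    using t unfolding factorization_costs_def by blast
  define p q where "p = sqrt (1 - u)" and "q = sqrt u"
  have pq: "p\<^sup>2 = 1 - u" "q\<^sup>2 = u" using u by (auto simp: p_def q_def)
  define mix where "mix x y n = (if even n then (\<lambda>z. of_real p * x (n div 2) z) else (\<lambda>z. of_real q * y ((n - 1) div 2) z))"
    for x y :: "nat \<Rightarrow> 'x \<Rightarrow> complex" and n
  have mixH: "mix x y n \<in> H" if "\<And>i. x i \<in> H" "\<And>i. y i \<in> H" for x y n
    using that by (auto simp: mix_def intro: scale_in)
  have mix_norm: "(\<lambda>n. (vnorm (mix x y n))\<^sup>2) sums ((1 - u) * S + u * S')"
    if x: "\<And>i. x i \<in> H" "(\<lambda>i. (vnorm (x i))\<^sup>2) sums S" and y: "\<And>i. y i \<in> H" "(\<lambda>i. (vnorm (y i))\<^sup>2) sums S'" for x y S S'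
  proof -
    have "(\<lambda>n. if even n then (1 - u) * (vnorm (x (n div 2)))\<^sup>2 else u * (vnorm (y ((n - 1) div 2)))\<^sup>2) sums (u * S' + (1 - u) * S)"
      by (rule sums_if) (intro sums_mult x y)+
    moreover have "(vnorm (mix x y n))\<^sup>2 = (if even n then (1 - u) * (vnorm (x (n div 2)))\<^sup>2 else u * (vnorm (y ((n - 1) div 2)))\<^sup>2)" for n
      using x(1) y(1) by (simp add: mix_def vnorm_scale power_mult_distrib pq)
    ultimately show ?thesis by (simp add: add.commute)
  qed
  have prod: "(\<lambda>n. mix \<phi> \<phi>' n z * mix \<gamma> \<gamma>' n z) sums h z" for z
  proof -
    have "(\<lambda>n. if even n then of_real (1 - u) * (\<phi> (n div 2) z * \<gamma> (n div 2) z)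
        else of_real u * (\<phi>' ((n - 1) div 2) z * \<gamma>' ((n - 1) div 2) z)) sums (of_real (1 - u) * h z + of_real u * h z)"
      by (rule sums_interleave) (intro sums_mult 1 2)+
    moreover have "of_real (1 - u) * h z + of_real u * h z = h z" by (simp add: algebra_simps)
    moreover have "mix \<phi> \<phi>' n z * mix \<gamma> \<gamma>' n z = (if even n then of_real (1 - u) * (\<phi> (n div 2) z * \<gamma> (n div 2) z)
        else of_real u * (\<phi>' ((n - 1) div 2) z * \<gamma>' ((n - 1) div 2) z))" for n
    proof -
      have "complex_of_real (1 - u) = of_real p * of_real p" "complex_of_real u = of_real q * of_real q"
        unfolding of_real_mult[symmetric] using pq by (simp_all only: power2_eq_square)
      then show ?thesis by (simp add: mix_def mult_ac)
    qed
    ultimately show ?thesis by simp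
  qed
  have mixf: "mix \<phi> \<phi>' n * f = mix (\<lambda>i. \<phi> i * f) (\<lambda>i. \<phi>' i * f) n" for n f
    by (auto simp: mix_def fun_eq_iff)
  have "(1 - u) * \<sigma> + u * \<sigma>' \<le> (1 - u) * M + u * M"
    using 1(3) 2(3) u by (intro add_mono mult_left_mono) auto
  then have "(1 - u) * \<sigma> + u * \<sigma>' \<le> M" by (simp add: algebra_simps)
  moreover have "(\<lambda>n. (vnorm (mix \<gamma> \<gamma>' n))\<^sup>2) sums ((1 - u) * \<sigma> + u * \<sigma>')"
    using mix_norm[OF 1(1,2) 2(1,2)] .
  moreover have "mix \<phi> \<phi>' n * f \<in> H" if "f \<in> J" for n f
    unfolding mixf using 1(5)[OF that] 2(5)[OF that] by (rule mixH)
  moreover have "(\<lambda>n. (vnorm (mix \<phi> \<phi>' n * f))\<^sup>2) sums ((1 - u) * s f + u * t f)" if "f \<in> J" for f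
    unfolding mixf using mix_norm[OF 1(5)[OF that] 1(6)[OF that] 2(5)[OF that] 2(6)[OF that]] .
  ultimately show ?thesis
    unfolding factorization_costs_def mem_Collect_eq
    by (intro exI[of _ "mix \<phi> \<phi>'"] exI[of _ "mix \<gamma> \<gamma>'"] exI[of _ "(1 - u) * \<sigma> + u * \<sigma>'"])
       (use mixH[OF 1(1) 2(1)] prod in auto)
qed

lemma finite_family_factorization:
  assumes cr: "column_row_property H ip \<kappa>"
    and \<theta>: "\<And>h. h \<in> W \<Longrightarrow> \<theta> * h \<in> W \<and> wnorm (\<theta> * h) \<le> N * wnorm h" and N: "0 \<le> N" "N < M"
    and g: "g \<in> H" "g \<noteq> 0" and J: "finite J" "J \<subseteq> H"
  obtains \<psi> G where "G \<in> H" "vnorm G \<le> vnorm g" "\<theta> * g = \<psi> * G"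
    "\<And>f. f \<in> insert 1 J \<Longrightarrow> \<psi> * f \<in> H \<and> vnorm (\<psi> * f) \<le> \<kappa> * M * vnorm f"
proof -
  \<comment> \<open>The slack is used twice: \<open>N < N'\<close> for near-optimal representations
    and \<open>N' < M\<close> for the gap in the minimax principle.\<close>
  define N' where "N' = (N + M) / 2"
  have N': "N < N'" "N' < M" "0 \<le> N'" using N by (auto simp: N'_def)
  \<comment> \<open>At \<open>0\<close> the gap between \<open>N'^2\<close> and \<open>M^2\<close>
    times the squared norm would close, so \<open>0\<close> is removed; \<open>1\<close> is needed
    for zero-free outer factors and to define \<open>\<psi>\<close>.\<close>
  define I where "I = insert 1 (J - {0})"
  have I: "finite I" "I \<subseteq> H" "1 \<in> I" using J one_in by (auto simp: I_def)
  have I0: "vnorm f > 0" if "f \<in> I" for f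
  proof -
    have "f \<noteq> 0" "f \<in> H" using that I by (auto simp: I_def)
    then show ?thesis using vnorm_eq_0 vnorm_nonneg by (metis less_eq_real_def)
  qed
  let ?S = "factorization_costs I (\<theta> * g) ((vnorm g)\<^sup>2)"
  have "\<exists>s\<in>?S. \<forall>f\<in>I. s f \<le> M\<^sup>2 * (vnorm f)\<^sup>2"
  proof (rule finite_minimax[where r = "\<lambda>f. N'\<^sup>2 * (vnorm f)\<^sup>2"])
    show "N'\<^sup>2 * (vnorm f)\<^sup>2 < M\<^sup>2 * (vnorm f)\<^sup>2" if "f \<in> I" for f
      using I0[OF that] N' by (intro mult_strict_right_mono power_strict_mono) auto
    show "0 \<le> s f" if sf: "s \<in> ?S" "f \<in> I" for s f
    proof -
      obtain \<phi> :: "nat \<Rightarrow> 'x \<Rightarrow> complex" where "(\<lambda>i. (vnorm (\<phi> i * f))\<^sup>2) sums s f"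
        using sf unfolding factorization_costs_def by blast
      then show ?thesis using suminf_nonneg[of "\<lambda>i. (vnorm (\<phi> i * f))\<^sup>2"] by (simp add: sums_iff)
    qed
    fix c :: "('x \<Rightarrow> complex) \<Rightarrow> real" assume c: "\<And>f. f \<in> I \<Longrightarrow> 0 < c f"
    obtain \<phi> \<gamma> where \<phi>: "\<And>i::nat. \<gamma> i \<in> H" "summable (\<lambda>i. (vnorm (\<gamma> i))\<^sup>2)" "(\<Sum>i. (vnorm (\<gamma> i))\<^sup>2) \<le> (vnorm g)\<^sup>2"
      "\<And>z. (\<lambda>i. \<phi> i z * \<gamma> i z) sums (\<theta> z * g z)"
      "\<And>i f. f \<in> I \<Longrightarrow> \<phi> i * f \<in> H" "\<And>f. f \<in> I \<Longrightarrow> summable (\<lambda>i. (vnorm (\<phi> i * f))\<^sup>2)"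
      "(\<Sum>f\<in>I. c f * (\<Sum>i. (vnorm (\<phi> i * f))\<^sup>2)) \<le> (\<Sum>f\<in>I. c f * (N'\<^sup>2 * (vnorm f)\<^sup>2))"
    proof (rule weighted_factorization[where c = c, OF _ N(1) N'(1) g I])
      show "\<theta> * h \<in> W \<and> wnorm (\<theta> * h) \<le> N * wnorm h" if "h \<in> W" for h
        using that by (rule \<theta>)
      show "0 < c f" if "f \<in> I" for f using that by (rule c)
    qed blast
    have "(\<lambda>f. \<Sum>i. (vnorm (\<phi> i * f))\<^sup>2) \<in> ?S"
      unfolding factorization_costs_def mem_Collect_eq
      by (intro exI[of _ \<phi>] exI[of _ \<gamma>] exI[of _ "\<Sum>i. (vnorm (\<gamma> i))\<^sup>2"]) (use \<phi>(1-6) in \<open>auto intro: summable_sums\<close>)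
    with \<phi>(7) show "\<exists>s\<in>?S. (\<Sum>f\<in>I. c f * s f) \<le> (\<Sum>f\<in>I. c f * (N'\<^sup>2 * (vnorm f)\<^sup>2))"
      by (rule bexI)
  qed (use I convex_factorization_costs in auto)
  then obtain s where s: "s \<in> ?S" "\<And>f. f \<in> I \<Longrightarrow> s f \<le> M\<^sup>2 * (vnorm f)\<^sup>2" by blast
  then obtain \<phi> \<gamma> \<sigma> where 1: "\<And>i::nat. \<gamma> i \<in> H" "(\<lambda>i. (vnorm (\<gamma> i))\<^sup>2) sums \<sigma>" "\<sigma> \<le> (vnorm g)\<^sup>2"
    "\<And>z. (\<lambda>i. \<phi> i z * \<gamma> i z) sums (\<theta> * g) z" "\<And>i f. f \<in> I \<Longrightarrow> \<phi> i * f \<in> H"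
    "\<And>f. f \<in> I \<Longrightarrow> (\<lambda>i. (vnorm (\<phi> i * f))\<^sup>2) sums s f"
    unfolding factorization_costs_def by blast
  have "\<gamma> \<in> tensor_l2 H ip" using 1(1) sums_summable[OF 1(2)] by (simp add: tensor_l2_def)
  then obtain \<beta> G where G: "G \<in> H" "vnorm G \<le> tensor_l2_norm ip \<gamma>" and \<beta>: "\<And>n. \<beta> n \<in> Mult H"
    "column_norm_le H ip \<beta> 1" "\<And>n. \<gamma> n = \<beta> n * G"
    using column_factorization by metis
  have nG: "vnorm G \<le> vnorm g"
    using G(2) real_le_lsqrt[OF vnorm_nonneg[OF g(1)] 1(3)] sums_unique[OF 1(2)] by (simp add: tensor_l2_norm_def)
  have row: "row_norm_le H ip \<beta> \<kappa>" using cr \<beta> by (auto simp: column_row_property_def)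
  have \<kappa>: "0 \<le> \<kappa>" using cr by (rule column_row_constant_nonneg)
  \<comment> \<open>The column \<open>\<beta>\<close> acts as a row of norm at most
    \<open>\<kappa>\<close> on the sequence \<open>\<phi> n * f\<close>, whose norm is at most
    \<open>M * vnorm f\<close>.\<close>
  have "\<exists>h\<in>H. (\<forall>z. (\<lambda>n. \<beta> n z * \<phi> n z * f z) sums h z) \<and> vnorm h \<le> \<kappa> * M * vnorm f" if f: "f \<in> I" for f
  proof -
    have t: "(\<lambda>n. \<phi> n * f) \<in> tensor_l2 H ip"
      using 1(5)[OF f] sums_summable[OF 1(6)[OF f]] by (simp add: tensor_l2_def)
    from bspec[OF row[unfolded row_norm_le_def] t]
    obtain h where h: "h \<in> H" "(\<lambda>N. vnorm ((\<Sum>n<N. \<beta> n * (\<phi> n * f)) - h)) \<longlonglongrightarrow> 0"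
      "vnorm h \<le> \<kappa> * tensor_l2_norm ip (\<lambda>n. \<phi> n * f)"
      by blast
    have "\<beta> n * (\<phi> n * f) \<in> H" for n using \<beta>(1)[of n] 1(5)[OF f] by (simp add: Mult_def)
    then have S: "(\<Sum>n<N. \<beta> n * (\<phi> n * f)) \<in> H" for N by (intro sum_in)
    have "(\<lambda>n. \<beta> n z * \<phi> n z * f z) sums h z" for z
      using tendsto_evaluation[OF S h(1,2), of z] by (simp add: sums_def sum_fun_apply mult.assoc)
    moreover have "tensor_l2_norm ip (\<lambda>n. \<phi> n * f) \<le> M * vnorm f"
      unfolding tensor_l2_norm_def sums_unique[OF 1(6)[OF f], symmetric]
      using s(2)[OF f] N' I0[OF f] by (intro real_le_lsqrt) (auto simp: power_mult_distrib)
    then have "vnorm h \<le> \<kappa> * (M * vnorm f)"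
      using h(3) mult_left_mono[OF _ \<kappa>] order_trans by blast
    ultimately show ?thesis using h(1) by (auto simp: mult.assoc)
  qed
  then obtain h where h: "\<And>f. f \<in> I \<Longrightarrow> h f \<in> H" "\<And>f z. f \<in> I \<Longrightarrow> (\<lambda>n. \<beta> n z * \<phi> n z * f z) sums h f z"
    "\<And>f. f \<in> I \<Longrightarrow> vnorm (h f) \<le> \<kappa> * M * vnorm f" by metis
  \<comment> \<open>Testing on \<open>1\<close> gives pointwise convergence of the series for
    \<open>\<psi>\<close> itself; the other \<open>h f\<close> must then equal
    \<open>\<psi> * f\<close>.\<close>
  define \<psi> where "\<psi> = h 1"
  have \<psi>: "(\<lambda>n. \<beta> n z * \<phi> n z) sums \<psi> z" for z using h(2)[OF I(3), of z] by (simp add: \<psi>_def)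
  have hf: "h f = \<psi> * f" if "f \<in> I" for f
    using sums_unique2[OF h(2)[OF that] sums_mult2[OF \<psi>]] by (auto simp: fun_eq_iff)
  have "(\<theta> * g) z = (\<psi> * G) z" for z
  proof (rule sums_unique2[OF 1(4)])
    show "(\<lambda>i. \<phi> i z * \<gamma> i z) sums (\<psi> * G) z"
      using sums_mult2[OF \<psi>[of z], of "G z"] \<beta>(3) by (simp add: mult_ac)
  qed
  then have eq: "\<theta> * g = \<psi> * G" by (simp add: fun_eq_iff)
  have "\<psi> * f \<in> H \<and> vnorm (\<psi> * f) \<le> \<kappa> * M * vnorm f" if "f \<in> insert 1 J" for f
  proof (cases "f = 0")
    case False
    then have "f \<in> I" using that by (auto simp: I_def)
    then show ?thesis using h hf by metis
  qed simp
  then show thesis using that[OF G(1) nG eq] by blast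
qed

text \<open>By \<open>ball_iff\<close> the set is an intersection of closed conditions, each
  depending on finitely many values of \<open>F p\<close>.\<close>

lemma closed_ball_comp:
  fixes F :: "'p::topological_space \<Rightarrow> 'x \<Rightarrow> complex"
  assumes "\<And>z. continuous_on UNIV (\<lambda>p. F p z)" "M \<ge> 0"
  shows "closed {p. F p \<in> H \<and> vnorm (F p) \<le> M}"
  unfolding ball_iff[OF assms(2)]
proof (intro closed_Collect_all)
  fix Y c
  show "closed {p. finite Y \<longrightarrow> cmod (\<Sum>w\<in>Y. c w * cnj (F p w))
      \<le> M * vnorm (\<Sum>w\<in>Y. (\<lambda>z. c w * (1 / (1 - ipE (b z) (b w)))))}"
    by (cases "finite Y") (auto intro!: closed_Collect_le continuous_intros assms(1))
qed

text \<open>Tychonoff's theorem passes from finite families of test functions to all of \<open>H\<close>.\<close>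

lemma multiplier_factorization:
  assumes cr: "column_row_property H ip \<kappa>"
    and \<theta>: "\<And>h. h \<in> W \<Longrightarrow> \<theta> * h \<in> W \<and> wnorm (\<theta> * h) \<le> N * wnorm h" and N: "0 \<le> N" "N < M"
    and g: "g \<in> H" "g \<noteq> 0"
  obtains \<psi> G where "G \<in> H" "vnorm G \<le> vnorm g" "\<theta> * g = \<psi> * G"
    "\<And>f. f \<in> H \<Longrightarrow> \<psi> * f \<in> H \<and> vnorm (\<psi> * f) \<le> \<kappa> * M * vnorm f"
proof -
  have \<kappa>M: "0 \<le> \<kappa> * M" using column_row_constant_nonneg[OF cr] N by simp
  obtain C where C: "\<And>z. C z \<ge> 0" "\<And>z f. f \<in> H \<Longrightarrow> cmod (f z) \<le> C z * vnorm f"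
    using evaluation_le by metis
  \<comment> \<open>Compact boxes for the values of \<open>\<psi>\<close> and \<open>G\<close>; the
    first uses that \<open>\<psi> = \<psi> * 1\<close> has norm at most
    \<open>\<kappa> * M * vnorm 1\<close>.\<close>
  define X where "X z = cball (0::complex) (C z * (\<kappa> * M * vnorm 1)) \<times> cball (0::complex) (C z * vnorm g)" for z
  \<comment> \<open>Each \<open>A f\<close> also carries the identity for
    \<open>\<theta> * g\<close> and the bound for \<open>G\<close>, so that both survive in the
    intersection.\<close>
  define A where "A f = {p :: 'x \<Rightarrow> complex \<times> complex. (\<forall>z. \<theta> z * g z = fst (p z) * snd (p z)) \<and>
    ((\<lambda>z. snd (p z)) \<in> H \<and> vnorm (\<lambda>z. snd (p z)) \<le> vnorm g) \<and>
    ((\<lambda>z. fst (p z) * f z) \<in> H \<and> vnorm (\<lambda>z. fst (p z) * f z) \<le> \<kappa> * M * vnorm f)}" for f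
  have "compactin (product_topology (\<lambda>_. euclidean) UNIV) (PiE UNIV X)"
    unfolding compactin_PiE by (auto simp: X_def intro: compact_Times)
  then have comp: "compact (PiE UNIV X)" by (simp add: euclidean_product_topology)
  have cont: "continuous_on UNIV (\<lambda>p :: 'x \<Rightarrow> complex \<times> complex. fst (p z))"
    "continuous_on UNIV (\<lambda>p :: 'x \<Rightarrow> complex \<times> complex. snd (p z))" for z
    by (intro continuous_intros continuous_on_product_coordinates)+
  have closed: "closed (A f)" if "f \<in> H" for f
    unfolding A_def
    by (intro closed_Collect_conj closed_Collect_all closed_Collect_eq closed_ball_comp continuous_intros cont)
       (use that g \<kappa>M in auto)
  have fip: "PiE UNIV X \<inter> \<Inter>(A ` J) \<noteq> {}" if J: "finite J" "J \<subseteq> H" for J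
  proof -
    obtain \<psi> G where G: "G \<in> H" "vnorm G \<le> vnorm g" "\<theta> * g = \<psi> * G"
      "\<And>f. f \<in> insert 1 J \<Longrightarrow> \<psi> * f \<in> H \<and> vnorm (\<psi> * f) \<le> \<kappa> * M * vnorm f"
      using finite_family_factorization[OF cr \<theta> N g J] by metis
    define p where "p z = (\<psi> z, G z)" for z
    have \<psi>1: "\<psi> \<in> H" "vnorm \<psi> \<le> \<kappa> * M * vnorm 1" using G(4)[of 1] by auto
    have "cmod (\<psi> z) \<le> C z * (\<kappa> * M * vnorm 1)" "cmod (G z) \<le> C z * vnorm g" for z
      using C(2)[OF \<psi>1(1), of z] C(2)[OF G(1), of z] mult_left_mono[OF \<psi>1(2) C(1)[of z]]
        mult_left_mono[OF G(2) C(1)[of z]] by linarith+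
    then have "p \<in> PiE UNIV X" by (auto simp: p_def X_def)
    moreover have "p \<in> A f" if "f \<in> J" for f
    proof -
      have "(\<lambda>z. \<psi> z * f z) = \<psi> * f" by (simp add: fun_eq_iff)
      moreover have "\<theta> z * g z = \<psi> z * G z" for z using G(3) by (simp add: fun_eq_iff)
      ultimately show ?thesis using G(1,2) G(4)[of f] that by (simp add: A_def p_def)
    qed
    ultimately show ?thesis by blast
  qed
  have "PiE UNIV X \<inter> \<Inter>(A ` H) \<noteq> {}"
  proof (rule compact_imp_fip[OF comp])
    show "closed T" if "T \<in> A ` H" for T using that closed by auto
    fix F assume "finite F" "F \<subseteq> A ` H"
    then obtain J where "finite J" "J \<subseteq> H" "F = A ` J" by (meson finite_subset_image)
    then show "PiE UNIV X \<inter> \<Inter>F \<noteq> {}" using fip by simp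
  qed
  then obtain p where p: "\<And>f. f \<in> H \<Longrightarrow> p \<in> A f" by blast
  define \<psi> G where "\<psi> = (\<lambda>z. fst (p z))" and "G = (\<lambda>z. snd (p z))"
  show thesis
  proof (rule that[of G \<psi>])
    show "G \<in> H" "vnorm G \<le> vnorm g" "\<theta> * g = \<psi> * G"
      using p[OF one_in] by (auto simp: A_def \<psi>_def G_def fun_eq_iff)
    fix f assume f: "f \<in> H"
    have "\<psi> * f = (\<lambda>z. fst (p z) * f z)" by (simp add: \<psi>_def fun_eq_iff)
    then show "\<psi> * f \<in> H \<and> vnorm (\<psi> * f) \<le> \<kappa> * M * vnorm f" using p[OF f] by (simp add: A_def)
  qed
qed

text \<open>The multiplier \<open>\<psi>\<close> is applied to its own partner \<open>G\<close>,
  whose norm is at most that of \<open>g\<close>. This settles every \<open>M > N\<close>, and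
  \<open>M\<close> then decreases to \<open>N\<close>.\<close>

lemma weak_product_multiplier:
  assumes cr: "column_row_property H ip \<kappa>"
    and \<theta>: "\<And>h. h \<in> W \<Longrightarrow> \<theta> * h \<in> W \<and> wnorm (\<theta> * h) \<le> N * wnorm h" and N: "0 \<le> N"
    and g: "g \<in> H"
  shows "\<theta> * g \<in> H \<and> vnorm (\<theta> * g) \<le> \<kappa> * N * vnorm g"
proof (cases "g = 0")
  case False
  have \<kappa>: "0 \<le> \<kappa>" using cr by (rule column_row_constant_nonneg)
  have M: "\<theta> * g \<in> H \<and> vnorm (\<theta> * g) \<le> \<kappa> * M * vnorm g" if M: "N < M" for M
  proof -
    obtain \<psi> G where G: "G \<in> H" "vnorm G \<le> vnorm g" "\<theta> * g = \<psi> * G"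
      "\<And>f. f \<in> H \<Longrightarrow> \<psi> * f \<in> H \<and> vnorm (\<psi> * f) \<le> \<kappa> * M * vnorm f"
      using multiplier_factorization[OF cr \<theta> N M g False] by metis
    have "vnorm (\<psi> * G) \<le> \<kappa> * M * vnorm G" using G by blast
    also have "\<dots> \<le> \<kappa> * M * vnorm g" using G(2) \<kappa> N M by (intro mult_left_mono) auto
    finally show ?thesis using G by simp
  qed
  have "vnorm (\<theta> * g) \<le> \<kappa> * N * vnorm g"
  proof (rule field_le_epsilon)
    fix e :: real assume e: "e > 0"
    define d where "d = e / (\<kappa> * vnorm g + 1)"
    have pos: "\<kappa> * vnorm g + 1 > 0" using \<kappa> g by (simp add: add_nonneg_pos)
    have d: "d > 0" "\<kappa> * vnorm g * d \<le> e" using e pos by (auto simp: d_def field_simps)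
    have "vnorm (\<theta> * g) \<le> \<kappa> * (N + d) * vnorm g" using M[of "N + d"] d by simp
    also have "\<dots> = \<kappa> * N * vnorm g + \<kappa> * vnorm g * d" by (simp add: algebra_simps)
    finally show "vnorm (\<theta> * g) \<le> \<kappa> * N * vnorm g + e" using d(2) by simp
  qed
  then show ?thesis using M[of "N + 1"] by simp
qed simp

end

theorem corollary1p3:
  fixes H :: "('x \<Rightarrow> complex) set"
    and ip :: "('x \<Rightarrow> complex) \<Rightarrow> ('x \<Rightarrow> complex) \<Rightarrow> complex"
    and scaleE :: "complex \<Rightarrow> 'e::ab_group_add \<Rightarrow> 'e"
    and E :: "'e set"
    and ipE :: "'e \<Rightarrow> 'e \<Rightarrow> complex"
    and b :: "'x \<Rightarrow> 'e"
    and \<kappa> :: real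
  assumes "normalized_cnp_space H ip scaleE E ipE b"
    and "separable H ip"
    and "column_row_property H ip \<kappa>"
  shows "Mult H = Mult (weak_product H ip) \<and>
    (\<forall>\<theta>\<in>Mult H.
      mult_norm (weak_product H ip) (weak_product_norm H ip) \<theta> \<le> mult_norm H (ip_norm ip) \<theta> \<and>
      mult_norm H (ip_norm ip) \<theta> \<le>
        \<kappa> * mult_norm (weak_product H ip) (weak_product_norm H ip) \<theta>)"
proof -
  interpret normalized_cnp_space H ip scaleE E ipE b by fact
  interpret BH: banach_function_space H "ip_norm ip" by (rule banach_function_space)
  interpret BW: banach_function_space W wnorm by (rule weak_product_banach_function_space)
  have sub: "\<theta> \<in> Mult W" and le: "mult_norm W wnorm \<theta> \<le> mult_norm H (ip_norm ip) \<theta>" if "\<theta> \<in> Mult H" for \<theta>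
  proof -
    have "\<theta> * h \<in> W" "wnorm (\<theta> * h) \<le> mult_norm H (ip_norm ip) \<theta> * wnorm h" if "h \<in> W" for h
      using mult_weak_product[OF \<open>\<theta> \<in> Mult H\<close> BH.mult_norm_bound[OF \<open>\<theta> \<in> Mult H\<close>] that] by auto
    then show "\<theta> \<in> Mult W" "mult_norm W wnorm \<theta> \<le> mult_norm H (ip_norm ip) \<theta>"
      using BH.mult_norm_bound(1)[OF that] by (auto simp: Mult_def intro: BW.mult_norm_le)
  qed
  \<comment> \<open>An arbitrary multiplier of the weak product has finite operator norm by
    \<open>multiplication_bounded\<close>, so the quantitative result applies with that norm as
    \<open>N\<close>.\<close>
  have sup: "\<theta> * g \<in> H \<and> ip_norm ip (\<theta> * g) \<le> \<kappa> * mult_norm W wnorm \<theta> * ip_norm ip g"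
    if \<theta>: "\<theta> \<in> Mult W" and g: "g \<in> H" for \<theta> g
  proof (rule weak_product_multiplier[OF assms(3) _ BW.mult_norm_bound(1)[OF \<theta>] g])
    show "\<theta> * h \<in> W \<and> wnorm (\<theta> * h) \<le> mult_norm W wnorm \<theta> * wnorm h" if "h \<in> W" for h
      using \<theta> BW.mult_norm_bound(2)[OF \<theta> that] that by (simp add: Mult_def)
  qed
  have "\<theta> \<in> Mult H" if "\<theta> \<in> Mult W" for \<theta> using sup[OF that] by (auto simp: Mult_def)
  moreover have "mult_norm H (ip_norm ip) \<theta> \<le> \<kappa> * mult_norm W wnorm \<theta>" if "\<theta> \<in> Mult H" for \<theta>
    using sup[OF sub[OF that]] column_row_constant_nonneg[OF assms(3)] BW.mult_norm_bound(1)[OF sub[OF that]]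
    by (intro BH.mult_norm_le) auto
  ultimately show ?thesis using sub le by blast
qed

end
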